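(* Let $\Bbbk$ be a field and let $G$ be a $2$-connected bipartite graph. (1) $\mathrm{Cl}(\Bbbk[G])\cong\mathbb{Z}$ if and only if $G$ is (isomorphic to) a complete bipartite graph $K_{s_1,s_2}$ with $s_1,s_2\ge2$. (2) $\mathrm{Cl}(\Bbbk[G])\cong\mathbb{Z}^2$ if and only if $G$ is (isomorphic to) a bipartite graph $K_{s_1,s_2}^{t_1,t_2}$ for some $t_1,t_2\ge1$ and $s_1,s_2\ge2$.
   Context: Graphs are finite and simple. The edge ring of a graph $G$ on $[d]$ is $\Bbbk[G]=\Bbbk[t_it_j:\{i,j\}\in E(G)]\subset\Bbbk[t_1,\dots,t_d]$; it is a normal domain for bipartite $G$. $\mathrm{Cl}$ is the (divisor) class group. For integers $s_1,s_2\ge1$ and $t_1,t_2\ge0$, $K_{s_1,s_2}^{t_1,t_2}$ is the bipartite graph on $[d]$, $d=s_1+s_2+t_1+t_2$, with edge set $\{\{i,j\}:1\le i\le s_1+t_1,\ s_1+t_1+t_2+1\le j\le d\}\cup\{\{i,j\}:1\le i\le s_1,\ s_1+t_1+1\le j\le d\}$. (Thus its two sides have $s_1+t_1$ and $s_2+t_2$ vertices, and it is the complete bipartite graph on these sides with all edges between the $t_1$ vertices $s_1+1,\dots,s_1+t_1$ and the $t_2$ vertices $s_1+t_1+1,\dots,s_1+t_1+t_2$ removed.) *)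

theory Defs
  imports
    "HOL-Library.Poly_Mapping"
    "HOL-Computational_Algebra.Polynomial_Factorial"
    "HOL-Algebra.Elementary_Groups"
begin

section \<open>Graphs\<close>

text \<open>A graph is a vertex set together with a set of two-element sets of vertices.\<close>

definition simple_graph :: "'v set \<Rightarrow> 'v set set \<Rightarrow> bool" where
  "simple_graph V E \<longleftrightarrow> finite V \<and> (\<forall>e\<in>E. e \<subseteq> V \<and> card e = 2)"

definition connected_graph :: "'v set \<Rightarrow> 'v set set \<Rightarrow> bool" where
  "connected_graph V E \<longleftrightarrow> V \<noteq> {} \<and> (\<forall>u\<in>V. \<forall>v\<in>V. (u, v) \<in> {(a, b). {a, b} \<in> E}\<^sup>*)"

definition two_connected :: "'v set \<Rightarrow> 'v set set \<Rightarrow> bool" where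
  "two_connected V E \<longleftrightarrow> card V \<ge> 3 \<and> connected_graph V E \<and>
     (\<forall>v\<in>V. connected_graph (V - {v}) {e \<in> E. v \<notin> e})"

definition bipartite :: "'v set \<Rightarrow> 'v set set \<Rightarrow> bool" where
  "bipartite V E \<longleftrightarrow> (\<exists>A B. A \<union> B = V \<and> A \<inter> B = {} \<and> (\<forall>e\<in>E. \<exists>a\<in>A. \<exists>b\<in>B. e = {a, b}))"

definition graph_iso :: "'v set \<Rightarrow> 'v set set \<Rightarrow> 'w set \<Rightarrow> 'w set set \<Rightarrow> bool" where
  "graph_iso V E V' E' \<longleftrightarrow>
     (\<exists>f. bij_betw f V V' \<and> (\<forall>u\<in>V. \<forall>v\<in>V. {u, v} \<in> E \<longleftrightarrow> {f u, f v} \<in> E'))"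

definition complete_bipartite_edges :: "nat \<Rightarrow> nat \<Rightarrow> nat set set" where
  "complete_bipartite_edges s1 s2 = {{i, j} | i j. i \<in> {1..s1} \<and> j \<in> {s1 + 1..s1 + s2}}"

definition K_edges :: "nat \<Rightarrow> nat \<Rightarrow> nat \<Rightarrow> nat \<Rightarrow> nat set set" where
  "K_edges s1 s2 t1 t2 =
     {{i, j} | i j. i \<in> {1..s1 + t1} \<and> j \<in> {s1 + t1 + t2 + 1..s1 + s2 + t1 + t2}} \<union>
     {{i, j} | i j. i \<in> {1..s1} \<and> j \<in> {s1 + t1 + 1..s1 + s2 + t1 + t2}}"

lemma K_edges_0_0: "K_edges s1 s2 0 0 = complete_bipartite_edges s1 s2"
  by (simp add: K_edges_def complete_bipartite_edges_def)


section \<open>Edge rings\<close>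

text \<open>
  Polynomials in the variables \<open>t\<^sub>i\<close>, \<open>i :: nat\<close>, are finitely supported functions from exponent
  vectors to coefficients. For a graph on \<open>{1..d}\<close> only \<open>t\<^sub>1, \<dots>, t\<^sub>d\<close> occur in the edge ring.
\<close>

type_synonym 'k mpoly_ring = "(nat \<Rightarrow>\<^sub>0 nat) \<Rightarrow>\<^sub>0 'k"

definition var :: "nat \<Rightarrow> 'k::field mpoly_ring" where
  "var i = Poly_Mapping.single (Poly_Mapping.single i 1) 1"

inductive_set edge_ring :: "nat set set \<Rightarrow> 'k::field mpoly_ring set"
  for E :: "nat set set" where
  const: "Poly_Mapping.single 0 c \<in> edge_ring E"
| edge: "{i, j} \<in> E \<Longrightarrow> var i * var j \<in> edge_ring E"
| add: "p \<in> edge_ring E \<Longrightarrow> q \<in> edge_ring E \<Longrightarrow> p + q \<in> edge_ring E"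
| mult: "p \<in> edge_ring E \<Longrightarrow> q \<in> edge_ring E \<Longrightarrow> p * q \<in> edge_ring E"


section \<open>The divisor class group\<close>

text \<open>
  In this section \<open>R\<close> is a subring of a field; its field of fractions is formed inside
  that field.
\<close>

definition frac_field :: "'f::field set \<Rightarrow> 'f set" where
  "frac_field R = {a / b | a b. a \<in> R \<and> b \<in> R \<and> b \<noteq> 0}"

definition fractional_ideal :: "'f::field set \<Rightarrow> 'f set \<Rightarrow> bool" where
  "fractional_ideal R I \<longleftrightarrow>
     I \<subseteq> frac_field R \<and> 0 \<in> I \<and> I \<noteq> {0} \<and>
     (\<forall>x\<in>I. \<forall>y\<in>I. x + y \<in> I) \<and> (\<forall>r\<in>R. \<forall>x\<in>I. r * x \<in> I) \<and>
     (\<exists>d\<in>R. d \<noteq> 0 \<and> (\<forall>x\<in>I. d * x \<in> R))"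

definition ideal_inverse :: "'f::field set \<Rightarrow> 'f set \<Rightarrow> 'f set" where
  "ideal_inverse R I = {x \<in> frac_field R. \<forall>y\<in>I. x * y \<in> R}"

definition divisorial_closure :: "'f::field set \<Rightarrow> 'f set \<Rightarrow> 'f set" where
  "divisorial_closure R I = ideal_inverse R (ideal_inverse R I)"

definition fractional_ideal_prod :: "'f::field set \<Rightarrow> 'f set \<Rightarrow> 'f set" where
  "fractional_ideal_prod I J = {\<Sum>k<n. x k * y k | (n::nat) x y. \<forall>k<n. x k \<in> I \<and> y k \<in> J}"

text \<open>
  The divisorial fractional ideals form a group under \<open>(I, J) \<mapsto> (R : (R : IJ))\<close> if \<open>R\<close> is
  completely integrally closed, in particular if \<open>R\<close> is a Noetherian normal domain.
\<close>

definition divisor_group :: "'f::field set \<Rightarrow> 'f set monoid" where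
  "divisor_group R =
     \<lparr>carrier = {I. fractional_ideal R I \<and> divisorial_closure R I = I},
      monoid.mult = (\<lambda>I J. divisorial_closure R (fractional_ideal_prod I J)),
      one = R\<rparr>"

definition principal_divisors :: "'f::field set \<Rightarrow> 'f set set" where
  "principal_divisors R = {(\<lambda>r. x * r) ` R | x. x \<in> frac_field R \<and> x \<noteq> 0}"

definition class_group :: "'f::field set \<Rightarrow> 'f set set monoid" where
  "class_group R = divisor_group R Mod principal_divisors R"

text \<open>The class group of a subring \<open>R\<close> of an integral domain, embedded in the fraction field of the latter.\<close>

definition Cl :: "'a::idom set \<Rightarrow> 'a fract set set monoid" where
  "Cl R = class_group (to_fract ` R)"

end

theory Submission
  imports Defs "HOL-Algebra.Free_Abelian_Groups"
begin

text \<open>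
  Let \<open>A\<close>, \<open>B\<close> be the sides of the graph and \<open>M\<close> the lattice of the integer vectors on the vertices
  with equal sums over \<open>A\<close> and \<open>B\<close>. By Hall's theorem the edge ring is spanned by the monomials
  whose exponents lie in the cone cut out of \<open>M\<close> by the facets \<open>x\<^sub>v \<ge> 0\<close> for the vertices \<open>v\<close> and
  \<open>x(N T) \<ge> x(T)\<close> for the \<open>T \<subset> A\<close> such that \<open>N T \<noteq> B\<close> and both \<open>T \<union> N T\<close> and its complement are
  connected. The Laurent ring with exponents in \<open>M\<close> is factorial by Gauss' lemma, so every
  divisorial ideal is a multiple of a monomial one, given by one integer per facet. Hence the class
  group is \<open>\<int>\<close> to the facets modulo \<open>M\<close>, a free abelian group whose rank is one more than the number
  of the sets \<open>T\<close>. Every pair of non-adjacent vertices in \<open>A \<times> B\<close> is separated by such a \<open>T\<close>: there is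
  no \<open>T\<close> exactly for complete bipartite graphs, and exactly one \<open>T\<close> exactly when the missing edges
  form a product \<open>T \<times> U\<close>.
\<close>


section \<open>Factorial subrings\<close>

text \<open>The class group is defined for a subset of a field, and the lattices in the proof grow
  by one coordinate at a time. Hence divisibility, primality and factoriality are relative to a
  carrier set inside an ambient domain, and Gauss' lemma is proved in that form. Factoriality of the
  Laurent ring is used only through greatest common divisors, which strip from a divisorial ideal
  everything that is not monomial. The remaining bounds, one per facet, are determined by the
  monomial ideal because the facets are irredundant and primitive: each bound is attained by an
  exponent. Two-connectedness enters through irredundance and through the bounds s1, s2 \<ge> 2. The
  rank is a count: there is one facet per vertex and one per T, while M is cut out by a single
  equation and has rank one less than the number of vertices. The quotient is free because a lattice
  vector can be read off from its vertex coordinates: the invariants of a class are the imbalance of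
  these coordinates and, for each T, the deviation of the coordinate at T from the value that the
  vertex coordinates predict.\<close>

definition subring_of :: "'a::comm_ring_1 set \<Rightarrow> bool" where
  "subring_of A \<longleftrightarrow> 1 \<in> A \<and> (\<forall>x\<in>A. \<forall>y\<in>A. x + y \<in> A \<and> x * y \<in> A) \<and> (\<forall>x\<in>A. - x \<in> A)"

definition dvd_in :: "'a::comm_ring_1 set \<Rightarrow> 'a \<Rightarrow> 'a \<Rightarrow> bool" where
  "dvd_in A x y \<longleftrightarrow> (\<exists>z\<in>A. y = x * z)"

text \<open>Units count as primes here, so that products of primes need no extra unit factor.\<close>

definition prime_in :: "'a::comm_ring_1 set \<Rightarrow> 'a \<Rightarrow> bool" where
  "prime_in A p \<longleftrightarrow> p \<in> A \<and> p \<noteq> 0 \<and>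
     (\<forall>a\<in>A. \<forall>b\<in>A. dvd_in A p (a * b) \<longrightarrow> dvd_in A p a \<or> dvd_in A p b)"

definition prime_products :: "'a::comm_ring_1 set \<Rightarrow> 'a set" where
  "prime_products A = {prod_list ps | ps. \<forall>p\<in>set ps. prime_in A p}"

definition factorial_in :: "'a::comm_ring_1 set \<Rightarrow> bool" where
  "factorial_in A \<longleftrightarrow> subring_of A \<and> A - {0} \<subseteq> prime_products A"

lemma
  assumes "subring_of A"
  shows subring_1: "1 \<in> A" and subring_0: "0 \<in> A"
    and subring_add: "x \<in> A \<Longrightarrow> y \<in> A \<Longrightarrow> x + y \<in> A"
    and subring_mult: "x \<in> A \<Longrightarrow> y \<in> A \<Longrightarrow> x * y \<in> A"
    and subring_uminus: "x \<in> A \<Longrightarrow> - x \<in> A"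
    and subring_diff: "x \<in> A \<Longrightarrow> y \<in> A \<Longrightarrow> x - y \<in> A"
proof -
  show 1: "1 \<in> A" and a: "x \<in> A \<Longrightarrow> y \<in> A \<Longrightarrow> x + y \<in> A"
    and "x \<in> A \<Longrightarrow> y \<in> A \<Longrightarrow> x * y \<in> A" and u: "x \<in> A \<Longrightarrow> - x \<in> A" for x y
    using assms by (auto simp: subring_of_def)
  show "0 \<in> A" using a[OF 1 u[OF 1]] by simp
  show "x \<in> A \<Longrightarrow> y \<in> A \<Longrightarrow> x - y \<in> A" using a u by (metis diff_conv_add_uminus)
qed

lemma subring_sum:
  assumes "subring_of A" and "\<And>i. i \<in> I \<Longrightarrow> f i \<in> A"
  shows "sum f I \<in> A"
  using assms(2) by (induction I rule: infinite_finite_induct)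
    (auto intro: subring_add[OF assms(1)] subring_0[OF assms(1)])

lemma subring_power:
  assumes "subring_of A" and "x \<in> A"
  shows "x ^ n \<in> A"
  using assms by (induction n) (auto intro: subring_mult subring_1)

lemma subring_prod_list:
  assumes "subring_of A" and "set ps \<subseteq> A"
  shows "prod_list ps \<in> A"
  using assms by (induction ps) (auto intro: subring_mult subring_1)

lemma dvd_in_mult:
  assumes "subring_of A" and "dvd_in A x y" and "c \<in> A"
  shows "dvd_in A x (y * c)" and "dvd_in A x (c * y)"
  using assms unfolding dvd_in_def
  by (metis mult.assoc subring_mult, metis mult.assoc mult.commute subring_mult)

lemma dvd_in_trans:
  assumes "subring_of A" and "dvd_in A x y" and "dvd_in A y z"
  shows "dvd_in A x z"
  using assms unfolding dvd_in_def by (metis mult.assoc subring_mult)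

lemma dvd_in_0: "subring_of A \<Longrightarrow> dvd_in A x 0"
  unfolding dvd_in_def by (metis mult_zero_right subring_0)

lemma dvd_in_add:
  assumes "subring_of A" and "dvd_in A x y" and "dvd_in A x z"
  shows "dvd_in A x (y + z)"
  using assms unfolding dvd_in_def by (metis distrib_left subring_add)

lemma dvd_in_diff:
  assumes "subring_of A" and "dvd_in A x y" and "dvd_in A x z"
  shows "dvd_in A x (y - z)"
  using assms unfolding dvd_in_def by (metis right_diff_distrib subring_diff)

lemma dvd_in_sum:
  assumes "subring_of A" and "\<And>i. i \<in> I \<Longrightarrow> dvd_in A x (f i)"
  shows "dvd_in A x (sum f I)"
  using assms(2) by (induction I rule: infinite_finite_induct)
    (auto intro: dvd_in_add[OF assms(1)] dvd_in_0[OF assms(1)])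

lemma prime_in_mem: "prime_in A p \<Longrightarrow> p \<in> A"
  and prime_in_nonzero: "prime_in A p \<Longrightarrow> p \<noteq> 0"
  and prime_in_dvd_mult:
    "prime_in A p \<Longrightarrow> a \<in> A \<Longrightarrow> b \<in> A \<Longrightarrow> dvd_in A p (a * b) \<Longrightarrow> dvd_in A p a \<or> dvd_in A p b"
  by (auto simp: prime_in_def)

lemma prime_in_unit:
  fixes u :: "'a::idom"
  assumes "subring_of A" and "u \<in> A" and "v \<in> A" and "u * v = 1"
  shows "prime_in A u"
proof -
  have "dvd_in A u a" if "a \<in> A" for a
    unfolding dvd_in_def
    by (rule bexI[of _ "v * a"]) (use assms that in \<open>auto simp: mult.assoc[symmetric] intro: subring_mult[OF assms(1)]\<close>)
  then show ?thesis using assms by (auto simp: prime_in_def)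
qed

lemma prime_in_dvd_power:
  assumes "subring_of A" and "prime_in A p" and "a \<in> A" and "dvd_in A p (a ^ n)"
  shows "dvd_in A p 1 \<or> dvd_in A p a"
  using assms(4)
proof (induction n)
  case (Suc n)
  then show ?case
    using prime_in_dvd_mult[OF assms(2,3), of "a ^ n"] subring_power[OF assms(1,3)] by auto
qed simp

lemma prime_in_dvd_prod_list:
  assumes "subring_of A" and "prime_in A p" and "set qs \<subseteq> A" and "dvd_in A p (prod_list qs)"
  shows "dvd_in A p 1 \<or> (\<exists>q\<in>set qs. dvd_in A p q)"
  using assms(3,4)
proof (induction qs)
  case (Cons q qs)
  then show ?case
    using prime_in_dvd_mult[OF assms(2), of q "prod_list qs"] subring_prod_list[OF assms(1)] by auto
qed simp

lemma prime_products_mult: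
  assumes "x \<in> prime_products A" and "y \<in> prime_products A"
  shows "x * y \<in> prime_products A"
proof -
  obtain ps qs where "x = prod_list ps" "\<forall>p\<in>set ps. prime_in A p"
    "y = prod_list qs" "\<forall>p\<in>set qs. prime_in A p"
    using assms unfolding prime_products_def by auto
  then show ?thesis
    unfolding prime_products_def by (intro CollectI exI[of _ "ps @ qs"]) auto
qed

lemma prime_products_prime:
  assumes "prime_in A p"
  shows "p \<in> prime_products A"
  unfolding prime_products_def by (intro CollectI exI[of _ "[p]"]) (auto simp: assms)

lemma factorial_inE:
  assumes "factorial_in A" and "x \<in> A" and "x \<noteq> 0"
  obtains ps where "x = prod_list ps" and "\<forall>p\<in>set ps. prime_in A p" and "set ps \<subseteq> A"
proof -
  have "x \<in> prime_products A" using assms unfolding factorial_in_def by blast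
  then obtain ps where "x = prod_list ps" "\<forall>p\<in>set ps. prime_in A p"
    unfolding prime_products_def by blast
  then show ?thesis using that[of ps] prime_in_mem by blast
qed

lemma factorial_in_subring: "factorial_in A \<Longrightarrow> subring_of A"
  by (simp add: factorial_in_def)

section \<open>Greatest common divisors in factorial subrings\<close>

lemma prod_list_remove1:
  fixes ps :: "'a::comm_monoid_mult list"
  assumes "p \<in> set ps"
  shows "prod_list ps = p * prod_list (remove1 p ps)"
  using assms by (induction ps) (auto simp: ac_simps)

text \<open>A prime q that fails to divide some g in G can be cancelled:
  \<open>r * prod_list (q # qs) = s * w\<close> and \<open>r * g = s * wg\<close> show that q
  divides \<open>w * g\<close>, hence w. Once all the primes are gone, r itself is a multiple of
  s.\<close>

lemma factorial_in_gcd_aux: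
  fixes A :: "'a::idom set"
  assumes A: "subring_of A"
    and G: "G \<subseteq> A" and s: "s \<noteq> 0"
    and dvd: "\<forall>g\<in>G. dvd_in A s (r * g)"
  shows "\<forall>q\<in>set qs. prime_in A q \<and> (\<exists>g\<in>G. \<not> dvd_in A q g) \<Longrightarrow> dvd_in A s (r * prod_list qs) \<Longrightarrow>
     dvd_in A s r"
proof (induction qs)
  case (Cons q qs)
  from Cons.prems(1) obtain g where g: "g \<in> G" "\<not> dvd_in A q g" and q: "prime_in A q" by auto
  obtain w where w: "w \<in> A" "r * prod_list (q # qs) = s * w" using Cons.prems(2) by (auto simp: dvd_in_def)
  obtain wg where wg: "wg \<in> A" "r * g = s * wg" using dvd g by (auto simp: dvd_in_def)
  have qsA: "prod_list qs \<in> A"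
    using Cons.prems(1) by (intro subring_prod_list A) (auto dest: prime_in_mem)
  have "s * (w * g) = r * g * (q * prod_list qs)" using w by (simp add: algebra_simps)
  also have "\<dots> = s * (q * (wg * prod_list qs))" using wg by (simp add: algebra_simps)
  finally have "w * g = q * (wg * prod_list qs)" using s by simp
  then have "dvd_in A q (w * g)" using wg qsA by (auto simp: dvd_in_def intro: subring_mult[OF A])
  then have "dvd_in A q w" using prime_in_dvd_mult[OF q w(1), of g] g G by auto
  then obtain w' where w': "w' \<in> A" "w = q * w'" by (auto simp: dvd_in_def)
  have "q * (r * prod_list qs) = q * (s * w')" using w w' by (simp add: algebra_simps)
  then have "r * prod_list qs = s * w'" using prime_in_nonzero[OF q] by simp
  then have "dvd_in A s (r * prod_list qs)" using w' by (auto simp: dvd_in_def)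
  then show ?case using Cons by auto
qed simp

text \<open>The last clause is the gcd property for fractions: if s / r divides all of G, it divides
  f. This form survives division of G by a common prime. G may be infinite, so the induction runs
  over the prime factors of one nonzero member of G: either one of them divides all of G and is
  split off, or none does and 1 is a gcd.\<close>

lemma factorial_in_gcd:
  fixes A :: "'a::idom set"
  assumes fac: "factorial_in A" and "G \<subseteq> A" and "\<exists>g\<in>G. g \<noteq> 0"
  shows "\<exists>f\<in>A. f \<noteq> 0 \<and> (\<forall>g\<in>G. dvd_in A f g) \<and>
    (\<forall>r\<in>A. \<forall>s\<in>A. s \<noteq> 0 \<longrightarrow> (\<forall>g\<in>G. dvd_in A s (r * g)) \<longrightarrow> dvd_in A s (r * f))"
proof -
  have A: "subring_of A" using fac by (rule factorial_in_subring)
  have *: "\<And>G. G \<subseteq> A \<Longrightarrow> prod_list ps \<in> G \<Longrightarrow> \<forall>p\<in>set ps. prime_in A p \<Longrightarrow>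
    \<exists>f\<in>A. f \<noteq> 0 \<and> (\<forall>g\<in>G. dvd_in A f g) \<and>
    (\<forall>r\<in>A. \<forall>s\<in>A. s \<noteq> 0 \<longrightarrow> (\<forall>g\<in>G. dvd_in A s (r * g)) \<longrightarrow> dvd_in A s (r * f))" for ps
  proof (induction ps rule: length_induct)
    case (1 ps G)
    show ?case
    proof (cases "\<exists>p\<in>set ps. \<forall>g\<in>G. dvd_in A p g")
      case True
      then obtain p where p: "p \<in> set ps" "\<forall>g\<in>G. dvd_in A p g" by blast
      have pp: "prime_in A p" and p0: "p \<noteq> 0" and pA: "p \<in> A"
        using p(1) 1 by (auto dest: prime_in_nonzero prime_in_mem)
      \<comment> \<open>G' is G divided by p; it contains the product of the remaining primes, so
        the induction hypothesis applies to the shorter list.\<close>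
      define G' where "G' = {g' \<in> A. p * g' \<in> G}"
      have rem: "set (remove1 p ps) \<subseteq> set ps" by (rule set_remove1_subset)
      have psA: "prod_list (remove1 p ps) \<in> A"
        using 1 rem by (intro subring_prod_list A) (auto dest: prime_in_mem)
      have "prod_list (remove1 p ps) \<in> G'"
        unfolding G'_def using 1 prod_list_remove1[OF p(1)] psA by auto
      moreover have "G' \<subseteq> A" by (auto simp: G'_def)
      moreover have "\<forall>p\<in>set (remove1 p ps). prime_in A p" using 1 rem by auto
      moreover have "length (remove1 p ps) < length ps"
        using p(1) by (metis length_pos_if_in_set length_remove1 diff_less zero_less_one)
      ultimately have "\<exists>f\<in>A. f \<noteq> 0 \<and> (\<forall>g\<in>G'. dvd_in A f g) \<and>
        (\<forall>r\<in>A. \<forall>s\<in>A. s \<noteq> 0 \<longrightarrow> (\<forall>g\<in>G'. dvd_in A s (r * g)) \<longrightarrow> dvd_in A s (r * f))"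
        by (intro 1(1)[rule_format, of "remove1 p ps" G']) simp_all
      then obtain f where f: "f \<in> A" "f \<noteq> 0" "\<forall>g\<in>G'. dvd_in A f g"
        "\<forall>r\<in>A. \<forall>s\<in>A. s \<noteq> 0 \<longrightarrow> (\<forall>g\<in>G'. dvd_in A s (r * g)) \<longrightarrow> dvd_in A s (r * f)"
        by blast
      have "dvd_in A (p * f) g" if g: "g \<in> G" for g
      proof -
        obtain g' where g': "g' \<in> A" "g = p * g'" using p g by (auto simp: dvd_in_def)
        then have "dvd_in A f g'" using f g by (auto simp: G'_def)
        then show ?thesis using g' by (auto simp: dvd_in_def mult.assoc)
      qed
      moreover have "dvd_in A s (r * (p * f))"
        if "r \<in> A" "s \<in> A" "s \<noteq> 0" "\<forall>g\<in>G. dvd_in A s (r * g)" for r s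
      proof -
        have "\<forall>g\<in>G'. dvd_in A s (r * p * g)" using that by (auto simp: G'_def mult.assoc)
        then have "dvd_in A s (r * p * f)" using f that pA by (auto intro: subring_mult[OF A])
        then show ?thesis by (simp add: mult.assoc)
      qed
      ultimately show ?thesis
        using f p0 pA by (intro bexI[of _ "p * f"]) (auto intro: subring_mult[OF A])
    next
      case False
      have "dvd_in A s r"
        if rs: "r \<in> A" "s \<in> A" "s \<noteq> 0" "\<forall>g\<in>G. dvd_in A s (r * g)" for r s
        using factorial_in_gcd_aux[OF A 1(2) rs(3,4), of ps] False 1 rs by auto
      moreover have "dvd_in A 1 g" if "g \<in> G" for g using that 1 by (auto simp: dvd_in_def)
      ultimately show ?thesis using subring_1[OF A] by (intro bexI[of _ 1]) auto
    qed
  qed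
  obtain g where g: "g \<in> G" "g \<noteq> 0" using assms by blast
  obtain ps where "g = prod_list ps" "\<forall>p\<in>set ps. prime_in A p"
    by (rule factorial_inE[OF fac]) (use g assms in auto)
  then show ?thesis using *[of G ps] g assms by auto
qed


section \<open>Gauss' lemma\<close>

definition poly_ring_over :: "'a::comm_ring_1 set \<Rightarrow> 'a poly set" where
  "poly_ring_over A = {p. \<forall>i. coeff p i \<in> A}"

lemma poly_ring_over_const [simp]: "subring_of A \<Longrightarrow> [:c:] \<in> poly_ring_over A \<longleftrightarrow> c \<in> A"
  by (auto simp: poly_ring_over_def coeff_pCons subring_0 split: nat.splits dest: spec[of _ 0])

lemma poly_ring_over_monom: "subring_of A \<Longrightarrow> c \<in> A \<Longrightarrow> monom c n \<in> poly_ring_over A"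
  by (auto simp: poly_ring_over_def subring_0)

lemma subring_poly_ring_over:
  assumes "subring_of A"
  shows "subring_of (poly_ring_over A)"
  unfolding subring_of_def
proof (intro conjI ballI)
  show "1 \<in> poly_ring_over A"
    using assms by (simp add: one_pCons subring_1)
  fix p q assume "p \<in> poly_ring_over A" "q \<in> poly_ring_over A"
  then show "p + q \<in> poly_ring_over A" "p * q \<in> poly_ring_over A"
    using assms by (auto simp: poly_ring_over_def coeff_mult intro!: subring_add subring_sum subring_mult)
next
  fix p assume "p \<in> poly_ring_over A"
  then show "- p \<in> poly_ring_over A"
    using assms by (auto simp: poly_ring_over_def intro: subring_uminus)
qed

lemma dvd_in_const_poly_iff:
  fixes A :: "'a::idom set"
  assumes A: "subring_of A" and c: "c \<noteq> 0"
  shows "dvd_in (poly_ring_over A) [:c:] p \<longleftrightarrow> (\<forall>i. dvd_in A c (coeff p i))"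
proof
  assume "dvd_in (poly_ring_over A) [:c:] p"
  then show "\<forall>i. dvd_in A c (coeff p i)"
    by (auto simp: dvd_in_def poly_ring_over_def)
next
  assume "\<forall>i. dvd_in A c (coeff p i)"
  then obtain d where d: "\<And>i. d i \<in> A" "\<And>i. coeff p i = c * d i"
    unfolding dvd_in_def by metis
  define q where "q = (\<Sum>i\<le>degree p. monom (d i) i)"
  have q: "coeff q i = (if i \<le> degree p then d i else 0)" for i
    unfolding q_def by (simp add: coeff_sum if_distrib cong: if_cong)
  have "p = [:c:] * q"
  proof (rule poly_eqI)
    fix i
    show "coeff p i = coeff ([:c:] * q) i"
      using d(2)[of i] c by (cases "i \<le> degree p") (auto simp: q coeff_eq_0)
  qed
  moreover have "q \<in> poly_ring_over A"
    using d(1) subring_0[OF A] by (auto simp: poly_ring_over_def q)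
  ultimately show "dvd_in (poly_ring_over A) [:c:] p" unfolding dvd_in_def by blast
qed

text \<open>For a and b not divisible by p, let i and j be the least indices of coefficients that p
  does not divide. In the coefficient of index i + j of \<open>a * b\<close> all summands but one
  are multiples of p.\<close>

lemma prime_in_const_poly:
  fixes A :: "'a::idom set"
  assumes A: "subring_of A" and p: "prime_in A p"
  shows "prime_in (poly_ring_over A) [:p:]"
proof -
  have p0: "p \<noteq> 0" and pA: "p \<in> A" using p by (auto simp: prime_in_def)
  note iff = dvd_in_const_poly_iff[OF A p0]
  have False
    if "a \<in> poly_ring_over A" "b \<in> poly_ring_over A" "\<forall>i. dvd_in A p (coeff (a * b) i)"
      "\<exists>i. \<not> dvd_in A p (coeff a i)" "\<exists>i. \<not> dvd_in A p (coeff b i)" for a b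
  proof -
    have cA: "coeff a i \<in> A" "coeff b i \<in> A" for i using that by (auto simp: poly_ring_over_def)
    define i where "i = (LEAST i. \<not> dvd_in A p (coeff a i))"
    define j where "j = (LEAST i. \<not> dvd_in A p (coeff b i))"
    have i: "\<not> dvd_in A p (coeff a i)" "\<And>k. k < i \<Longrightarrow> dvd_in A p (coeff a k)"
      unfolding i_def by (rule LeastI_ex[OF that(4)]) (use not_less_Least in blast)
    have j: "\<not> dvd_in A p (coeff b j)" "\<And>k. k < j \<Longrightarrow> dvd_in A p (coeff b k)"
      unfolding j_def by (rule LeastI_ex[OF that(5)]) (use not_less_Least in blast)
    have e: "coeff (a * b) (i + j) = coeff a i * coeff b j +
        (\<Sum>k\<in>{..i + j} - {i}. coeff a k * coeff b (i + j - k))"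
      unfolding coeff_mult by (subst sum.remove[of _ i]) auto
    have d: "dvd_in A p (\<Sum>k\<in>{..i + j} - {i}. coeff a k * coeff b (i + j - k))"
    proof (rule dvd_in_sum[OF A])
      fix k assume "k \<in> {..i + j} - {i}"
      then have "k < i \<or> i + j - k < j" by auto
      then show "dvd_in A p (coeff a k * coeff b (i + j - k))"
        using i(2) j(2) cA dvd_in_mult[OF A] by blast
    qed
    have "dvd_in A p (coeff a i * coeff b j)"
      using dvd_in_diff[OF A that(3)[rule_format, of "i + j"] d] by (simp only: e add_diff_cancel_right')
    then show False using prime_in_dvd_mult[OF p cA(1)[of i] cA(2)[of j]] i(1) j(1) by simp
  qed
  then have "\<forall>a\<in>poly_ring_over A. \<forall>b\<in>poly_ring_over A. dvd_in (poly_ring_over A) [:p:] (a * b) \<longrightarrow>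
      dvd_in (poly_ring_over A) [:p:] a \<or> dvd_in (poly_ring_over A) [:p:] b"
    unfolding iff by blast
  then show ?thesis
    using p0 pA A by (simp add: prime_in_def)
qed

text \<open>The leading coefficient of g need not be invertible, so each reduction step first
  multiplies f by it; the factor a collects these multipliers.\<close>

lemma pseudo_division_in:
  fixes A :: "'a::idom set"
  assumes A: "subring_of A" and g: "g \<in> poly_ring_over A" "g \<noteq> 0"
  shows "f \<in> poly_ring_over A \<Longrightarrow> \<exists>a q r. a \<in> A \<and> a \<noteq> 0 \<and> q \<in> poly_ring_over A \<and> r \<in> poly_ring_over A \<and>
     smult a f = q * g + r \<and> (r = 0 \<or> degree r < degree g)"
proof (induction "degree f" arbitrary: f rule: less_induct)
  case less
  note P = subring_poly_ring_over[OF A]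
  have sm: "smult c p \<in> poly_ring_over A" if "c \<in> A" "p \<in> poly_ring_over A" for c p
    using that A by (auto simp: poly_ring_over_def intro: subring_mult)
  show ?case
  proof (cases "f = 0 \<or> degree f < degree g")
    case True
    then show ?thesis
      using less.prems subring_1[OF A] subring_0[OF P]
      by (intro exI[of _ 1] exI[of _ 0] exI[of _ f]) auto
  next
    case False
    define l where "l = lead_coeff g"
    define m where "m = monom (lead_coeff f) (degree f - degree g)"
    define f' where "f' = smult l f - m * g"
    have l: "l \<in> A" "l \<noteq> 0" using g by (auto simp: l_def poly_ring_over_def)
    have m: "m \<in> poly_ring_over A"
      unfolding m_def using less.prems by (intro poly_ring_over_monom A) (auto simp: poly_ring_over_def)
    have f': "f' \<in> poly_ring_over A"
      unfolding f'_def using l m g less.prems by (intro subring_diff[OF P] sm subring_mult[OF P])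
    have m0: "m \<noteq> 0" and f0: "f \<noteq> 0" using False by (auto simp: m_def)
    have "coeff f' (degree f) = 0"
      using False unfolding f'_def m_def l_def
      by (simp add: coeff_monom_mult)
    moreover have "degree f' \<le> degree f"
    proof -
      have "degree (m * g) \<le> degree f"
        using False degree_mult_le[of m g] degree_monom_le[of "lead_coeff f" "degree f - degree g"]
        unfolding m_def by linarith
      then show ?thesis unfolding f'_def by (intro degree_diff_le) auto
    qed
    ultimately have "f' = 0 \<or> degree f' < degree f"
      by (metis eq_zero_or_degree_less)
    then have "\<exists>a q r. a \<in> A \<and> a \<noteq> 0 \<and> q \<in> poly_ring_over A \<and> r \<in> poly_ring_over A \<and>
     smult a f' = q * g + r \<and> (r = 0 \<or> degree r < degree g)"
    proof
      assume "f' = 0"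
      then show ?thesis using subring_1[OF A] subring_0[OF P]
        by (intro exI[of _ 1] exI[of _ 0] exI[of _ 0]) auto
    next
      assume "degree f' < degree f"
      then show ?thesis using less.hyps f' by blast
    qed
    then obtain a q r where aqr: "a \<in> A" "a \<noteq> 0" "q \<in> poly_ring_over A" "r \<in> poly_ring_over A"
      "smult a f' = q * g + r" "r = 0 \<or> degree r < degree g" by blast
    have "smult (a * l) f = smult a f' + smult a (m * g)"
      by (simp add: f'_def smult_diff_right)
    also have "\<dots> = (q + smult a m) * g + r"
      using aqr by (simp add: algebra_simps)
    finally have "smult (a * l) f = (q + smult a m) * g + r" .
    moreover have "a * l \<in> A" "a * l \<noteq> 0" using subring_mult[OF A] aqr l by auto
    moreover have "q + smult a m \<in> poly_ring_over A" using subring_add[OF P] aqr sm m by blast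
    ultimately show ?thesis using aqr by blast
  qed
qed

text \<open>Irreducibility over the fraction field of \<open>A\<close>, with denominators cleared.\<close>

definition irreducible_over :: "'a::idom set \<Rightarrow> 'a poly \<Rightarrow> bool" where
  "irreducible_over A f \<longleftrightarrow> degree f > 0 \<and>
     (\<forall>a\<in>A. \<forall>g\<in>poly_ring_over A. \<forall>h\<in>poly_ring_over A.
        a \<noteq> 0 \<longrightarrow> smult a f = g * h \<longrightarrow> degree g = 0 \<or> degree h = 0)"

lemma irreducible_overD:
  assumes "irreducible_over A f" and "smult a f = g * h" and "a \<noteq> 0" and "a \<in> A"
    and "g \<in> poly_ring_over A" and "h \<in> poly_ring_over A"
  shows "degree g = 0 \<or> degree h = 0"
  using assms by (simp add: irreducible_over_def)

text \<open>The Euclidean argument over the fraction field, with denominators cleared. A nonzero r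
  of least degree in the ideal J generated by f and g divides every element of J up to a constant
  factor. As f is irreducible, r is either constant, and then f divides a multiple of h, or
  proportional to f, and then f divides a multiple of g.\<close>

lemma irreducible_over_dvd_mult:
  fixes A :: "'a::idom set"
  assumes A: "subring_of A" and f: "f \<in> poly_ring_over A" "irreducible_over A f"
    and g: "g \<in> poly_ring_over A" and h: "h \<in> poly_ring_over A"
    and dvd: "dvd_in (poly_ring_over A) f (g * h)"
  shows "\<exists>a\<in>A. a \<noteq> 0 \<and> (dvd_in (poly_ring_over A) f (smult a g) \<or> dvd_in (poly_ring_over A) f (smult a h))"
proof -
  note P = subring_poly_ring_over[OF A]
  define J where "J = {u * f + v * g | u v. u \<in> poly_ring_over A \<and> v \<in> poly_ring_over A}"
  have sm: "smult c p \<in> poly_ring_over A" if "c \<in> A" "p \<in> poly_ring_over A" for c p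
    using that A by (auto simp: poly_ring_over_def intro: subring_mult)
  have f0: "f \<noteq> 0" using f by (auto simp: irreducible_over_def)
  have "f = 1 * f + 0 * g" "g = 0 * f + 1 * g" by simp_all
  then have fJ: "f \<in> J" and gJ: "g \<in> J"
    unfolding J_def using subring_0[OF P] subring_1[OF P] by (metis (mono_tags, lifting) mem_Collect_eq)+
  have JP: "J \<subseteq> poly_ring_over A"
    unfolding J_def by (auto simp: f(1) g intro!: subring_add[OF P] subring_mult[OF P])
  have Jlin: "smult a x - q * y \<in> J" if "x \<in> J" "y \<in> J" "a \<in> A" "q \<in> poly_ring_over A" for a x q y
  proof -
    obtain u v u' v' where uv: "u \<in> poly_ring_over A" "v \<in> poly_ring_over A" "u' \<in> poly_ring_over A"
      "v' \<in> poly_ring_over A" "x = u * f + v * g" "y = u' * f + v' * g"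
      using \<open>x \<in> J\<close> \<open>y \<in> J\<close> unfolding J_def by blast
    have "smult a x - q * y = (smult a u - q * u') * f + (smult a v - q * v') * g"
      by (simp add: uv algebra_simps smult_add_right)
    moreover have "smult a u - q * u' \<in> poly_ring_over A" "smult a v - q * v' \<in> poly_ring_over A"
      using uv that by (auto intro!: subring_diff[OF P] sm subring_mult[OF P])
    ultimately show ?thesis unfolding J_def by blast
  qed
  have "\<exists>r. (r \<in> J \<and> r \<noteq> 0) \<and> (\<forall>y. y \<in> J \<and> y \<noteq> 0 \<longrightarrow> degree r \<le> degree y)"
    by (rule ex_has_least_nat[of _ f]) (use fJ f0 in auto)
  then obtain r where r: "r \<in> J" "r \<noteq> 0" and rmin: "\<And>y. y \<in> J \<Longrightarrow> y \<noteq> 0 \<Longrightarrow> degree r \<le> degree y"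
    by blast
  have *: "\<exists>a\<in>A. \<exists>q\<in>poly_ring_over A. a \<noteq> 0 \<and> smult a x = q * r" if x: "x \<in> J" for x
  proof -
    obtain a q s where aqs: "a \<in> A" "a \<noteq> 0" "q \<in> poly_ring_over A" "s \<in> poly_ring_over A"
      "smult a x = q * r + s" "s = 0 \<or> degree s < degree r"
      using pseudo_division_in[OF A, of r x] r x JP by blast
    have "s = smult a x - q * r" using aqs by simp
    then have "s \<in> J" using Jlin[OF x r(1) aqs(1,3)] by simp
    then have "s = 0" using rmin aqs(6) by (metis leD)
    then show ?thesis using aqs by auto
  qed
  obtain a q where aq: "a \<in> A" "a \<noteq> 0" "q \<in> poly_ring_over A" "smult a f = q * r"
    using *[OF fJ] by blast
  have "degree q = 0 \<or> degree r = 0"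
    by (rule irreducible_overD[OF f(2) aq(4,2,1,3)]) (use r JP in auto)
  then show ?thesis
  proof
    assume "degree r = 0"
    then obtain c where c: "r = [:c:]" by (rule degree_eq_zeroE)
    then have cA: "c \<in> A" "c \<noteq> 0" using r JP A by auto
    obtain u v where uv: "u \<in> poly_ring_over A" "v \<in> poly_ring_over A" "r = u * f + v * g"
      using r unfolding J_def by blast
    have "smult c h = r * h" by (simp add: c)
    also have "\<dots> = f * (u * h) + v * (g * h)" by (simp add: uv algebra_simps)
    finally have "smult c h = f * (u * h) + v * (g * h)" .
    moreover have "dvd_in (poly_ring_over A) f (f * (u * h))"
      unfolding dvd_in_def using uv h by (auto intro: subring_mult[OF P])
    ultimately have "dvd_in (poly_ring_over A) f (smult c h)"
      using dvd_in_add[OF P] dvd_in_mult(2)[OF P dvd uv(2)] by simp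
    then show ?thesis using cA by blast
  next
    assume "degree q = 0"
    then obtain e where e: "q = [:e:]" by (rule degree_eq_zeroE)
    have eA: "e \<in> A" "e \<noteq> 0" using aq f0 A e by auto
    obtain b q' where b: "b \<in> A" "b \<noteq> 0" "q' \<in> poly_ring_over A" "smult b g = q' * r"
      using *[OF gJ] by blast
    have "smult (e * b) g = smult e (q' * r)" using b by (metis smult_smult)
    also have "\<dots> = q' * (q * r)" by (simp add: e)
    also have "\<dots> = f * smult a q'" by (simp add: aq(4)[symmetric]) (simp add: mult.commute)
    finally have "dvd_in (poly_ring_over A) f (smult (e * b) g)"
      unfolding dvd_in_def using sm aq b by blast
    moreover have "e * b \<in> A" "e * b \<noteq> 0" using eA b subring_mult[OF A] by auto
    ultimately show ?thesis by blast
  qed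
qed

text \<open>The conclusion is \<open>dvd_in A p 1\<close> and not a contradiction, because units
  count as primes.\<close>

definition primitive_over :: "'a::idom set \<Rightarrow> 'a poly \<Rightarrow> bool" where
  "primitive_over A f \<longleftrightarrow> (\<forall>p. prime_in A p \<longrightarrow> (\<forall>i. dvd_in A p (coeff f i)) \<longrightarrow> dvd_in A p 1)"

text \<open>The prime factors of the constant are cancelled one at a time. If p divides
  \<open>f * w\<close>, it divides f or w; in the first case p is a unit by primitivity and divides
  w anyway.\<close>

lemma primitive_over_dvd_smult:
  fixes A :: "'a::idom set"
  assumes A: "subring_of A" and f: "f \<in> poly_ring_over A" "primitive_over A f"
  shows "\<forall>p\<in>set ps. prime_in A p \<Longrightarrow> g \<in> poly_ring_over A \<Longrightarrow>
    dvd_in (poly_ring_over A) f (smult (prod_list ps) g) \<Longrightarrow> dvd_in (poly_ring_over A) f g"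
proof (induction ps arbitrary: g)
  case (Cons p ps)
  note P = subring_poly_ring_over[OF A]
  have p: "prime_in A p" and p0: "p \<noteq> 0" using Cons.prems by (auto dest: prime_in_nonzero)
  have psA: "prod_list ps \<in> A"
    using Cons.prems(1) by (intro subring_prod_list A) (auto dest: prime_in_mem)
  have pg: "smult (prod_list ps) g \<in> poly_ring_over A"
    using psA Cons.prems(2) A by (auto simp: poly_ring_over_def intro: subring_mult)
  note P = subring_poly_ring_over[OF A]
  obtain w where w: "w \<in> poly_ring_over A" "[:p:] * smult (prod_list ps) g = f * w"
    using Cons.prems(3) by (auto simp: dvd_in_def mult.commute)
  then have "dvd_in (poly_ring_over A) [:p:] (f * w)"
    using pg unfolding dvd_in_def by metis
  then have "dvd_in (poly_ring_over A) [:p:] f \<or> dvd_in (poly_ring_over A) [:p:] w"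
    using prime_in_dvd_mult[OF prime_in_const_poly[OF A p] f(1) w(1)] by blast
  moreover have "dvd_in (poly_ring_over A) [:p:] w" if "dvd_in (poly_ring_over A) [:p:] f"
  proof -
    have "dvd_in A p 1"
      using that f(2) p unfolding dvd_in_const_poly_iff[OF A p0] primitive_over_def by blast
    then have "dvd_in A p (coeff w i)" for i
      using dvd_in_mult(1)[OF A, of p 1 "coeff w i"] w by (auto simp: poly_ring_over_def)
    then show ?thesis unfolding dvd_in_const_poly_iff[OF A p0] by blast
  qed
  ultimately have "dvd_in (poly_ring_over A) [:p:] w" by blast
  then obtain w' where w': "w' \<in> poly_ring_over A" "w = [:p:] * w'" by (auto simp: dvd_in_def)
  have "[:p:] * smult (prod_list ps) g = [:p:] * (f * w')"
    using w w' by (simp add: mult_ac)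
  then have "smult (prod_list ps) g = f * w'"
    using p0 by (metis mult_left_cancel pCons_eq_0_iff)
  then have "dvd_in (poly_ring_over A) f (smult (prod_list ps) g)" using w' by (auto simp: dvd_in_def)
  then show ?case using Cons by auto
qed simp

lemma prime_in_poly:
  fixes A :: "'a::idom set"
  assumes A: "factorial_in A" and f: "f \<in> poly_ring_over A" "irreducible_over A f" "primitive_over A f"
  shows "prime_in (poly_ring_over A) f"
proof -
  note S = factorial_in_subring[OF A]
  have *: "dvd_in (poly_ring_over A) f g"
    if "a \<in> A" "a \<noteq> 0" "g \<in> poly_ring_over A" "dvd_in (poly_ring_over A) f (smult a g)" for a g
  proof -
    obtain ps where "a = prod_list ps" "\<forall>p\<in>set ps. prime_in A p"
      using factorial_inE[OF A \<open>a \<in> A\<close> \<open>a \<noteq> 0\<close>] by blast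
    then show ?thesis using primitive_over_dvd_smult[OF S f(1,3) _ that(3)] that(4) by simp
  qed
  have "f \<noteq> 0" using f by (auto simp: irreducible_over_def)
  then show ?thesis
    unfolding prime_in_def using irreducible_over_dvd_mult[OF S f(1,2)] * f(1) by blast
qed

text \<open>A common divisor of the coefficients divides the leading coefficient, so an induction
  over the prime factors of the latter splits off the content. When none of these primes divides f,
  then f is primitive and therefore prime.\<close>

lemma irreducible_over_prime_products:
  fixes A :: "'a::idom set"
  assumes A: "factorial_in A"
  shows "f \<in> poly_ring_over A \<Longrightarrow> irreducible_over A f \<Longrightarrow> lead_coeff f = prod_list ps \<Longrightarrow>
    \<forall>p\<in>set ps. prime_in A p \<Longrightarrow> f \<in> prime_products (poly_ring_over A)"
proof (induction ps arbitrary: f rule: length_induct)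
  case (1 ps f)
  note S = factorial_in_subring[OF A]
  note P = subring_poly_ring_over[OF S]
  have psA: "set ps \<subseteq> A" using 1 by (auto dest: prime_in_mem)
  have f0: "f \<noteq> 0" using 1 by (auto simp: irreducible_over_def)
  show ?case
  proof (cases "\<exists>p\<in>set ps. \<forall>i. dvd_in A p (coeff f i)")
    case True
    then obtain p where p: "p \<in> set ps" "\<forall>i. dvd_in A p (coeff f i)" by blast
    have pp: "prime_in A p" and p0: "p \<noteq> 0" and pA: "p \<in> A"
      using p(1) 1 by (auto dest: prime_in_nonzero prime_in_mem)
    obtain f' where f': "f' \<in> poly_ring_over A" "f = [:p:] * f'"
      using p dvd_in_const_poly_iff[OF S p0] unfolding dvd_in_def by blast
    have "lead_coeff f = p * lead_coeff f'" using f' p0 by simp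
    then have "p * lead_coeff f' = p * prod_list (remove1 p ps)"
      by (metis 1(4) prod_list_remove1[OF p(1)])
    then have "lead_coeff f' = prod_list (remove1 p ps)" using p0 mult_left_cancel by metis
    moreover have "irreducible_over A f'"
      unfolding irreducible_over_def
    proof (intro conjI ballI impI)
      show "degree f' > 0" using 1(3) p0 f' by (auto simp: irreducible_over_def)
      fix a g h assume *: "a \<in> A" "g \<in> poly_ring_over A" "h \<in> poly_ring_over A" "a \<noteq> 0" "smult a f' = g * h"
      have "smult a f = [:p:] * smult a f'" by (simp add: f'(2) mult.commute)
      also have "\<dots> = ([:p:] * g) * h" by (simp only: *(5) mult.assoc)
      finally have "smult a f = ([:p:] * g) * h" .
      moreover have "[:p:] * g \<in> poly_ring_over A"
        using * pA S by (intro subring_mult[OF P]) auto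
      ultimately have "degree ([:p:] * g) = 0 \<or> degree h = 0"
        by (intro irreducible_overD[OF 1(3) _ *(4,1)]) (auto intro: *)
      then show "degree g = 0 \<or> degree h = 0" using p0 by simp
    qed
    moreover have "length (remove1 p ps) < length ps"
      using p(1) by (metis length_pos_if_in_set length_remove1 diff_less zero_less_one)
    moreover have "\<forall>p\<in>set (remove1 p ps). prime_in A p" using 1 set_remove1_subset by fast
    ultimately have "f' \<in> prime_products (poly_ring_over A)" using 1(1) f' by blast
    then show ?thesis
      unfolding f' using prime_products_mult prime_products_prime prime_in_const_poly[OF S pp] by blast
  next
    case False
    have "primitive_over A f"
      unfolding primitive_over_def
    proof (intro allI impI)
      fix q assume q: "prime_in A q" "\<forall>i. dvd_in A q (coeff f i)"
      \<comment> \<open>As a divisor of the leading coefficient, q is a unit or divides a listed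
        prime p = q c. Then p divides q or c: the former would make p a common divisor of the
        coefficients, the latter makes q a unit.\<close>
      have "dvd_in A q (prod_list ps)" using q 1(4) by metis
      then consider "dvd_in A q 1" | p where "p \<in> set ps" "dvd_in A q p"
        using prime_in_dvd_prod_list[OF S q(1) psA] by blast
      then show "dvd_in A q 1"
      proof cases
        case 2
        then obtain c where c: "c \<in> A" "p = q * c" by (auto simp: dvd_in_def)
        have p: "prime_in A p" and p0: "p \<noteq> 0" using 2 1 by (auto dest: prime_in_nonzero)
        have "dvd_in A p (q * c)" using c subring_1[OF S] by (auto simp: dvd_in_def)
        then have "dvd_in A p q \<or> dvd_in A p c"
          using prime_in_dvd_mult[OF p] c prime_in_mem[OF q(1)] by blast
        moreover have "\<not> dvd_in A p q"
          using False 2 q dvd_in_trans[OF S] by blast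
        ultimately obtain e where e: "e \<in> A" "c = p * e" by (auto simp: dvd_in_def)
        have "c * 1 = c * (q * e)" using e c by (simp add: mult_ac)
        then have "1 = q * e" using p0 c by (metis mult_left_cancel mult_zero_right)
        then show ?thesis using e by (auto simp: dvd_in_def)
      qed
    qed
    then show ?thesis using prime_in_poly[OF A 1(2,3)] prime_products_prime by blast
  qed
qed

text \<open>Each prime factor of the constant divides g or h and is cancelled there, which leaves
  the degrees unchanged. A factorisation over the fraction field thus turns into one over A.\<close>

lemma split_smult_prime_products:
  fixes A :: "'a::idom set"
  assumes S: "subring_of A"
  shows "\<forall>p\<in>set ps. prime_in A p \<Longrightarrow> g \<in> poly_ring_over A \<Longrightarrow> h \<in> poly_ring_over A \<Longrightarrow>
    smult (prod_list ps) f = g * h \<Longrightarrow> f \<in> poly_ring_over A \<Longrightarrow>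
    \<exists>g'\<in>poly_ring_over A. \<exists>h'\<in>poly_ring_over A. f = g' * h' \<and> degree g' = degree g \<and> degree h' = degree h"
proof (induction ps arbitrary: g h)
  case (Cons p ps)
  have p: "prime_in A p" and p0: "p \<noteq> 0" using Cons.prems by (auto dest: prime_in_nonzero)
  have psA: "prod_list ps \<in> A"
    using Cons.prems(1) by (intro subring_prod_list S) (auto dest: prime_in_mem)
  have e: "[:p:] * smult (prod_list ps) f = g * h" using Cons.prems by (simp add: mult.commute)
  moreover have "smult (prod_list ps) f \<in> poly_ring_over A"
    using psA Cons.prems S by (auto simp: poly_ring_over_def intro: subring_mult)
  ultimately have "dvd_in (poly_ring_over A) [:p:] (g * h)" unfolding dvd_in_def by metis
  then have "dvd_in (poly_ring_over A) [:p:] g \<or> dvd_in (poly_ring_over A) [:p:] h"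
    using prime_in_dvd_mult[OF prime_in_const_poly[OF S p]] Cons.prems by blast
  then show ?case
  proof
    assume "dvd_in (poly_ring_over A) [:p:] g"
    then obtain g' where g': "g' \<in> poly_ring_over A" "g = [:p:] * g'" by (auto simp: dvd_in_def)
    have "[:p:] * smult (prod_list ps) f = [:p:] * (g' * h)" using e g' by (simp add: mult_ac)
    then have "smult (prod_list ps) f = g' * h" using p0 by (metis mult_left_cancel pCons_eq_0_iff)
    moreover have "degree g' = degree g" using g' p0 by simp
    ultimately show ?thesis using Cons.IH[of g' h] Cons.prems g' by auto
  next
    assume "dvd_in (poly_ring_over A) [:p:] h"
    then obtain g' where g': "g' \<in> poly_ring_over A" "h = [:p:] * g'" by (auto simp: dvd_in_def)
    have "[:p:] * smult (prod_list ps) f = [:p:] * (g * g')" using e g' by (simp add: mult_ac)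
    then have "smult (prod_list ps) f = g * g'" using p0 by (metis mult_left_cancel pCons_eq_0_iff)
    moreover have "degree g' = degree h" using g' p0 by simp
    ultimately show ?thesis using Cons.IH[of g g'] Cons.prems g' by auto
  qed
next
  case Nil
  then show ?case by (intro bexI[of _ g] bexI[of _ h]) auto
qed

lemma factorial_in_poly_ring_over:
  fixes A :: "'a::idom set"
  assumes A: "factorial_in A"
  shows "factorial_in (poly_ring_over A)"
proof -
  note S = factorial_in_subring[OF A]
  note P = subring_poly_ring_over[OF S]
  have "f \<in> poly_ring_over A \<Longrightarrow> f \<noteq> 0 \<Longrightarrow> f \<in> prime_products (poly_ring_over A)" for f
  proof (induction "degree f" arbitrary: f rule: less_induct)
    case less
    consider (const) "degree f = 0" | (irr) "irreducible_over A f"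
      | (red) a g h where "a \<in> A" "a \<noteq> 0" "g \<in> poly_ring_over A" "h \<in> poly_ring_over A"
        "smult a f = g * h" "degree g \<noteq> 0" "degree h \<noteq> 0"
      unfolding irreducible_over_def by (meson gr0I)
    then show ?case
    proof cases
      case const
      then obtain c where c: "f = [:c:]" by (rule degree_eq_zeroE)
      then have "c \<in> A" "c \<noteq> 0" using less S by auto
      then obtain ps where ps: "c = prod_list ps" "\<forall>p\<in>set ps. prime_in A p"
        by (rule factorial_inE[OF A])
      have "prod_list (map (\<lambda>p. [:p:]) qs) = [:prod_list qs:]" for qs :: "'a list"
        by (induction qs) (simp_all add: one_pCons)
      then have "f = prod_list (map (\<lambda>p. [:p:]) ps)" using c ps(1) by simp
      then show ?thesis
        unfolding prime_products_def using ps(2) prime_in_const_poly[OF S]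
        by (intro CollectI exI[of _ "map (\<lambda>p. [:p:]) ps"]) auto
    next
      case irr
      have "lead_coeff f \<in> A" "lead_coeff f \<noteq> 0" using less by (auto simp: poly_ring_over_def)
      then obtain ps where "lead_coeff f = prod_list ps" "\<forall>p\<in>set ps. prime_in A p"
        by (rule factorial_inE[OF A])
      then show ?thesis using irreducible_over_prime_products[OF A less.prems(1) irr] by blast
    next
      case red
      obtain ps where ps: "a = prod_list ps" "\<forall>p\<in>set ps. prime_in A p"
        using factorial_inE[OF A red(1,2)] by blast
      obtain g' h' where gh: "g' \<in> poly_ring_over A" "h' \<in> poly_ring_over A" "f = g' * h'"
        "degree g' = degree g" "degree h' = degree h"
        using split_smult_prime_products[OF S ps(2) red(3,4)] red ps less.prems by blast
      have "g' \<noteq> 0" "h' \<noteq> 0" using gh less.prems by auto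
      then have "degree f = degree g' + degree h'" using gh by (simp add: degree_mult_eq)
      then have "degree g' < degree f" "degree h' < degree f" using gh red by auto
      then have "g' \<in> prime_products (poly_ring_over A)" "h' \<in> prime_products (poly_ring_over A)"
        using less.hyps gh \<open>g' \<noteq> 0\<close> \<open>h' \<noteq> 0\<close> by auto
      then show ?thesis unfolding gh(3) by (rule prime_products_mult)
    qed
  qed
  then show ?thesis using P unfolding factorial_in_def by auto
qed


section \<open>Laurent extensions and group algebras\<close>

text \<open>By \<open>surj\<close> and \<open>inj\<close>, B is the polynomial ring over A with its
  variable inverted: up to a power of the unit t every element of B is the value of a polynomial. A
  prime polynomial that divides the variable becomes a unit of B, and every other one stays
  prime.\<close>

lemma factorial_in_laurent_extension:
  fixes A B :: "'a::idom set"
  assumes A: "factorial_in A" and B: "subring_of B" and t: "t \<in> B" "t' \<in> B" "t * t' = 1"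
    and AB: "A \<subseteq> B"
    and surj: "\<And>x. x \<in> B \<Longrightarrow> \<exists>n. \<exists>p\<in>poly_ring_over A. x * t ^ n = poly p t"
    and inj: "\<And>p. p \<in> poly_ring_over A \<Longrightarrow> poly p t = 0 \<Longrightarrow> p = 0"
  shows "factorial_in B"
proof -
  note S = factorial_in_subring[OF A]
  note P = subring_poly_ring_over[OF S]
  have inj': "p = q" if "p \<in> poly_ring_over A" "q \<in> poly_ring_over A" "poly p t = poly q t" for p q
    using inj[of "p - q"] subring_diff[OF P] that by simp
  have ev: "poly p t \<in> B" if "p \<in> poly_ring_over A" for p
    unfolding poly_altdef using that AB
    by (intro subring_sum[OF B] subring_mult[OF B] subring_power[OF B] t) (auto simp: poly_ring_over_def)
  have tt: "t ^ n * t' ^ n = 1" for n using t(3) by (metis power_mult_distrib power_one)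
  have tn: "t ^ n \<in> B" "t' ^ n \<in> B" for n using t by (auto intro: subring_power[OF B])
  have t0: "t \<noteq> 0" using t(3) by auto
  define X :: "'a poly" where "X = [:0, 1:]"
  have X: "X \<in> poly_ring_over A"
    using poly_ring_over_monom[OF S subring_1[OF S], of 1] by (simp add: X_def monom_altdef)
  have Xn: "X ^ n \<in> poly_ring_over A" for n by (rule subring_power[OF P X])
  have evX: "poly (X ^ n) t = t ^ n" for n by (simp add: X_def)
  have dvd_ev: "dvd_in B (poly p t) x"
    if "p \<in> poly_ring_over A" "q \<in> poly_ring_over A" "x * t ^ n = poly q t"
      and pq: "dvd_in (poly_ring_over A) p q" for p q x n
  proof -
    obtain r where r: "r \<in> poly_ring_over A" "q = p * r" using pq by (auto simp: dvd_in_def)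
    have "x = x * t ^ n * t' ^ n" using tt[of n] by (simp add: mult.assoc)
    also have "\<dots> = poly p t * (poly r t * t' ^ n)" using that r by (simp add: mult.assoc)
    finally show ?thesis
      unfolding dvd_in_def using ev[OF r(1)] tn subring_mult[OF B] by blast
  qed
  have prime_ev: "prime_in B (poly p t)" if p: "prime_in (poly_ring_over A) p" for p
  proof (cases "dvd_in (poly_ring_over A) p X")
    case True
    then obtain r where r: "r \<in> poly_ring_over A" "X = p * r" by (auto simp: dvd_in_def)
    have "poly X t = poly p t * poly r t" using r by simp
    then have "poly p t * (poly r t * t') = 1" using t(3) by (simp add: X_def flip: mult.assoc)
    then show ?thesis
      using prime_in_unit[OF B ev[OF prime_in_mem[OF p]]] ev[OF r(1)] t subring_mult[OF B] by blast
  next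
    case False
    have pP: "p \<in> poly_ring_over A" and p0: "p \<noteq> 0"
      using p by (auto dest: prime_in_mem prime_in_nonzero)
    have "\<not> dvd_in (poly_ring_over A) p 1"
      using False dvd_in_mult(2)[OF P _ X, of p 1] by auto
    then have Xpow: "\<not> dvd_in (poly_ring_over A) p (X ^ n)" for n
      using prime_in_dvd_power[OF P p X] False by blast
    have "dvd_in B (poly p t) a \<or> dvd_in B (poly p t) b"
      if ab: "a \<in> B" "b \<in> B" and dvd: "dvd_in B (poly p t) (a * b)" for a b
    proof -
      obtain z where z: "z \<in> B" "a * b = poly p t * z" using dvd by (auto simp: dvd_in_def)
      obtain n \<alpha> where \<alpha>: "\<alpha> \<in> poly_ring_over A" "a * t ^ n = poly \<alpha> t" using surj[OF ab(1)] by blast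
      obtain m \<beta> where \<beta>: "\<beta> \<in> poly_ring_over A" "b * t ^ m = poly \<beta> t" using surj[OF ab(2)] by blast
      obtain l \<zeta> where \<zeta>: "\<zeta> \<in> poly_ring_over A" "z * t ^ l = poly \<zeta> t" using surj[OF z(1)] by blast
      have "poly (\<alpha> * \<beta> * X ^ l) t = (a * t ^ n) * (b * t ^ m) * t ^ l" by (simp add: \<alpha> \<beta> X_def)
      also have "\<dots> = (a * b) * (t ^ n * t ^ m * t ^ l)" by (simp add: ac_simps)
      also have "\<dots> = poly p t * (z * t ^ l) * (t ^ n * t ^ m)" unfolding z(2) by (simp add: ac_simps)
      also have "\<dots> = poly (p * (\<zeta> * X ^ (n + m))) t" by (simp add: \<zeta>(2) X_def power_add ac_simps)
      finally have "\<alpha> * \<beta> * X ^ l = p * (\<zeta> * X ^ (n + m))"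
        by (rule inj'[rotated 2]) (intro subring_mult[OF P] \<alpha> \<beta> \<zeta> Xn pP)+
      then have "dvd_in (poly_ring_over A) p (\<alpha> * \<beta> * X ^ l)"
        unfolding dvd_in_def using subring_mult[OF P \<zeta>(1) Xn] by blast
      then have "dvd_in (poly_ring_over A) p \<alpha> \<or> dvd_in (poly_ring_over A) p \<beta>"
        using prime_in_dvd_mult[OF p] subring_mult[OF P] \<alpha> \<beta> Xn Xpow by metis
      then show ?thesis using dvd_ev[OF pP] \<alpha> \<beta> by blast
    qed
    moreover have "poly p t \<noteq> 0" using inj pP p0 by blast
    ultimately show ?thesis unfolding prime_in_def using ev[OF pP] by blast
  qed
  have "x \<in> prime_products B" if x: "x \<in> B" "x \<noteq> 0" for x
  proof -
    obtain n p where p: "p \<in> poly_ring_over A" "x * t ^ n = poly p t" using surj[OF x(1)] by blast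
    then have "p \<noteq> 0" using x t0 by auto
    then obtain ps where ps: "p = prod_list ps" "\<forall>p\<in>set ps. prime_in (poly_ring_over A) p"
      using factorial_inE[OF factorial_in_poly_ring_over[OF A] p(1)] by blast
    have "poly (prod_list qs) t = prod_list (map (\<lambda>p. poly p t) qs)" for qs
      by (induction qs) auto
    then have "poly p t \<in> prime_products B"
      unfolding prime_products_def using ps prime_ev
      by (intro CollectI exI[of _ "map (\<lambda>p. poly p t) ps"]) auto
    moreover have "t' ^ n \<in> prime_products B"
      using prime_in_unit[OF B tn(2)[of n] tn(1)[of n]] tt[of n] by (intro prime_products_prime) (simp add: mult.commute)
    ultimately have "poly p t * t' ^ n \<in> prime_products B" by (rule prime_products_mult)
    moreover have "poly p t * t' ^ n = x" using p(2) tt[of n] by (metis mult.assoc mult_1_right)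
    ultimately show ?thesis by simp
  qed
  then show ?thesis using B unfolding factorial_in_def by auto
qed

section \<open>Group algebras of subgroups\<close>

definition group_algebra :: "'m::ab_group_add set \<Rightarrow> ('m \<Rightarrow>\<^sub>0 'k::field) set" where
  "group_algebra H = {p. Poly_Mapping.keys p \<subseteq> H}"

definition add_subgroup :: "'m::ab_group_add set \<Rightarrow> bool" where
  "add_subgroup H \<longleftrightarrow> 0 \<in> H \<and> (\<forall>x\<in>H. \<forall>y\<in>H. x + y \<in> H) \<and> (\<forall>x\<in>H. - x \<in> H)"

lemma
  assumes "add_subgroup H"
  shows add_subgroup_0: "0 \<in> H"
    and add_subgroup_add: "x \<in> H \<Longrightarrow> y \<in> H \<Longrightarrow> x + y \<in> H"
    and add_subgroup_uminus: "x \<in> H \<Longrightarrow> - x \<in> H"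
  using assms unfolding add_subgroup_def by auto

lemma single_in_group_algebra: "m \<in> H \<Longrightarrow> Poly_Mapping.single m c \<in> group_algebra H"
  by (auto simp: group_algebra_def)

lemma subring_group_algebra:
  assumes "add_subgroup H"
  shows "subring_of (group_algebra H :: ('m::ab_group_add \<Rightarrow>\<^sub>0 'k::field) set)"
  unfolding subring_of_def
proof (intro conjI ballI)
  show "(1 :: 'm \<Rightarrow>\<^sub>0 'k) \<in> group_algebra H" using add_subgroup_0[OF assms] by (auto simp: group_algebra_def)
  fix p q :: "'m \<Rightarrow>\<^sub>0 'k" assume "p \<in> group_algebra H" "q \<in> group_algebra H"
  then show "p + q \<in> group_algebra H" "p * q \<in> group_algebra H"
    using keys_add[of p q] keys_mult[of p q] add_subgroup_add[OF assms]
    unfolding group_algebra_def by blast+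
next
  fix p :: "'m \<Rightarrow>\<^sub>0 'k" assume "p \<in> group_algebra H"
  then show "- p \<in> group_algebra H" by (auto simp: group_algebra_def in_keys_iff)
qed

lemma poly_mapping_eq_sum_single:
  fixes p :: "'a \<Rightarrow>\<^sub>0 'b::comm_monoid_add"
  shows "(\<Sum>m\<in>Poly_Mapping.keys p. Poly_Mapping.single m (Poly_Mapping.lookup p m)) = p"
  by (rule poly_mapping_eqI)
    (auto simp: lookup_sum lookup_single when_def in_keys_iff if_distrib sum.delta cong: if_cong)

lemma poly_mapping_keys_induct [consumes 1, case_names zero single add]:
  assumes "Poly_Mapping.keys p \<subseteq> S"
    and zero: "P 0"
    and single: "\<And>m c. m \<in> S \<Longrightarrow> P (Poly_Mapping.single m c)"
    and add: "\<And>p q. Poly_Mapping.keys p \<subseteq> S \<Longrightarrow> Poly_Mapping.keys q \<subseteq> S \<Longrightarrow> P p \<Longrightarrow> P q \<Longrightarrow> P (p + q)"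
  shows "P (p :: 'a \<Rightarrow>\<^sub>0 'b::comm_monoid_add)"
proof -
  note p = poly_mapping_eq_sum_single[of p, symmetric]
  have "Poly_Mapping.keys (\<Sum>m\<in>F. Poly_Mapping.single m (Poly_Mapping.lookup p m)) \<subseteq> S \<and>
      P (\<Sum>m\<in>F. Poly_Mapping.single m (Poly_Mapping.lookup p m))"
    if "finite F" "F \<subseteq> S" for F
    using that
  proof (induction F)
    case (insert m F)
    let ?s = "Poly_Mapping.single m (Poly_Mapping.lookup p m)"
    let ?r = "\<Sum>m\<in>F. Poly_Mapping.single m (Poly_Mapping.lookup p m)"
    have s: "Poly_Mapping.keys ?s \<subseteq> S" "P ?s" using insert.prems single by auto
    have r: "Poly_Mapping.keys ?r \<subseteq> S" "P ?r" using insert.IH insert.prems by auto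
    have "Poly_Mapping.keys (?s + ?r) \<subseteq> S" using keys_add[of ?s ?r] s(1) r(1) by blast
    moreover have "P (?s + ?r)" by (rule add[OF s(1) r(1) s(2) r(2)])
    ultimately show ?case using insert.hyps by simp
  qed (auto simp: zero)
  then show ?thesis using p assms(1) by (metis finite_keys)
qed

lemma lookup_times_single:
  fixes p :: "'m::ab_group_add \<Rightarrow>\<^sub>0 'k::semiring_0"
  shows "Poly_Mapping.lookup (p * Poly_Mapping.single b c) k = Poly_Mapping.lookup p (k - b) * c"
proof -
  have "Poly_Mapping.keys p \<subseteq> UNIV" by simp
  then show ?thesis
  proof (induction p rule: poly_mapping_keys_induct)
    case (single m d)
    then show ?case
      by (auto simp: mult_single lookup_single when_def algebra_simps)
  qed (auto simp: lookup_add distrib_right)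
qed

lemma single_power:
  fixes b :: "nat \<Rightarrow>\<^sub>0 int"
  shows "Poly_Mapping.single b (1::'k::field) ^ n = Poly_Mapping.single (frag_cmul (int n) b) 1"
  by (induction n) (auto simp: mult_single frag_cmul_distrib)

text \<open>The coordinate v vanishes on H and is 1 at b, so H' is the direct sum of H and the
  multiples of b. Its group algebra is thus the Laurent extension of the group algebra of H by the
  monomial with exponent b.\<close>

lemma factorial_in_group_algebra_extend:
  fixes H H' :: "(nat \<Rightarrow>\<^sub>0 int) set"
  assumes fac: "factorial_in (group_algebra H :: ((nat \<Rightarrow>\<^sub>0 int) \<Rightarrow>\<^sub>0 'k::field) set)"
    and H: "add_subgroup H" and H': "add_subgroup H'" and HH': "H \<subseteq> H'"
    and b: "b \<in> H'" "Poly_Mapping.lookup b v = 1"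
    and v: "\<And>m. m \<in> H \<Longrightarrow> Poly_Mapping.lookup m v = 0"
    and diff: "\<And>m. m \<in> H' \<Longrightarrow> m - frag_cmul (Poly_Mapping.lookup m v) b \<in> H"
  shows "factorial_in (group_algebra H' :: ((nat \<Rightarrow>\<^sub>0 int) \<Rightarrow>\<^sub>0 'k) set)"
proof (rule factorial_in_laurent_extension[OF fac subring_group_algebra[OF H']])
  define t :: "(nat \<Rightarrow>\<^sub>0 int) \<Rightarrow>\<^sub>0 'k" where "t = Poly_Mapping.single b 1"
  note S = subring_group_algebra[OF H, where ?'k = 'k]
  note P = subring_poly_ring_over[OF S]
  show "Poly_Mapping.single b 1 \<in> group_algebra H'" "Poly_Mapping.single (- b) 1 \<in> group_algebra H'"
    using b add_subgroup_uminus[OF H'] by (auto intro: single_in_group_algebra)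
  show "Poly_Mapping.single b (1::'k) * Poly_Mapping.single (- b) 1 = 1"
    by (simp add: mult_single)
  show "group_algebra H \<subseteq> group_algebra H'" using HH' by (auto simp: group_algebra_def)
  have tn: "t ^ n = Poly_Mapping.single (frag_cmul (int n) b) 1" for n
    unfolding t_def by (rule single_power)
  have bn: "Poly_Mapping.lookup (frag_cmul n b) v = n" for n using b(2) by simp
  show "p = 0" if p: "p \<in> poly_ring_over (group_algebra H :: ((nat \<Rightarrow>\<^sub>0 int) \<Rightarrow>\<^sub>0 'k) set)"
    and 0: "poly p (Poly_Mapping.single b 1) = 0" for p
  proof (rule poly_eqI)
    fix i
    show "coeff p i = coeff 0 i"
    proof (cases "i \<le> degree p")
      case True
      have "Poly_Mapping.lookup (coeff p i) m = 0" for m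
      proof (cases "m \<in> H")
        case True
        \<comment> \<open>All exponents of \<open>coeff p j * t ^ j\<close> have v-coordinate j, so
          different powers of t cannot cancel.\<close>
        have "Poly_Mapping.lookup (coeff p j) (m + frag_cmul (int i) b - frag_cmul (int j) b) = 0" if "j \<noteq> i" for j
        proof (rule ccontr)
          assume "Poly_Mapping.lookup (coeff p j) (m + frag_cmul (int i) b - frag_cmul (int j) b) \<noteq> 0"
          then have "m + frag_cmul (int i) b - frag_cmul (int j) b \<in> H"
            using p by (auto simp: poly_ring_over_def group_algebra_def in_keys_iff subset_iff)
          then have "Poly_Mapping.lookup m v + int i - int j = 0"
            using v[of "m + frag_cmul (int i) b - frag_cmul (int j) b"] b(2)
            by (simp add: lookup_add lookup_minus)
          then show False using v[OF True] that by simp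
        qed
        then have "Poly_Mapping.lookup (coeff p j * t ^ j) (m + frag_cmul (int i) b) =
            (if j = i then Poly_Mapping.lookup (coeff p i) m else 0)" for j
          by (auto simp: tn lookup_times_single)
        then have "Poly_Mapping.lookup (poly p t) (m + frag_cmul (int i) b) = Poly_Mapping.lookup (coeff p i) m"
          using \<open>i \<le> degree p\<close> by (simp add: poly_altdef lookup_sum)
        then show ?thesis using 0 by (simp add: t_def)
      next
        case False
        then show ?thesis using p by (auto simp: poly_ring_over_def group_algebra_def in_keys_iff subset_iff)
      qed
      then show ?thesis by (intro poly_mapping_eqI) simp
    qed (simp add: coeff_eq_0)
  qed
  show "\<exists>n. \<exists>p\<in>poly_ring_over (group_algebra H). x * Poly_Mapping.single b 1 ^ n = poly p (Poly_Mapping.single b 1)"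
    if "x \<in> group_algebra H'" for x :: "(nat \<Rightarrow>\<^sub>0 int) \<Rightarrow>\<^sub>0 'k"
  proof -
    have "Poly_Mapping.keys x \<subseteq> H'" using that by (simp add: group_algebra_def)
    then have "\<exists>n. \<exists>p\<in>poly_ring_over (group_algebra H). x * t ^ n = poly p t"
    proof (induction x rule: poly_mapping_keys_induct)
      case zero
      then show ?case using subring_0[OF P] by (intro exI bexI[of _ 0]) auto
    next
      case (single m c)
      define h where "h = m - frag_cmul (Poly_Mapping.lookup m v) b"
      have h: "h \<in> H" using diff[OF single] by (simp add: h_def)
      \<comment> \<open>The negative part n of the v-coordinate goes into the power of t that
        multiplies x, the positive part k becomes the degree of the polynomial.\<close>
      define n where "n = nat (- Poly_Mapping.lookup m v)"
      define k where "k = nat (Poly_Mapping.lookup m v)"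
      have "int k - int n = Poly_Mapping.lookup m v" by (auto simp: k_def n_def)
      then have "frag_cmul (int k) b - frag_cmul (int n) b = frag_cmul (Poly_Mapping.lookup m v) b"
        by (metis frag_cmul_diff_distrib)
      then have e: "m + frag_cmul (int n) b = h + frag_cmul (int k) b"
        by (simp add: h_def algebra_simps)
      have "poly (monom (Poly_Mapping.single h c) k) t = Poly_Mapping.single m c * t ^ n"
        by (simp add: poly_monom tn mult_single e)
      moreover have "monom (Poly_Mapping.single h c) k \<in> poly_ring_over (group_algebra H)"
        using h by (intro poly_ring_over_monom S single_in_group_algebra)
      ultimately show ?case by metis
    next
      case (add x y)
      obtain n p where p: "p \<in> poly_ring_over (group_algebra H)" "x * t ^ n = poly p t" using add by blast
      obtain m q where q: "q \<in> poly_ring_over (group_algebra H)" "y * t ^ m = poly q t" using add by blast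
      define X where "X = monom (1 :: (nat \<Rightarrow>\<^sub>0 int) \<Rightarrow>\<^sub>0 'k)"
      have X: "X i \<in> poly_ring_over (group_algebra H)" for i
        unfolding X_def by (intro poly_ring_over_monom S subring_1)
      have "(x + y) * t ^ (n + m) = (x * t ^ n) * t ^ m + (y * t ^ m) * t ^ n"
        by (simp add: power_add algebra_simps)
      also have "\<dots> = poly (p * X m + q * X n) t" by (simp add: p q X_def poly_monom)
      finally show ?case
        using p q X subring_add[OF P] subring_mult[OF P] by blast
    qed
    then show ?thesis by (simp add: t_def)
  qed
qed

text \<open>The group algebra of the zero group is the field of constants; its nonzero elements are
  units and hence prime in the present sense.\<close>

lemma factorial_in_group_algebra_trivial:
  "factorial_in (group_algebra {0} :: ('m::{linorder, ordered_cancel_comm_monoid_add, ab_group_add} \<Rightarrow>\<^sub>0 'k::field) set)"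
proof -
  have S: "subring_of (group_algebra {0} :: ('m \<Rightarrow>\<^sub>0 'k) set)"
    by (rule subring_group_algebra) (simp add: add_subgroup_def)
  have "prime_in (group_algebra {0}) p" if p: "p \<in> group_algebra {0}" "p \<noteq> 0" for p :: "'m \<Rightarrow>\<^sub>0 'k"
  proof -
    have c: "p = Poly_Mapping.single 0 (Poly_Mapping.lookup p 0)"
      using p by (intro poly_mapping_eqI) (auto simp: lookup_single when_def group_algebra_def in_keys_iff subset_iff)
    then have "Poly_Mapping.lookup p 0 \<noteq> 0" using p(2) by (metis single_zero)
    then have "p * Poly_Mapping.single 0 (1 / Poly_Mapping.lookup p 0) = 1"
      by (subst c) (simp add: mult_single)
    then show ?thesis
      by (intro prime_in_unit[OF S p(1)]) (auto intro: single_in_group_algebra)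
  qed
  then show ?thesis unfolding factorial_in_def using S prime_products_prime by blast
qed


section \<open>Divisor class groups of normal affine monoid rings\<close>

lemma keys_nonempty: "p \<noteq> 0 \<Longrightarrow> Poly_Mapping.keys p \<noteq> {}"
  by (metis keys_zero poly_mapping_eqI not_in_keys_iff_lookup_eq_zero empty_iff lookup_zero)

lemma lookup_times_group:
  fixes f g :: "'m::ab_group_add \<Rightarrow>\<^sub>0 'k::semiring_0"
  shows "Poly_Mapping.lookup (f * g) k =
    (\<Sum>b\<in>Poly_Mapping.keys g. Poly_Mapping.lookup f (k - b) * Poly_Mapping.lookup g b)"
proof -
  have "f * g = (\<Sum>b\<in>Poly_Mapping.keys g. f * Poly_Mapping.single b (Poly_Mapping.lookup g b))"
    by (subst (1) poly_mapping_eq_sum_single[of g, symmetric]) (simp add: sum_distrib_left)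
  then show ?thesis by (simp add: lookup_sum lookup_times_single)
qed

text \<open>Ties of \<open>lam\<close> are broken by the order on the exponents, so that no cancellation can occur.\<close>

lemma keys_mult_minimal:
  fixes f g :: "'m::linordered_ab_group_add \<Rightarrow>\<^sub>0 'k::field" and lam :: "'m \<Rightarrow> int"
  assumes "f \<noteq> 0" and "g \<noteq> 0" and lam: "\<And>x y. lam (x + y) = lam x + lam y"
  shows "\<exists>m\<in>Poly_Mapping.keys f. \<exists>n\<in>Poly_Mapping.keys g. m + n \<in> Poly_Mapping.keys (f * g) \<and>
    (\<forall>x\<in>Poly_Mapping.keys f. lam m \<le> lam x) \<and> (\<forall>x\<in>Poly_Mapping.keys g. lam n \<le> lam x)"
proof -
  have ex: "\<exists>m\<in>Poly_Mapping.keys f. \<forall>x\<in>Poly_Mapping.keys f. lam m < lam x \<or> lam m = lam x \<and> m \<le> x"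
    if "f \<noteq> 0" for f :: "'m \<Rightarrow>\<^sub>0 'k"
  proof -
    let ?K = "Poly_Mapping.keys f"
    have "?K \<noteq> {}" using that by (rule keys_nonempty)
    then have "Min (lam ` ?K) \<in> lam ` ?K" by (intro Min_in) auto
    then obtain x0 where x0: "x0 \<in> ?K" "Min (lam ` ?K) = lam x0" by auto
    define F where "F = {x \<in> ?K. lam x = lam x0}"
    have F: "finite F" "F \<noteq> {}" using x0 by (auto simp: F_def)
    have "Min F \<in> F" using F by (rule Min_in)
    then have mF: "Min F \<in> ?K" "lam (Min F) = lam x0" by (simp_all add: F_def)
    have "lam (Min F) < lam x \<or> lam (Min F) = lam x \<and> Min F \<le> x" if x: "x \<in> ?K" for x
    proof (cases "x \<in> F")
      case True
      then show ?thesis using F mF by (simp add: F_def)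
    next
      case False
      moreover have "lam x0 \<le> lam x"
        using x0(2) x by (metis Min_le finite_imageI finite_keys imageI)
      ultimately show ?thesis using mF x by (auto simp: F_def)
    qed
    then show ?thesis using mF(1) by blast
  qed
  obtain m where m: "m \<in> Poly_Mapping.keys f"
    "\<And>x. x \<in> Poly_Mapping.keys f \<Longrightarrow> lam m < lam x \<or> lam m = lam x \<and> m \<le> x"
    using ex[OF assms(1)] by blast
  obtain n where n: "n \<in> Poly_Mapping.keys g"
    "\<And>x. x \<in> Poly_Mapping.keys g \<Longrightarrow> lam n < lam x \<or> lam n = lam x \<and> n \<le> x"
    using ex[OF assms(2)] by blast
  have "Poly_Mapping.lookup f (m + n - b) * Poly_Mapping.lookup g b = 0"
    if b: "b \<in> Poly_Mapping.keys g" "b \<noteq> n" for b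
  proof (rule ccontr)
    assume "Poly_Mapping.lookup f (m + n - b) * Poly_Mapping.lookup g b \<noteq> 0"
    then have c: "m + n - b \<in> Poly_Mapping.keys f" by (auto simp: in_keys_iff)
    have "lam (m + n - b) + lam b = lam m + lam n"
      using lam[of "m + n - b" b] lam[of m n] by simp
    then have "m \<le> m + n - b" "n \<le> b" using m(2)[OF c] n(2)[OF b(1)] by linarith+
    then show False using b(2) by (simp add: algebra_simps)
  qed
  then have "(\<Sum>b\<in>Poly_Mapping.keys g - {n}.
      Poly_Mapping.lookup f (m + n - b) * Poly_Mapping.lookup g b) = 0"
    by (intro sum.neutral) blast
  then have "Poly_Mapping.lookup (f * g) (m + n) = Poly_Mapping.lookup f m * Poly_Mapping.lookup g n"
    unfolding lookup_times_group using n(1) by (simp add: sum.remove[of _ n])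
  then have "m + n \<in> Poly_Mapping.keys (f * g)" using m n by (auto simp: in_keys_iff)
  moreover have "lam m \<le> lam x" if "x \<in> Poly_Mapping.keys f" for x using m(2)[OF that] by auto
  moreover have "lam n \<le> lam x" if "x \<in> Poly_Mapping.keys g" for x using n(2)[OF that] by auto
  ultimately show ?thesis using m(1) n(1) by blast
qed

lemma frac_field_mult:
  assumes "x \<in> frac_field R" and "y \<in> frac_field R" and "\<And>a b. a \<in> R \<Longrightarrow> b \<in> R \<Longrightarrow> a * b \<in> R"
  shows "x * y \<in> frac_field R"
proof -
  obtain a b c d where "x = a / b" "y = c / d" "a \<in> R" "b \<in> R" "b \<noteq> 0" "c \<in> R" "d \<in> R" "d \<noteq> 0"
    using assms(1,2) unfolding frac_field_def by blast
  then show ?thesis unfolding frac_field_def using assms(3)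
    by (intro CollectI exI[of _ "a * c"] exI[of _ "b * d"]) auto
qed

lemma frac_field_inverse:
  assumes "x \<in> frac_field R" and "x \<noteq> 0"
  shows "1 / x \<in> frac_field R"
proof -
  obtain a b where "x = a / b" "a \<in> R" "b \<in> R" "b \<noteq> 0"
    using assms(1) unfolding frac_field_def by blast
  then show ?thesis unfolding frac_field_def using assms(2)
    by (intro CollectI exI[of _ b] exI[of _ a]) auto
qed

text \<open>
  The map \<open>h\<close> realises the Laurent polynomial ring with exponents in \<open>M\<close> inside a field; the
  linear forms \<open>lam i\<close> cut out the cone of a normal affine monoid irredundantly.
\<close>

locale toric_ring =
  fixes h :: "('m::linordered_ab_group_add \<Rightarrow>\<^sub>0 'k::field) \<Rightarrow> 'f::field"
    and M :: "'m set" and I :: "'i set" and lam :: "'i \<Rightarrow> 'm \<Rightarrow> int"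
  assumes h_add: "h (p + q) = h p + h q" and h_mult: "h (p * q) = h p * h q" and h_1: "h 1 = 1"
    and h_eq_0: "h p = 0 \<Longrightarrow> p = 0"
    and M: "add_subgroup M"
    and fac: "factorial_in (group_algebra M :: ('m \<Rightarrow>\<^sub>0 'k) set)"
    and fin: "finite I"
    and lam_add: "lam i (x + y) = lam i x + lam i y"
    and face: "i \<in> I \<Longrightarrow> \<exists>s\<in>M. lam i s = 0 \<and> (\<forall>j\<in>I - {i}. lam j s > 0)"
    and primitive: "i \<in> I \<Longrightarrow> \<exists>m\<in>M. lam i m = 1"
    and interior: "\<exists>s\<in>M. \<forall>i\<in>I. lam i s > 0"
begin

section \<open>Monomial divisorial ideals\<close>

definition cone :: "('i \<Rightarrow> int) \<Rightarrow> 'm set" where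
  "cone a = {m \<in> M. \<forall>i\<in>I. a i \<le> lam i m}"

text \<open>In the language of divisors, this is the divisorial ideal with multiplicity
  \<open>a i\<close> at the height one prime that belongs to the facet i.\<close>

definition J :: "('i \<Rightarrow> int) \<Rightarrow> 'f set" where
  "J a = h ` {p. Poly_Mapping.keys p \<subseteq> cone a}"

abbreviation R :: "'f set" where "R \<equiv> J (\<lambda>_. 0)"

definition L :: "'f set" where "L = h ` group_algebra M"

definition chi :: "'m \<Rightarrow> 'f" where "chi m = h (Poly_Mapping.single m 1)"

lemma lam_0: "lam i 0 = 0" using lam_add[of i 0 0] by simp

lemma lam_uminus: "lam i (- m) = - lam i m" using lam_add[of i m "- m"] lam_0[of i] by simp

lemma h_0: "h 0 = 0" using h_add[of 0 0] by (metis add.right_neutral add_left_cancel)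

lemma h_diff: "h (p - q) = h p - h q" using h_add[of "p - q" q] by simp

lemma h_inj: "h p = h q \<longleftrightarrow> p = q"
  using h_eq_0[of "p - q"] h_diff[of p q] by auto

lemma h_mem_J: "h p \<in> J a \<longleftrightarrow> Poly_Mapping.keys p \<subseteq> cone a"
  unfolding J_def by (auto simp: h_inj)

lemma J_E: assumes "x \<in> J a" obtains p where "x = h p" "Poly_Mapping.keys p \<subseteq> cone a"
  using assms unfolding J_def by blast

lemma L_E: assumes "x \<in> L" obtains p where "x = h p" "Poly_Mapping.keys p \<subseteq> M"
  using assms unfolding L_def group_algebra_def by blast

lemma J_0: "0 \<in> J a" unfolding J_def using h_0 by (intro image_eqI[of _ _ 0]) auto

lemma J_add: "x \<in> J a \<Longrightarrow> y \<in> J a \<Longrightarrow> x + y \<in> J a"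
  by (elim J_E) (use keys_add in \<open>fastforce simp: h_add[symmetric] h_mem_J\<close>)

lemma J_mult:
  assumes "x \<in> J a" and "y \<in> J b"
  shows "x * y \<in> J (\<lambda>i. a i + b i)"
proof -
  obtain p where p: "x = h p" "Poly_Mapping.keys p \<subseteq> cone a" using assms(1) by (rule J_E)
  obtain q where q: "y = h q" "Poly_Mapping.keys q \<subseteq> cone b" using assms(2) by (rule J_E)
  have "m + n \<in> cone (\<lambda>i. a i + b i)" if "m \<in> cone a" "n \<in> cone b" for m n
    using that add_subgroup_add[OF M] by (auto simp: cone_def lam_add add_mono)
  then have "Poly_Mapping.keys (p * q) \<subseteq> cone (\<lambda>i. a i + b i)"
    using keys_mult[of p q] p q by blast
  then show ?thesis unfolding p q h_mult[symmetric] h_mem_J .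
qed

lemma J_mono: "(\<And>i. i \<in> I \<Longrightarrow> b i \<le> a i) \<Longrightarrow> J a \<subseteq> J b"
  unfolding J_def cone_def by (intro image_mono) (auto dest!: subsetD intro: order_trans)

lemma J_cong: "(\<And>i. i \<in> I \<Longrightarrow> a i = b i) \<Longrightarrow> J a = J b"
  by (intro antisym J_mono) auto

lemma J_L: "J a \<subseteq> L"
  unfolding J_def L_def group_algebra_def cone_def by auto

lemma chi_add: "chi (m + n) = chi m * chi n"
  unfolding chi_def h_mult[symmetric] by (simp add: mult_single)

lemma chi_0: "chi 0 = 1" by (simp add: chi_def h_1)

lemma chi_uminus: "chi (- m) * chi m = 1"
  using chi_add[of "- m" m] chi_0 by simp

lemma chi_nonzero: "chi m \<noteq> 0" using chi_uminus[of m] by auto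

lemma chi_mem_J: "chi m \<in> J a \<longleftrightarrow> m \<in> cone a"
  unfolding chi_def h_mem_J by simp

lemma chi_mem_J': "m \<in> M \<Longrightarrow> chi m \<in> J (\<lambda>i. lam i m)"
  unfolding chi_mem_J by (simp add: cone_def)

lemma one_mem_R: "1 \<in> R"
  using chi_mem_J[of 0] chi_0 by (simp add: cone_def lam_0 add_subgroup_0[OF M])

lemma R_mult: "x \<in> R \<Longrightarrow> y \<in> R \<Longrightarrow> x * y \<in> R"
  using J_mult[of x "\<lambda>_. 0" y "\<lambda>_. 0"] by simp

lemma R_sum: "(\<And>k. k \<in> K \<Longrightarrow> f k \<in> R) \<Longrightarrow> sum f K \<in> R"
  by (induction K rule: infinite_finite_induct) (auto intro: J_add J_0)

lemma L_mult:
  assumes "x \<in> L" and "y \<in> L"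
  shows "x * y \<in> L"
proof -
  obtain p q where "p \<in> group_algebra M" "x = h p" "q \<in> group_algebra M" "y = h q"
    using assms unfolding L_def by blast
  then show ?thesis
    using subring_mult[OF subring_group_algebra[OF M], of p q] unfolding L_def
    by (intro image_eqI[of _ _ "p * q"]) (simp_all add: h_mult)
qed

lemma chi_L: "m \<in> M \<Longrightarrow> chi m \<in> L"
  unfolding chi_def L_def by (auto intro: single_in_group_algebra)

lemma L_cancel_chi:
  assumes "x * chi m \<in> L" and "m \<in> M"
  shows "x \<in> L"
proof -
  have "x * chi m * chi (- m) = x" using chi_uminus[of m] by (simp add: mult.assoc mult.commute)
  then show ?thesis using L_mult[OF assms(1) chi_L[OF add_subgroup_uminus[OF M assms(2)]]] by metis
qed

lemma scale_exists:
  assumes "m \<in> M"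
  shows "\<exists>m'\<in>M. \<forall>i. lam i m' = n * lam i m"
proof (induction n rule: int_induct[of _ 0])
  case base
  then show ?case using add_subgroup_0[OF M] lam_0 by (intro bexI[of _ 0]) auto
next
  case (step1 n)
  then obtain m' where "m' \<in> M" "\<forall>i. lam i m' = n * lam i m" by blast
  then show ?case using assms add_subgroup_add[OF M]
    by (intro bexI[of _ "m' + m"]) (auto simp: lam_add algebra_simps)
next
  case (step2 n)
  then obtain m' where "m' \<in> M" "\<forall>i. lam i m' = n * lam i m" by blast
  then show ?case using assms add_subgroup_add[OF M] add_subgroup_uminus[OF M]
    by (intro bexI[of _ "m' + - m"]) (auto simp only: lam_add lam_uminus algebra_simps)
qed

text \<open>A large multiple of s is added to m: it lifts the forms in K above their bounds and does
  not change the forms that vanish at s.\<close>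

lemma raise_exists:
  assumes "m \<in> M" and "s \<in> M" and "\<And>j. j \<in> K \<Longrightarrow> lam j s > 0" and "K \<subseteq> I"
  shows "\<exists>m'\<in>M. (\<forall>i. lam i s = 0 \<longrightarrow> lam i m' = lam i m) \<and> (\<forall>j\<in>K. a j \<le> lam j m')"
proof -
  \<comment> \<open>The sum of all the deviations bounds each of them. Since \<open>lam j s\<close>
    is a positive integer, N copies of s are enough.\<close>
  define N where "N = (\<Sum>j\<in>K. \<bar>a j - lam j m\<bar>)"
  have K: "finite K" using assms(4) fin finite_subset by blast
  obtain s' where s': "s' \<in> M" "\<And>i. lam i s' = N * lam i s" using scale_exists[OF assms(2)] by blast
  have "a j \<le> lam j (m + s')" if "j \<in> K" for j
  proof -
    have "\<bar>a j - lam j m\<bar> \<le> N" unfolding N_def using K that by (intro member_le_sum) auto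
    moreover have "N * 1 \<le> N * lam j s"
      using assms(3)[OF that] by (intro mult_left_mono) (auto simp: N_def sum_nonneg)
    ultimately show ?thesis by (simp add: lam_add s')
  qed
  then show ?thesis using s' assms(1) add_subgroup_add[OF M]
    by (intro bexI[of _ "m + s'"]) (auto simp: lam_add)
qed

lemma large_exists: "\<exists>m\<in>M. \<forall>i\<in>I. a i \<le> lam i m"
proof -
  obtain s where "s \<in> M" "\<forall>i\<in>I. lam i s > 0" using interior by blast
  then show ?thesis using raise_exists[OF add_subgroup_0[OF M], of s I a] by blast
qed

text \<open>Irredundance and primitivity combined: every bound is attained within the cone. Start
  from \<open>a i\<close> times a vector at which form i is 1, and move parallel to the facet i
  until the other bounds hold.\<close>

lemma corner_exists:
  assumes "i \<in> I"
  shows "\<exists>m\<in>cone a. lam i m = a i"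
proof -
  obtain m where m: "m \<in> M" "lam i m = 1" using primitive[OF assms] by blast
  obtain m' where m': "m' \<in> M" "\<forall>j. lam j m' = a i * lam j m" using scale_exists[OF m(1)] by blast
  obtain s where s: "s \<in> M" "lam i s = 0" "\<forall>j\<in>I - {i}. lam j s > 0" using face[OF assms] by blast
  obtain m'' where "m'' \<in> M" "\<forall>j. lam j s = 0 \<longrightarrow> lam j m'' = lam j m'" "\<forall>j\<in>I - {i}. a j \<le> lam j m''"
    using raise_exists[OF m'(1) s(1), of "I - {i}" a] s(3) by blast
  then show ?thesis using m m' s by (intro bexI[of _ m'']) (auto simp: cone_def)
qed

text \<open>Multiplication by a monomial shifts exponents without cancellation. One monomial deep in
  the cone places z in L; for each facet i, a monomial whose exponent attains the bound
  \<open>a i\<close> then gives the sharp inequality.\<close>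

lemma J_colon:
  assumes z: "\<And>y. y \<in> J a \<Longrightarrow> z * y \<in> J b"
  shows "z \<in> J (\<lambda>i. b i - a i)"
proof -
  obtain m where m: "m \<in> M" "\<forall>i\<in>I. a i \<le> lam i m" using large_exists by blast
  then have "z * chi m \<in> J b" by (intro z) (auto simp: chi_mem_J cone_def)
  then have "z \<in> L" using L_cancel_chi m J_L by blast
  then obtain p where p: "z = h p" "Poly_Mapping.keys p \<subseteq> M" by (rule L_E)
  have "b i - a i \<le> lam i k" if k: "k \<in> Poly_Mapping.keys p" and i: "i \<in> I" for i k
  proof -
    obtain n where n: "n \<in> cone a" "lam i n = a i" using corner_exists[OF i] by blast
    have "z * chi n \<in> J b" using n by (intro z) (simp add: chi_mem_J)
    then have sub: "Poly_Mapping.keys (p * Poly_Mapping.single n 1) \<subseteq> cone b"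
      unfolding p chi_def h_mult[symmetric] h_mem_J .
    have "k + n \<in> Poly_Mapping.keys (p * Poly_Mapping.single n 1)"
      using k by (simp add: in_keys_iff lookup_times_single)
    then have "b i \<le> lam i (k + n)" using sub i by (auto simp: cone_def)
    then show ?thesis using n by (simp add: lam_add)
  qed
  then show ?thesis unfolding p h_mem_J using p(2) by (auto simp: cone_def)
qed

lemma L_in_J: assumes "x \<in> L" shows "\<exists>a. x \<in> J a"
proof -
  obtain p where p: "x = h p" "Poly_Mapping.keys p \<subseteq> M" using assms by (rule L_E)
  define a where "a i = - (\<Sum>k\<in>Poly_Mapping.keys p. \<bar>lam i k\<bar>)" for i
  have "a i \<le> lam i k" if "k \<in> Poly_Mapping.keys p" for i k
    using member_le_sum[OF that, of "\<lambda>k. \<bar>lam i k\<bar>"] by (simp add: a_def)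
  then have "h p \<in> J a" unfolding h_mem_J using p(2) by (auto simp: cone_def)
  then show ?thesis using p by blast
qed

lemma R_frac: "x \<in> R \<Longrightarrow> x \<in> frac_field R"
  unfolding frac_field_def using one_mem_R by (intro CollectI exI[of _ x] exI[of _ 1]) auto

lemma frac_mult: "x \<in> frac_field R \<Longrightarrow> y \<in> frac_field R \<Longrightarrow> x * y \<in> frac_field R"
  using frac_field_mult R_mult by blast

lemma denominator_exists: "\<exists>m\<in>M. chi m \<in> R \<and> (\<forall>x\<in>J a. chi m * x \<in> R)"
proof -
  \<comment> \<open>The maximum with 0 puts \<open>chi m\<close> itself into R, as is required of a
    denominator.\<close>
  obtain m where m: "m \<in> M" "\<forall>i\<in>I. max 0 (- a i) \<le> lam i m"
    using large_exists[of "\<lambda>i. max 0 (- a i)"] by blast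
  have "chi m \<in> R" using m by (auto simp: chi_mem_J cone_def)
  moreover have "chi m * x \<in> R" if "x \<in> J a" for x
  proof -
    have "J (\<lambda>i. lam i m + a i) \<subseteq> R" using m by (intro J_mono) force
    then show ?thesis using J_mult[OF chi_mem_J'[OF m(1)] that] by blast
  qed
  ultimately show ?thesis using m by blast
qed

lemma L_frac: assumes "x \<in> L" shows "x \<in> frac_field R"
proof -
  obtain a where "x \<in> J a" using L_in_J[OF assms] by blast
  then obtain m where m: "chi m \<in> R" "chi m * x \<in> R" using denominator_exists by blast
  have "x = chi m * x / chi m" using chi_nonzero by simp
  then show ?thesis unfolding frac_field_def using m chi_nonzero by blast
qed

section \<open>Multiples of monomial ideals by field elements: inverses and products\<close>

definition mdiv :: "'f \<Rightarrow> ('i \<Rightarrow> int) \<Rightarrow> 'f set" where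
  "mdiv f a = (\<lambda>x. f * x) ` J a"

lemma mem_mdiv: "f \<noteq> 0 \<Longrightarrow> x \<in> mdiv f a \<longleftrightarrow> x / f \<in> J a"
  unfolding mdiv_def by (auto intro: image_eqI[of _ _ "x / f"])

lemma mdiv_frac: "f \<in> frac_field R \<Longrightarrow> mdiv f a \<subseteq> frac_field R"
  unfolding mdiv_def using J_L L_frac frac_mult by blast

lemma ideal_inverse_mdiv:
  assumes f: "f \<in> frac_field R" "f \<noteq> 0"
  shows "ideal_inverse R (mdiv f a) = mdiv (1 / f) (\<lambda>i. - a i)"
proof (intro Set.set_eqI iffI)
  fix x assume "x \<in> ideal_inverse R (mdiv f a)"
  then have "x * f * y \<in> R" if "y \<in> J a" for y
    using that by (auto simp: ideal_inverse_def mdiv_def mult.assoc)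
  then have "x * f \<in> J (\<lambda>i. 0 - a i)" by (rule J_colon)
  then show "x \<in> mdiv (1 / f) (\<lambda>i. - a i)" using f by (simp add: mem_mdiv)
next
  fix x assume x: "x \<in> mdiv (1 / f) (\<lambda>i. - a i)"
  have "x \<in> frac_field R" using x mdiv_frac[OF frac_field_inverse[OF f]] by blast
  moreover have "x * (f * y) \<in> R" if "y \<in> J a" for y
    using J_mult[of "x * f" "\<lambda>i. - a i" y a] that x f by (simp add: mem_mdiv mult.assoc)
  ultimately show "x \<in> ideal_inverse R (mdiv f a)" by (auto simp: ideal_inverse_def mdiv_def)
qed

lemma divisorial_closure_mdiv:
  assumes f: "f \<in> frac_field R" "f \<noteq> 0"
  shows "divisorial_closure R (mdiv f a) = mdiv f a"
  unfolding divisorial_closure_def ideal_inverse_mdiv[OF f]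
  using ideal_inverse_mdiv[OF frac_field_inverse[OF f], of "\<lambda>i. - a i"] f by simp

lemma fractional_ideal_mdiv:
  assumes f: "f \<in> frac_field R" "f \<noteq> 0"
  shows "fractional_ideal R (mdiv f a)"
  unfolding fractional_ideal_def
proof (intro conjI ballI)
  show "mdiv f a \<subseteq> frac_field R" by (rule mdiv_frac[OF f(1)])
  show "0 \<in> mdiv f a" using J_0 f by (simp add: mem_mdiv)
  obtain m where m: "m \<in> M" "\<forall>i\<in>I. a i \<le> lam i m" using large_exists by blast
  then have "f * chi m \<in> mdiv f a" using f by (simp add: mem_mdiv chi_mem_J cone_def)
  then show "mdiv f a \<noteq> {0}" using f chi_nonzero by auto
  show "x + y \<in> mdiv f a" if "x \<in> mdiv f a" "y \<in> mdiv f a" for x y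
    using that f J_add by (simp add: mem_mdiv add_divide_distrib)
  show "r * x \<in> mdiv f a" if "r \<in> R" "x \<in> mdiv f a" for r x
    using that f J_mult[of r "\<lambda>_. 0" "x / f" a] by (simp add: mem_mdiv)
  obtain u v where uv: "f = u / v" "u \<in> R" "v \<in> R" "v \<noteq> 0"
    using f unfolding frac_field_def by blast
  obtain n where n: "n \<in> M" "chi n \<in> R" "\<forall>x\<in>J a. chi n * x \<in> R" using denominator_exists by blast
  have "v * chi n * x \<in> R" if "x \<in> mdiv f a" for x
  proof -
    obtain y where y: "y \<in> J a" "x = f * y" using \<open>x \<in> mdiv f a\<close> by (auto simp: mdiv_def)
    have "v * chi n * x = u * (chi n * y)" using uv y by simp
    then show ?thesis using R_mult[OF uv(2)] n(3) y(1) by metis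
  qed
  then show "\<exists>d\<in>R. d \<noteq> 0 \<and> (\<forall>x\<in>mdiv f a. d * x \<in> R)"
    using R_mult[OF uv(3) n(2)] uv chi_nonzero by (intro bexI[of _ "v * chi n"]) auto
qed

lemma R_eq_mdiv: "R = mdiv 1 (\<lambda>_. 0)"
  by (simp add: mdiv_def)

text \<open>The product of two such ideals may be smaller than the ideal with the added bounds. Its
  inverse is nevertheless determined by applying \<open>J_colon\<close> once per factor, and a
  second inversion gives the closure.\<close>

lemma divisorial_closure_prod:
  assumes f: "f \<in> frac_field R" "f \<noteq> 0" and g: "g \<in> frac_field R" "g \<noteq> 0"
  shows "divisorial_closure R (fractional_ideal_prod (mdiv f a) (mdiv g b)) = mdiv (f * g) (\<lambda>i. a i + b i)"
proof -
  let ?P = "fractional_ideal_prod (mdiv f a) (mdiv g b)"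
  have fg: "f * g \<in> frac_field R" "f * g \<noteq> 0" using f g frac_mult by auto
  have prod: "x * y \<in> ?P" if "x \<in> mdiv f a" "y \<in> mdiv g b" for x y
    unfolding fractional_ideal_prod_def using that
    by (intro CollectI exI[of _ "1::nat"] exI[of _ "\<lambda>_. x"] exI[of _ "\<lambda>_. y"]) auto
  have "ideal_inverse R ?P = mdiv (1 / (f * g)) (\<lambda>i. - (a i + b i))"
  proof (intro Set.set_eqI iffI)
    fix x assume x: "x \<in> ideal_inverse R ?P"
    have "x * f * g * y \<in> J (\<lambda>i. - b i)" if y: "y \<in> J a" for y
    proof -
      have "x * f * g * y * z \<in> R" if z: "z \<in> J b" for z
      proof -
        have "(f * y) * (g * z) \<in> ?P" using y z by (intro prod) (auto simp: mdiv_def)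
        then have "x * ((f * y) * (g * z)) \<in> R" using x by (simp add: ideal_inverse_def)
        then show ?thesis by (simp add: mult_ac)
      qed
      then have "x * f * g * y \<in> J (\<lambda>i. 0 - b i)" by (rule J_colon)
      then show ?thesis by simp
    qed
    then have "x * f * g \<in> J (\<lambda>i. - b i - a i)" by (rule J_colon)
    moreover have "J (\<lambda>i. - b i - a i) = J (\<lambda>i. - (a i + b i))" by (rule J_cong) simp
    ultimately show "x \<in> mdiv (1 / (f * g)) (\<lambda>i. - (a i + b i))"
      using f g by (simp add: mem_mdiv mult.assoc)
  next
    fix x assume x: "x \<in> mdiv (1 / (f * g)) (\<lambda>i. - (a i + b i))"
    have "x * y \<in> R" if y: "y \<in> ?P" for y
    proof -
      obtain n :: nat and u v where uv: "y = (\<Sum>k<n. u k * v k)" "\<forall>k<n. u k \<in> mdiv f a \<and> v k \<in> mdiv g b"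
        using y unfolding fractional_ideal_prod_def by blast
      have "x * (u k * v k) \<in> R" if "k < n" for k
      proof -
        have "u k / f * (v k / g) \<in> J (\<lambda>i. a i + b i)"
          using uv(2) that f g by (intro J_mult) (auto simp: mem_mdiv)
        moreover have "x / (1 / (f * g)) \<in> J (\<lambda>i. - (a i + b i))"
          using x fg mem_mdiv[of "1 / (f * g)"] by simp
        ultimately have "x / (1 / (f * g)) * (u k / f * (v k / g)) \<in> J (\<lambda>i. - (a i + b i) + (a i + b i))"
          by (intro J_mult[of _ "\<lambda>i. - (a i + b i)"])
        then show ?thesis using f g by simp
      qed
      then show ?thesis unfolding uv(1) sum_distrib_left by (intro R_sum) auto
    qed
    then show "x \<in> ideal_inverse R ?P"
      unfolding ideal_inverse_def using x mdiv_frac[OF frac_field_inverse[OF fg]] by blast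
  qed
  then show ?thesis
    unfolding divisorial_closure_def
    using ideal_inverse_mdiv[OF frac_field_inverse[OF fg], of "\<lambda>i. - (a i + b i)"] fg(2)
    by (simp add: add.commute)
qed

text \<open>
  A divisorial ideal is an intersection of principal ones. After division by a greatest common
  divisor in the factorial ring \<open>L\<close> only the conditions at the facets remain.
\<close>

lemma divisorial_is_mdiv:
  assumes D: "fractional_ideal R D" "divisorial_closure R D = D"
  shows "\<exists>f\<in>frac_field R. \<exists>a. f \<noteq> 0 \<and> D = mdiv f a"
proof -
  let ?T = "group_algebra M :: ('m \<Rightarrow>\<^sub>0 'k) set"
  note S = subring_group_algebra[OF M, where ?'k = 'k]
  define X where "X = ideal_inverse R D"
  have D_eq: "x \<in> D \<longleftrightarrow> x \<in> frac_field R \<and> (\<forall>y\<in>X. x * y \<in> R)" for x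
    using D(2) unfolding divisorial_closure_def X_def[symmetric] by (auto simp: ideal_inverse_def)
  obtain x0 where x0: "x0 \<in> D" "x0 \<noteq> 0" using D(1) unfolding fractional_ideal_def by blast
  obtain d where d: "d \<in> R" "d \<noteq> 0" "\<forall>x\<in>D. d * x \<in> R" using D(1) unfolding fractional_ideal_def by blast
  have dX: "d \<in> X" using d R_frac by (auto simp: X_def ideal_inverse_def)
  have x0F: "x0 \<in> frac_field R" using x0 D_eq by blast
  \<comment> \<open>Multiplication by \<open>x0\<close>, an element of D, carries the inverse X of D
    into R and hence into L, where greatest common divisors exist.\<close>
  define G where "G = {g \<in> ?T. \<exists>y\<in>X. h g = x0 * y}"
  have G_ex: "\<exists>g\<in>G. h g = x0 * y" if "y \<in> X" for y
  proof -
    have "x0 * y \<in> L" using D_eq x0 that J_L by blast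
    then obtain g where "g \<in> ?T" "h g = x0 * y" unfolding L_def by (metis imageE)
    then show ?thesis using that unfolding G_def by blast
  qed
  obtain g0 where g0: "g0 \<in> G" "h g0 = x0 * d" using G_ex[OF dX] by blast
  have g00: "g0 \<noteq> 0" using g0 x0 d h_0 by auto
  have "\<exists>f\<in>?T. f \<noteq> 0 \<and> (\<forall>g\<in>G. dvd_in ?T f g) \<and>
    (\<forall>r\<in>?T. \<forall>s\<in>?T. s \<noteq> 0 \<longrightarrow> (\<forall>g\<in>G. dvd_in ?T s (r * g)) \<longrightarrow> dvd_in ?T s (r * f))"
  proof (rule factorial_in_gcd[OF fac])
    show "G \<subseteq> ?T" by (auto simp: G_def)
    show "\<exists>g\<in>G. g \<noteq> 0" using g0(1) g00 by blast
  qed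
  then obtain f where f: "f \<in> ?T" "f \<noteq> 0" and f_dvd: "\<And>g. g \<in> G \<Longrightarrow> dvd_in ?T f g"
    and f_gcd: "\<And>r s. r \<in> ?T \<Longrightarrow> s \<in> ?T \<Longrightarrow> s \<noteq> 0 \<Longrightarrow> (\<And>g. g \<in> G \<Longrightarrow> dvd_in ?T s (r * g)) \<Longrightarrow> dvd_in ?T s (r * f)"
    by blast
  have hf: "h f \<noteq> 0" using f h_eq_0 by blast
  define G' where "G' = {g \<in> ?T. f * g \<in> G}"
  \<comment> \<open>Divided by \<open>x0 / h f\<close>, the ideal D lies in the Laurent ring, and
    membership depends only on the products with the reduced set G', that is, G divided by its gcd
    f.\<close>
  have D_eq': "x \<in> D \<longleftrightarrow> (\<exists>w\<in>?T. x = x0 / h f * h w \<and> (\<forall>g\<in>G'. h (w * g) \<in> R))" for x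
  proof
    assume x: "x \<in> D"
    define z where "z = x / x0"
    have zg: "z * h g \<in> R" if "g \<in> G" for g
    proof -
      obtain y where "y \<in> X" "h g = x0 * y" using \<open>g \<in> G\<close> by (auto simp: G_def)
      then show ?thesis using x D_eq x0 by (simp add: z_def)
    qed
    then have "\<exists>w\<in>?T. z * h g = h w" if "g \<in> G" for g
      using that J_L unfolding L_def by blast
    then obtain w where w: "\<And>g. g \<in> G \<Longrightarrow> w g \<in> ?T \<and> z * h g = h (w g)" by metis
    \<comment> \<open>In the field, z is \<open>h (w g0) / h g0\<close>. This fraction multiplies
      all of G into L, so by the gcd property it also multiplies f into L.\<close>
    have "dvd_in ?T g0 (w g0 * f)"
    proof (rule f_gcd)
      show "dvd_in ?T g0 (w g0 * g)" if g: "g \<in> G" for g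
      proof -
        have "h (w g0 * g) = h (g0 * w g)" using w[OF g] w[OF g0(1)] by (simp add: h_mult) (metis mult.commute mult.left_commute)
        then show ?thesis unfolding dvd_in_def h_inj using w[OF g] by blast
      qed
    qed (use w g0 g00 in \<open>auto simp: G_def\<close>)
    then obtain v where v: "v \<in> ?T" "w g0 * f = g0 * v" by (auto simp: dvd_in_def)
    have hg0: "h g0 \<noteq> 0" using g00 h_eq_0 by blast
    have "h g0 * (z * h f) = h (w g0 * f)" using w[OF g0(1)] by (simp add: h_mult mult_ac)
    also have "\<dots> = h g0 * h v" by (simp only: v(2) h_mult)
    finally have zf: "z * h f = h v" using hg0 by simp
    then have "x = x0 / h f * h v" using hf x0 by (simp add: z_def field_simps)
    moreover have "h (v * g) \<in> R" if "g \<in> G'" for g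
      using zg[of "f * g"] that zf by (simp add: G'_def h_mult mult.assoc[symmetric])
    ultimately show "\<exists>w\<in>?T. x = x0 / h f * h w \<and> (\<forall>g\<in>G'. h (w * g) \<in> R)" using v by blast
  next
    assume "\<exists>w\<in>?T. x = x0 / h f * h w \<and> (\<forall>g\<in>G'. h (w * g) \<in> R)"
    then obtain w where w: "w \<in> ?T" "x = x0 / h f * h w" "\<forall>g\<in>G'. h (w * g) \<in> R" by blast
    have "h f \<in> frac_field R" "h w \<in> frac_field R" using f w by (auto intro!: L_frac simp: L_def)
    then have "x0 * (1 / h f) * h w \<in> frac_field R"
      using x0F frac_field_inverse[OF _ hf] frac_mult by blast
    then have "x \<in> frac_field R" by (simp add: w)
    moreover have "x * y \<in> R" if y: "y \<in> X" for y
    proof -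
      obtain g where g: "g \<in> G" "h g = x0 * y" using G_ex[OF y] by blast
      obtain g' where g': "g' \<in> ?T" "g = f * g'" using f_dvd[OF g(1)] by (auto simp: dvd_in_def)
      have "x * y = h w / h f * h g" using g by (simp add: w)
      also have "\<dots> = h (w * g')" using hf by (simp add: g' h_mult)
      finally show ?thesis using w g g' by (simp add: G'_def)
    qed
    ultimately show "x \<in> D" using D_eq by blast
  qed
  obtain w0 where w0: "w0 \<in> ?T" "x0 = x0 / h f * h w0" "\<forall>g\<in>G'. h (w0 * g) \<in> R" using D_eq' x0 by blast
  have w00: "w0 \<noteq> 0" using w0 x0 h_0 by auto
  \<comment> \<open>The order of w along the facet i. It is additive on products of nonzero elements
    by \<open>mn_mult\<close>, so membership of a product in R becomes one inequality per
    facet.\<close>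
  define mn where "mn i w = Min (lam i ` Poly_Mapping.keys w)" for i and w :: "'m \<Rightarrow>\<^sub>0 'k"
  have mn_le: "c \<le> mn i w \<longleftrightarrow> (\<forall>k\<in>Poly_Mapping.keys w. c \<le> lam i k)" if "w \<noteq> 0" for c i w
    unfolding mn_def using keys_nonempty[OF that] by (subst Min_ge_iff) auto
  have mn_mult: "mn i (w * g) = mn i w + mn i g" if nz: "w \<noteq> 0" "g \<noteq> 0" for i w g
  proof -
    have wg: "w * g \<noteq> 0" using that by simp
    obtain m n where mn: "m \<in> Poly_Mapping.keys w" "n \<in> Poly_Mapping.keys g"
      "m + n \<in> Poly_Mapping.keys (w * g)" "\<forall>x\<in>Poly_Mapping.keys w. lam i m \<le> lam i x"
      "\<forall>x\<in>Poly_Mapping.keys g. lam i n \<le> lam i x"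
      using keys_mult_minimal[OF nz, of "lam i"] lam_add by blast
    have 1: "mn i w = lam i m" "mn i g = lam i n"
      unfolding mn_def using mn by (auto intro!: Min_eqI)
    have "lam i m + lam i n \<le> mn i (w * g)"
      unfolding mn_le[OF wg]
    proof
      fix k assume "k \<in> Poly_Mapping.keys (w * g)"
      then obtain a b where "k = a + b" "a \<in> Poly_Mapping.keys w" "b \<in> Poly_Mapping.keys g"
        using keys_mult[of w g] by blast
      then show "lam i m + lam i n \<le> lam i k" using mn by (simp add: lam_add add_mono)
    qed
    moreover have "mn i (w * g) \<le> lam i (m + n)" using mn_le[OF wg, of "mn i (w * g)" i] mn(3) by blast
    ultimately show ?thesis using 1 by (simp add: lam_add)
  qed
  have R_iff: "h p \<in> R \<longleftrightarrow> (\<forall>i\<in>I. 0 \<le> mn i p)" if "p \<in> ?T" "p \<noteq> 0" for p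
    unfolding h_mem_J using that mn_le[OF that(2)] by (auto simp: cone_def group_algebra_def)
  have GT: "G' \<subseteq> ?T" by (auto simp: G'_def)
  obtain g1 where g1: "g1 \<in> ?T" "g0 = f * g1" using f_dvd[OF g0(1)] by (auto simp: dvd_in_def)
  have g1G: "g1 \<in> G'" "g1 \<noteq> 0" using g1 g0 g00 by (auto simp: G'_def)
  \<comment> \<open>The least order along i that brings every product with a nonzero g in G' to
    nonnegative order there. For a facet i the supremum exists: \<open>g1\<close> makes the set
    nonempty, and \<open>w0\<close>, which represents \<open>x0\<close> itself, satisfies all the
    conditions and bounds it.\<close>
  define a where "a i = Sup ((\<lambda>g. - mn i g) ` (G' - {0}))" for i
  have a_le: "a i \<le> c \<longleftrightarrow> (\<forall>g\<in>G' - {0}. - mn i g \<le> c)" if "i \<in> I" for i c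
    unfolding a_def
  proof (subst cSup_le_iff)
    show "(\<lambda>g. - mn i g) ` (G' - {0}) \<noteq> {}" using g1G by auto
    have "- mn i g \<le> mn i w0" if g: "g \<in> G' - {0}" for g
    proof -
      have "w0 * g \<in> ?T" "w0 * g \<noteq> 0" using subring_mult[OF S w0(1)] g GT w00 by auto
      then have "0 \<le> mn i (w0 * g)" using R_iff \<open>i \<in> I\<close> w0(3) g by blast
      then show ?thesis using mn_mult[OF w00, of g i] g by simp
    qed
    then show "bdd_above ((\<lambda>g. - mn i g) ` (G' - {0}))" by (intro bdd_aboveI2)
  qed auto
  have "(\<forall>g\<in>G'. h (w * g) \<in> R) \<longleftrightarrow> h w \<in> J a" if w: "w \<in> ?T" for w
  proof (cases "w = 0")
    case True
    then show ?thesis using J_0 h_0 by simp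
  next
    case False
    have "(\<forall>g\<in>G'. h (w * g) \<in> R) \<longleftrightarrow> (\<forall>g\<in>G' - {0}. h (w * g) \<in> R)"
      using J_0 h_0 by (metis Diff_iff mult_zero_right singletonD)
    also have "\<dots> \<longleftrightarrow> (\<forall>g\<in>G' - {0}. \<forall>i\<in>I. - mn i g \<le> mn i w)"
    proof (rule ball_cong[OF refl])
      fix g assume g: "g \<in> G' - {0}"
      have "w * g \<in> ?T" "w * g \<noteq> 0" using subring_mult[OF S w] g GT False by auto
      then show "h (w * g) \<in> R \<longleftrightarrow> (\<forall>i\<in>I. - mn i g \<le> mn i w)"
        using R_iff mn_mult[OF False] g by (auto simp: minus_le_iff add.commute le_minus_iff)
    qed
    also have "\<dots> \<longleftrightarrow> (\<forall>i\<in>I. a i \<le> mn i w)" using a_le by blast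
    also have "\<dots> \<longleftrightarrow> h w \<in> J a"
      unfolding h_mem_J using w mn_le[OF False] by (auto simp: cone_def group_algebra_def)
    finally show ?thesis .
  qed
  then have "D = mdiv (x0 / h f) a"
    unfolding mdiv_def set_eq_iff D_eq' using J_L unfolding L_def by fastforce
  moreover have "x0 * (1 / h f) \<in> frac_field R"
  proof (intro frac_mult[OF x0F] frac_field_inverse[OF _ hf] L_frac)
    show "h f \<in> L" using f(1) by (auto simp: L_def)
  qed
  ultimately show ?thesis using x0 hf by (intro bexI[of _ "x0 / h f"] exI[of _ a]) auto
qed

text \<open>The quotient u = f / g multiplies \<open>J a\<close> into \<open>J b\<close>, and its
  inverse does the reverse, so both are Laurent polynomials, with exponents bounded below by b - a
  and a - b. Extremal exponents in their product 1 show that every exponent of u meets its bounds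
  with equality.\<close>

lemma mdiv_eqD:
  assumes "f \<noteq> 0" and "g \<noteq> 0" and eq: "mdiv f a = mdiv g b"
  shows "\<exists>m\<in>M. \<forall>i\<in>I. b i - a i = lam i m"
proof -
  define u where "u = f / g"
  have mul: "u * y \<in> J b" if "y \<in> J a" for y
  proof -
    have "f * y \<in> mdiv f a" using that by (auto simp: mdiv_def)
    then have "f * y \<in> mdiv g b" by (simp only: eq)
    then show ?thesis using assms(1,2) by (simp add: mem_mdiv u_def)
  qed
  have mul': "(1 / u) * y \<in> J a" if "y \<in> J b" for y
  proof -
    have "g * y \<in> mdiv g b" using that by (auto simp: mdiv_def)
    then have "g * y \<in> mdiv f a" by (simp only: eq)
    then show ?thesis using assms(1,2) by (simp add: mem_mdiv u_def)
  qed
  obtain p where p: "u = h p" "Poly_Mapping.keys p \<subseteq> cone (\<lambda>i. b i - a i)"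
    using J_colon[OF mul] by (rule J_E)
  obtain q where q: "1 / u = h q" "Poly_Mapping.keys q \<subseteq> cone (\<lambda>i. a i - b i)"
    using J_colon[OF mul'] by (rule J_E)
  have "u \<noteq> 0" using assms(1,2) by (simp add: u_def)
  then have "h (p * q) = h 1" by (simp add: h_mult h_1 p(1)[symmetric] q(1)[symmetric])
  then have pq: "p * q = 1" by (simp only: h_inj)
  then have p0: "p \<noteq> 0" and q0: "q \<noteq> 0" by auto
  obtain k where k: "k \<in> Poly_Mapping.keys p" using keys_nonempty[OF p0] by blast
  have "b i - a i = lam i k" if i: "i \<in> I" for i
  proof -
    \<comment> \<open>The form is negated so that m maximises \<open>lam i\<close>. Since m + n = 0,
      the lower bound at n is an upper bound at m.\<close>
    obtain m n where mn: "m \<in> Poly_Mapping.keys p" "n \<in> Poly_Mapping.keys q"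
      "m + n \<in> Poly_Mapping.keys (p * q)" "\<forall>x\<in>Poly_Mapping.keys p. - lam i m \<le> - lam i x"
      using keys_mult_minimal[OF p0 q0, of "\<lambda>m. - lam i m"] by (auto simp: lam_add)
    have "m + n = 0" using mn(3) by (simp add: pq)
    then have "lam i m + lam i n = 0" using lam_add[of i m n] lam_0[of i] by simp
    moreover have "a i - b i \<le> lam i n" "b i - a i \<le> lam i k" using mn(2) k p q i by (auto simp: cone_def)
    moreover have "lam i k \<le> lam i m" using mn(4) k by simp
    ultimately show ?thesis by linarith
  qed
  moreover have "k \<in> M" using k p by (auto simp: cone_def)
  ultimately show ?thesis by blast
qed

lemma mdiv_chi:
  assumes m: "m \<in> M" and a: "\<And>i. i \<in> I \<Longrightarrow> a i = lam i m"
  shows "mdiv f a = mdiv (f * chi m) (\<lambda>_. 0)"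
proof -
  have "J a = mdiv (chi m) (\<lambda>_. 0)"
  proof (intro Set.set_eqI iffI)
    fix x assume x: "x \<in> J a"
    have "chi (- m) * x \<in> J (\<lambda>i. lam i (- m) + a i)"
      by (rule J_mult[OF chi_mem_J'[OF add_subgroup_uminus[OF M m]] x])
    also have "J (\<lambda>i. lam i (- m) + a i) = R" using a by (intro J_cong) (simp add: lam_uminus)
    finally have "chi (- m) * x \<in> R" .
    moreover have "x / chi m = chi (- m) * x"
      using chi_uminus[of m] chi_nonzero[of m] by (simp add: field_simps)
    ultimately show "x \<in> mdiv (chi m) (\<lambda>_. 0)" using chi_nonzero by (simp add: mem_mdiv)
  next
    fix x assume "x \<in> mdiv (chi m) (\<lambda>_. 0)"
    then obtain y where y: "y \<in> R" "x = chi m * y" by (auto simp: mdiv_def)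
    have "chi m * y \<in> J (\<lambda>i. lam i m + 0)" by (rule J_mult[OF chi_mem_J'[OF m] y(1)])
    also have "J (\<lambda>i. lam i m + 0) = J a" using a by (intro J_cong) simp
    finally show "x \<in> J a" using y by simp
  qed
  then have "mdiv f a = (*) f ` mdiv (chi m) (\<lambda>_. 0)" by (simp add: mdiv_def)
  then show ?thesis by (simp add: mdiv_def image_image mult.assoc)
qed

section \<open>The divisor group and the class group\<close>

lemma carrier_divisor_group:
  "carrier (divisor_group R) = {mdiv f a | f a. f \<in> frac_field R \<and> f \<noteq> 0}"
  using divisorial_is_mdiv fractional_ideal_mdiv divisorial_closure_mdiv
  unfolding divisor_group_def by fastforce

lemma mult_divisor_group:
  assumes "f \<in> frac_field R" "f \<noteq> 0" and "g \<in> frac_field R" "g \<noteq> 0"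
  shows "mdiv f a \<otimes>\<^bsub>divisor_group R\<^esub> mdiv g b = mdiv (f * g) (\<lambda>i. a i + b i)"
  using divisorial_closure_prod[OF assms] by (simp add: divisor_group_def)

lemma one_divisor_group: "\<one>\<^bsub>divisor_group R\<^esub> = mdiv 1 (\<lambda>_. 0)"
  using R_eq_mdiv by (simp add: divisor_group_def)

lemma one_frac: "1 \<in> frac_field R" by (rule R_frac[OF one_mem_R])

lemma group_divisor_group: "group (divisor_group R)"
proof (rule groupI)
  show "\<one>\<^bsub>divisor_group R\<^esub> \<in> carrier (divisor_group R)"
    unfolding one_divisor_group carrier_divisor_group using one_frac by fastforce
  fix x assume "x \<in> carrier (divisor_group R)"
  then obtain f a where x: "x = mdiv f a" "f \<in> frac_field R" "f \<noteq> 0" unfolding carrier_divisor_group by blast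
  show "\<one>\<^bsub>divisor_group R\<^esub> \<otimes>\<^bsub>divisor_group R\<^esub> x = x"
    unfolding one_divisor_group x(1) using mult_divisor_group[OF one_frac _ x(2,3)] by simp
  have "mdiv (1 / f) (\<lambda>i. - a i) \<in> carrier (divisor_group R)"
    unfolding carrier_divisor_group using frac_field_inverse[OF x(2,3)] x(3) by fastforce
  moreover have "mdiv (1 / f) (\<lambda>i. - a i) \<otimes>\<^bsub>divisor_group R\<^esub> x = \<one>\<^bsub>divisor_group R\<^esub>"
    unfolding one_divisor_group x(1) using mult_divisor_group[OF frac_field_inverse[OF x(2,3)] _ x(2,3)] x(3) by simp
  ultimately show "\<exists>y\<in>carrier (divisor_group R). y \<otimes>\<^bsub>divisor_group R\<^esub> x = \<one>\<^bsub>divisor_group R\<^esub>" by blast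
  fix y assume "y \<in> carrier (divisor_group R)"
  then obtain g b where y: "y = mdiv g b" "g \<in> frac_field R" "g \<noteq> 0" unfolding carrier_divisor_group by blast
  show "x \<otimes>\<^bsub>divisor_group R\<^esub> y \<in> carrier (divisor_group R)"
    unfolding x(1) y(1) mult_divisor_group[OF x(2,3) y(2,3)] carrier_divisor_group
    using frac_mult[OF x(2) y(2)] x(3) y(3) by fastforce
  fix z assume "z \<in> carrier (divisor_group R)"
  then obtain k c where z: "z = mdiv k c" "k \<in> frac_field R" "k \<noteq> 0" unfolding carrier_divisor_group by blast
  show "x \<otimes>\<^bsub>divisor_group R\<^esub> y \<otimes>\<^bsub>divisor_group R\<^esub> z = x \<otimes>\<^bsub>divisor_group R\<^esub> (y \<otimes>\<^bsub>divisor_group R\<^esub> z)"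
    unfolding x(1) y(1) z(1)
    using x(2,3) y(2,3) z(2,3) frac_mult by (simp add: mult_divisor_group mult.assoc add.assoc)
qed

text \<open>The map sends \<open>mdiv f a\<close> to \<open>\<theta> a\<close> and forgets f. It is
  well defined because equal ideals have bounds that differ by a vector of M. Its kernel consists of
  the principal ideals because a monomial ideal whose bounds come from M is generated by a
  monomial.\<close>

theorem class_group_iso:
  fixes G (structure)
  assumes G: "group G"
    and closed: "\<And>a. \<theta> a \<in> carrier G"
    and add: "\<And>a b. \<theta> (\<lambda>i. a i + b i) = \<theta> a \<otimes> \<theta> b"
    and surj: "\<And>x. x \<in> carrier G \<Longrightarrow> \<exists>a. \<theta> a = x"
    and ker: "\<And>a. \<theta> a = \<one> \<longleftrightarrow> (\<exists>m\<in>M. \<forall>i\<in>I. a i = lam i m)"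
  shows "class_group R \<cong> G" and "group (class_group R)"
proof -
  interpret G: group G by (rule G)
  have wd: "\<theta> a = \<theta> b" if fg: "f \<noteq> 0" "g \<noteq> 0" "mdiv f a = mdiv g b" for f g a b
  proof -
    have "\<theta> (\<lambda>i. b i - a i) = \<one>" using mdiv_eqD[OF fg] ker by auto
    moreover have "\<theta> b = \<theta> a \<otimes> \<theta> (\<lambda>i. b i - a i)" using add[of a "\<lambda>i. b i - a i"] by simp
    ultimately show ?thesis using closed by simp
  qed
  define \<Psi> where "\<Psi> D = (THE x. \<exists>f a. f \<noteq> 0 \<and> D = mdiv f a \<and> x = \<theta> a)" for D
  have \<Psi>: "\<Psi> (mdiv f a) = \<theta> a" if "f \<noteq> 0" for f a
    unfolding \<Psi>_def using that wd by (intro the_equality) blast+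
  have hom: "group_hom (divisor_group R) G \<Psi>"
  proof (intro group_hom.intro group_divisor_group G group_hom_axioms.intro homI)
    fix x assume "x \<in> carrier (divisor_group R)"
    then obtain f a where x: "x = mdiv f a" "f \<in> frac_field R" "f \<noteq> 0" unfolding carrier_divisor_group by blast
    show "\<Psi> x \<in> carrier G" using x \<Psi> closed by simp
    fix y assume "y \<in> carrier (divisor_group R)"
    then obtain g b where y: "y = mdiv g b" "g \<in> frac_field R" "g \<noteq> 0" unfolding carrier_divisor_group by blast
    show "\<Psi> (x \<otimes>\<^bsub>divisor_group R\<^esub> y) = \<Psi> x \<otimes> \<Psi> y"
      using x y by (simp add: mult_divisor_group \<Psi> add)
  qed
  have img: "\<Psi> ` carrier (divisor_group R) = carrier G"
  proof
    show "\<Psi> ` carrier (divisor_group R) \<subseteq> carrier G"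
      unfolding carrier_divisor_group using \<Psi> closed by auto
    show "carrier G \<subseteq> \<Psi> ` carrier (divisor_group R)"
    proof
      fix x assume "x \<in> carrier G"
      then obtain a where "\<theta> a = x" using surj by blast
      then have "x = \<Psi> (mdiv 1 a)" using \<Psi> by simp
      moreover have "mdiv 1 a \<in> carrier (divisor_group R)"
        unfolding carrier_divisor_group using one_frac by fastforce
      ultimately show "x \<in> \<Psi> ` carrier (divisor_group R)" by blast
    qed
  qed
  have "kernel (divisor_group R) G \<Psi> = principal_divisors R"
  proof (intro Set.set_eqI iffI)
    fix x assume "x \<in> kernel (divisor_group R) G \<Psi>"
    then obtain f a where x: "x = mdiv f a" "f \<in> frac_field R" "f \<noteq> 0" and "\<Psi> x = \<one>"
      unfolding kernel_def carrier_divisor_group by blast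
    then have "\<theta> a = \<one>" using \<Psi> by simp
    then obtain m where m: "m \<in> M" "\<forall>i\<in>I. a i = lam i m" using ker by blast
    have "x = mdiv (f * chi m) (\<lambda>_. 0)" unfolding x(1) using m by (intro mdiv_chi) auto
    moreover have "f * chi m \<in> frac_field R" using x(2) L_frac[OF chi_L[OF m(1)]] by (rule frac_mult)
    ultimately show "x \<in> principal_divisors R"
      unfolding principal_divisors_def mdiv_def using x(3) chi_nonzero by fastforce
  next
    fix x assume "x \<in> principal_divisors R"
    then obtain f where f: "x = mdiv f (\<lambda>_. 0)" "f \<in> frac_field R" "f \<noteq> 0"
      unfolding principal_divisors_def mdiv_def by blast
    moreover have "\<theta> (\<lambda>_. 0) = \<one>" using ker add_subgroup_0[OF M] lam_0 by fastforce
    ultimately show "x \<in> kernel (divisor_group R) G \<Psi>"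
      unfolding kernel_def carrier_divisor_group using \<Psi> by auto
  qed
  then show "class_group R \<cong> G" "group (class_group R)"
    unfolding class_group_def
    using group_hom.FactGroup_iso[OF hom img] normal.factorgroup_is_group[OF group_hom.normal_kernel[OF hom]]
    by simp_all
qed

end


section \<open>Facets of the edge cone of a two-connected bipartite graph\<close>

text \<open>Connectedness of the subgraph induced on W, expressed by cuts and not by paths. Its
  negation is directly a splitting into two parts without edges between them, which is the form that
  all later arguments need.\<close>

definition cut_connected :: "'v set set \<Rightarrow> 'v set \<Rightarrow> bool" where
  "cut_connected E W \<longleftrightarrow> W \<noteq> {} \<and>
     (\<forall>X\<subseteq>W. X \<noteq> {} \<longrightarrow> X \<noteq> W \<longrightarrow> (\<exists>x\<in>X. \<exists>y\<in>W - X. {x, y} \<in> E))"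

lemma cut_connectedD:
  assumes "cut_connected E W" and "X \<subseteq> W" and "X \<noteq> {}" and "X \<noteq> W"
  obtains x y where "x \<in> X" and "y \<in> W" and "y \<notin> X" and "{x, y} \<in> E"
  using assms unfolding cut_connected_def by (metis DiffE)

lemma cut_connected_neighbour:
  assumes "cut_connected E W" and "v \<in> W" and "W \<noteq> {v}"
  obtains w where "w \<in> W" and "w \<noteq> v" and "{v, w} \<in> E"
  using cut_connectedD[OF assms(1), of "{v}"] assms by auto

lemma cut_connected_cases:
  assumes "cut_connected E W" and "W \<subseteq> X \<union> Y" and "X \<inter> Y = {}"
    and "\<And>x y. x \<in> W \<Longrightarrow> y \<in> W \<Longrightarrow> x \<in> X \<Longrightarrow> y \<in> Y \<Longrightarrow> {x, y} \<notin> E"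
  shows "W \<subseteq> X \<or> W \<subseteq> Y"
proof (rule ccontr)
  assume "\<not> (W \<subseteq> X \<or> W \<subseteq> Y)"
  then have "W \<inter> X \<noteq> {}" "W \<inter> X \<noteq> W" using assms(2) by blast+
  then obtain x y where "x \<in> W \<inter> X" "y \<in> W" "y \<notin> W \<inter> X" "{x, y} \<in> E"
    using cut_connectedD[OF assms(1), of "W \<inter> X"] by blast
  then show False using assms(2,4) by blast
qed

text \<open>A path from a point of X to a point outside has to leave X. The separate edge set F
  covers graphs with a deleted vertex, while \<open>cut_connected\<close> always refers to the full
  edge set.\<close>

lemma connected_graph_cut_connected:
  assumes "connected_graph W F" and "F \<subseteq> E" and "\<And>e. e \<in> F \<Longrightarrow> e \<subseteq> W"
  shows "cut_connected E W"
  unfolding cut_connected_def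
proof (intro conjI allI impI)
  show "W \<noteq> {}" using assms(1) by (simp add: connected_graph_def)
  fix X assume X: "X \<subseteq> W" "X \<noteq> {}" "X \<noteq> W"
  then obtain u v where uv: "u \<in> X" "v \<in> W" "v \<notin> X" by blast
  then have "(u, v) \<in> {(a, b). {a, b} \<in> F}\<^sup>*"
    using assms(1) X by (auto simp: connected_graph_def)
  then have "v \<in> X \<or> (\<exists>x\<in>X. \<exists>y\<in>W - X. {x, y} \<in> E)"
  proof (induction rule: rtrancl_induct)
    case (step y z)
    then have "{y, z} \<in> F" by simp
    then have "z \<in> W" "{y, z} \<in> E" using assms(2) assms(3)[of "{y, z}"] by auto
    then show ?case using step by blast
  qed (use uv in simp)
  then show "\<exists>x\<in>X. \<exists>y\<in>W - X. {x, y} \<in> E" using uv by blast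
qed

locale two_connected_bipartite =
  fixes A B :: "'v set" and E :: "'v set set"
  assumes finite_A: "finite A" and finite_B: "finite B" and disjoint: "A \<inter> B = {}"
    and edges: "e \<in> E \<Longrightarrow> \<exists>a\<in>A. \<exists>b\<in>B. e = {a, b}"
    and connected: "cut_connected E (A \<union> B)"
    and connected_minus: "v \<in> A \<union> B \<Longrightarrow> cut_connected E (A \<union> B - {v})"
    and card_ge_3: "card (A \<union> B) \<ge> 3"
begin

definition N :: "'v set \<Rightarrow> 'v set" where
  "N T = {b \<in> B. \<exists>a\<in>T. {a, b} \<in> E}"

text \<open>A set with \<open>N T = B\<close> is left out because its inequality already follows
  from nonnegativity: x(T) is at most x(A) = x(B).\<close>

definition acceptable :: "'v set set" where
  "acceptable = {T. T \<subseteq> A \<and> T \<noteq> {} \<and> N T \<noteq> B \<and> cut_connected E (T \<union> N T) \<and>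
     cut_connected E ((A - T) \<union> (B - N T))}"

lemma N_subset: "N T \<subseteq> B" by (auto simp: N_def)

lemma N_mono: "S \<subseteq> T \<Longrightarrow> N S \<subseteq> N T" by (auto simp: N_def)

lemma edge_cases:
  assumes "{x, y} \<in> E"
  shows "x \<in> A \<and> y \<in> B \<or> x \<in> B \<and> y \<in> A"
  using edges[OF assms] by (auto simp: doubleton_eq_iff)

lemma finite_acceptable: "finite acceptable"
  by (rule finite_subset[of _ "Pow A"]) (auto simp: acceptable_def finite_A)

text \<open>A convenient form of two-connectedness: the graph without v is connected and, having at
  least two vertices, contains a neighbour of w.\<close>

lemma neighbour_avoiding:
  assumes "v \<in> A \<union> B" and "w \<in> A \<union> B" and "v \<noteq> w"
  obtains u where "u \<in> A \<union> B" and "u \<noteq> v" and "u \<noteq> w" and "{w, u} \<in> E"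
proof -
  have "A \<union> B - {v} \<noteq> {w}"
  proof
    assume "A \<union> B - {v} = {w}"
    then have "A \<union> B \<subseteq> {v, w}" by blast
    then have "card (A \<union> B) \<le> card {v, w}" by (rule card_mono[rotated]) simp
    also have "\<dots> \<le> 2" by (simp add: card_insert_if)
    finally show False using card_ge_3 by simp
  qed
  then show ?thesis
    using cut_connected_neighbour[OF connected_minus[OF assms(1)], of w] assms that by blast
qed

lemma neighbour_B:
  assumes "a \<in> A"
  obtains b where "b \<in> B" and "{a, b} \<in> E"
proof -
  have "A \<union> B \<noteq> {a}" using card_ge_3 by auto
  then obtain b where "b \<in> A \<union> B" "{a, b} \<in> E"
    using cut_connected_neighbour[OF connected, of a] assms by blast
  then show ?thesis using that edge_cases assms disjoint by blast
qed

lemma neighbour_A: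
  assumes "b \<in> B"
  obtains a where "a \<in> A" and "{a, b} \<in> E"
proof -
  have "A \<union> B \<noteq> {b}" using card_ge_3 by auto
  then obtain a where "a \<in> A \<union> B" "{b, a} \<in> E"
    using cut_connected_neighbour[OF connected, of b] assms by blast
  then show ?thesis using that[of a] edge_cases[of b a] assms disjoint by (auto simp: insert_commute)
qed

lemma N_A: "N A = B"
  unfolding N_def using neighbour_A by (auto intro!: subset_antisym)

lemma N_Un: "N (S \<union> T) = N S \<union> N T" by (auto simp: N_def)

text \<open>The part Y of the complement is merged into T, so that T becomes A - X. A vertex of Y in
  B has all its neighbours in Y, whence the new neighbourhood is B - X. The new set stays connected:
  a piece of Y without edges to the rest of it has none to X either and would be cut off from the
  whole graph.\<close>

lemma extend:
  assumes T: "T \<subseteq> A" "cut_connected E (T \<union> N T)"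
    and XY: "X \<union> Y = (A - T) \<union> (B - N T)" "X \<inter> Y = {}" "Y \<noteq> {}"
    and no: "\<And>x y. x \<in> X \<Longrightarrow> y \<in> Y \<Longrightarrow> {x, y} \<notin> E"
  shows "N (A - X) = B - X" and "cut_connected E ((A - X) \<union> (B - X))" and "T \<subset> A - X"
proof -
  have no': "{y, x} \<notin> E" if "x \<in> X" "y \<in> Y" for x y using no[OF that] by (simp add: insert_commute)
  have nT: "{a, b} \<notin> E" if "a \<in> T" "b \<in> B - N T" for a b using that by (auto simp: N_def)
  have disj: "T \<inter> (X \<union> Y) = {}" "N T \<inter> (X \<union> Y) = {}"
    unfolding XY(1) using T(1) disjoint N_subset by blast+
  have cov: "A \<union> B \<subseteq> T \<union> N T \<union> X \<union> Y" using XY(1) by blast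
  have XYs: "X \<union> Y \<subseteq> A \<union> B" using XY(1) by blast
  have Y_nb: "\<exists>a\<in>Y \<inter> A. {a, b} \<in> E" if b: "b \<in> Y \<inter> B" for b
  proof -
    obtain a where a: "a \<in> A" "{a, b} \<in> E" using neighbour_A b by blast
    have "b \<notin> N T" using b disj by blast
    then have "a \<notin> T" using nT a b by blast
    then have "a \<in> X \<union> Y" using a XY(1) by blast
    then show ?thesis using a b no by blast
  qed
  show NX: "N (A - X) = B - X"
  proof
    show "N (A - X) \<subseteq> B - X"
    proof
      fix b assume "b \<in> N (A - X)"
      then obtain a where a: "a \<in> A" "a \<notin> X" "b \<in> B" "{a, b} \<in> E" by (auto simp: N_def)
      have "b \<notin> X"
      proof
        assume b: "b \<in> X"
        then have "b \<notin> N T" using disj by blast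
        then have "a \<notin> T" using a nT by blast
        then have "a \<in> Y" using a XY(1) by blast
        then show False using no'[OF b] a by blast
      qed
      then show "b \<in> B - X" using a by blast
    qed
    show "B - X \<subseteq> N (A - X)"
    proof
      fix b assume b: "b \<in> B - X"
      show "b \<in> N (A - X)"
      proof (cases "b \<in> N T")
        case True
        moreover have "T \<subseteq> A - X" using T(1) disj by blast
        ultimately show ?thesis using N_mono by blast
      next
        case False
        then have "b \<in> Y \<inter> B" using b XY(1) by blast
        then obtain a where "a \<in> Y \<inter> A" "{a, b} \<in> E" using Y_nb by blast
        then show ?thesis using b XY(2) by (auto simp: N_def)
      qed
    qed
  qed
  have "Y \<inter> A \<noteq> {}" using Y_nb XYs XY(3) by blast
  then show "T \<subset> A - X" using T(1) disj XY(2) by blast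
  have TN: "T \<union> N T \<noteq> {}" using T(2) by (simp add: cut_connected_def)
  have Q: False if Q: "Q \<subseteq> Y" "Q \<noteq> {}"
    "\<And>x y. x \<in> Q \<Longrightarrow> y \<in> (A - X) \<union> (B - X) \<Longrightarrow> y \<notin> Q \<Longrightarrow> {x, y} \<notin> E" for Q
  proof -
    have "Q \<noteq> A \<union> B" using Q(1) TN disj T(1) N_subset by blast
    then obtain x y where xy: "x \<in> Q" "y \<in> A \<union> B" "y \<notin> Q" "{x, y} \<in> E"
      using cut_connectedD[OF connected, of Q] Q(1,2) XYs by blast
    have "y \<notin> X" using xy Q(1) no' by blast
    then show False using xy Q(3) by blast
  qed
  show "cut_connected E ((A - X) \<union> (B - X))"
    unfolding cut_connected_def
  proof (intro conjI allI impI)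
    show "(A - X) \<union> (B - X) \<noteq> {}" using TN disj T(1) N_subset by blast
    fix Z assume Z: "Z \<subseteq> (A - X) \<union> (B - X)" "Z \<noteq> {}" "Z \<noteq> (A - X) \<union> (B - X)"
    show "\<exists>x\<in>Z. \<exists>y\<in>(A - X) \<union> (B - X) - Z. {x, y} \<in> E"
    proof (rule ccontr)
      assume "\<not> ?thesis"
      then have nz: "{x, y} \<notin> E" if "x \<in> Z" "y \<in> (A - X) \<union> (B - X)" "y \<notin> Z" for x y using that by blast
      let ?Z' = "(A - X) \<union> (B - X) - Z"
      have "T \<union> N T \<subseteq> Z \<or> T \<union> N T \<subseteq> ?Z'"
      proof (rule cut_connected_cases[OF T(2)])
        show "T \<union> N T \<subseteq> Z \<union> ?Z'" using T(1) N_subset disj by blast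
      qed (use nz in blast)+
      then show False
      proof
        assume "T \<union> N T \<subseteq> Z"
        then have "?Z' \<subseteq> Y" using cov by blast
        moreover have "?Z' \<noteq> {}" using Z by blast
        moreover have "{x, y} \<notin> E" if "x \<in> ?Z'" "y \<in> (A - X) \<union> (B - X)" "y \<notin> ?Z'" for x y
          using nz[of y x] that by (simp add: insert_commute)
        ultimately show False by (rule Q)
      next
        assume "T \<union> N T \<subseteq> ?Z'"
        then have "Z \<subseteq> Y" using cov Z(1) by blast
        then show False using Z(2) nz by (rule Q)
      qed
    qed
  qed
qed

lemma not_cut_connected_split:
  assumes "\<not> cut_connected E W" and "b \<in> W"
  obtains X Y where "X \<union> Y = W" "X \<inter> Y = {}" "b \<in> X" "Y \<noteq> {}"
    "\<And>x y. x \<in> X \<Longrightarrow> y \<in> Y \<Longrightarrow> {x, y} \<notin> E"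
proof -
  obtain X where X: "X \<subseteq> W" "X \<noteq> {}" "X \<noteq> W" and no: "\<And>x y. x \<in> X \<Longrightarrow> y \<in> W - X \<Longrightarrow> {x, y} \<notin> E"
    using assms unfolding cut_connected_def by blast
  have no': "{x, y} \<notin> E" if "x \<in> W - X" "y \<in> X" for x y
    using no[OF that(2,1)] by (simp add: insert_commute)
  show ?thesis
  proof (cases "b \<in> X")
    case True
    show ?thesis by (rule that[of X "W - X"]) (use X True no in auto)
  next
    case False
    show ?thesis by (rule that[of "W - X" X]) (use X False assms(2) no' in auto)
  qed
qed

text \<open>Take a largest T for which T \<union> N T is connected, a is in T and b is not in N T;
  the star around a shows that such sets exist. If the complement were disconnected, the part of it
  without b could be merged into T by \<open>extend\<close>.\<close>

lemma exists_acceptable: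
  assumes "a \<in> A" and "b \<in> B" and "{a, b} \<notin> E"
  shows "\<exists>T\<in>acceptable. a \<in> T \<and> b \<notin> N T"
proof -
  define P where "P T \<longleftrightarrow> T \<subseteq> A \<and> cut_connected E (T \<union> N T) \<and> a \<in> T \<and> b \<notin> N T" for T
  have "cut_connected E ({a} \<union> N {a})"
    unfolding cut_connected_def
  proof (intro conjI allI impI)
    fix X assume X: "X \<subseteq> {a} \<union> N {a}" "X \<noteq> {}" "X \<noteq> {a} \<union> N {a}"
    show "\<exists>x\<in>X. \<exists>y\<in>{a} \<union> N {a} - X. {x, y} \<in> E"
    proof (cases "a \<in> X")
      case True
      then obtain y where "y \<in> N {a} - X" using X by blast
      then show ?thesis using True by (intro bexI[of _ a] bexI[of _ y]) (auto simp: N_def)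
    next
      case False
      then obtain x where "x \<in> X" "x \<in> N {a}" using X by blast
      then show ?thesis using False
        by (intro bexI[of _ x] bexI[of _ a]) (auto simp: N_def insert_commute)
    qed
  qed simp
  then have "P {a}" using assms by (simp add: P_def N_def)
  moreover have "\<forall>T. P T \<longrightarrow> card T \<le> card A" using finite_A by (auto simp: P_def intro: card_mono)
  ultimately obtain T where T: "P T" "\<And>S. P S \<Longrightarrow> card S \<le> card T"
    using ex_has_greatest_nat[of P "{a}" card "card A + 1"] by (metis le_imp_less_Suc Suc_eq_plus1)
  have "cut_connected E ((A - T) \<union> (B - N T))"
  proof (rule ccontr)
    assume "\<not> ?thesis"
    moreover have b: "b \<in> (A - T) \<union> (B - N T)" using T(1) assms by (simp add: P_def)
    ultimately obtain X Y where XY: "X \<union> Y = (A - T) \<union> (B - N T)" "X \<inter> Y = {}" "b \<in> X" "Y \<noteq> {}"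
      "\<And>x y. x \<in> X \<Longrightarrow> y \<in> Y \<Longrightarrow> {x, y} \<notin> E"
      by (rule not_cut_connected_split) blast
    note ext = extend[OF _ _ XY(1,2,4,5)]
    have "P (A - X)" using ext T(1) XY(3) assms by (auto simp: P_def)
    moreover have "card T < card (A - X)"
      using ext(3) T(1) finite_A by (intro psubset_card_mono) (auto simp: P_def)
    ultimately show False using T(2) by fastforce
  qed
  then have "T \<in> acceptable" using T(1) assms by (auto simp: acceptable_def P_def)
  then show ?thesis using T(1) by (auto simp: P_def)
qed

lemma acceptable_not_adjacent: "T \<in> acceptable \<Longrightarrow> a \<in> T \<Longrightarrow> b \<in> B - N T \<Longrightarrow> {a, b} \<notin> E"
  by (auto simp: N_def)

lemma acceptable_parts:
  assumes "T \<in> acceptable"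
  shows "T \<subseteq> A" and "T \<noteq> {}" and "N T \<noteq> {}" and "A - T \<noteq> {}" and "B - N T \<noteq> {}"
    and "cut_connected E (T \<union> N T)" and "cut_connected E ((A - T) \<union> (B - N T))"
proof -
  show *: "T \<subseteq> A" "T \<noteq> {}" "cut_connected E (T \<union> N T)" "cut_connected E ((A - T) \<union> (B - N T))"
    using assms by (auto simp: acceptable_def)
  show "N T \<noteq> {}" using * neighbour_B by (auto simp: N_def) (metis subsetD)
  show "B - N T \<noteq> {}" using assms N_subset by (auto simp: acceptable_def)
  then show "A - T \<noteq> {}" using N_A * assms by (auto simp: acceptable_def)
qed

text \<open>
  \<open>Inl v\<close> stands for the facet \<open>x\<^sub>v = 0\<close> of the edge cone, \<open>Inr T\<close> for the facet on which the sums of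
  \<open>x\<close> over \<open>T\<close> and over its neighbourhood \<open>N T\<close> agree.
\<close>

definition facets :: "('v + 'v set) set" where
  "facets = Inl ` (A \<union> B) \<union> Inr ` acceptable"

fun facet_form :: "'v + 'v set \<Rightarrow> ('v \<Rightarrow> int) \<Rightarrow> int" where
  "facet_form (Inl v) x = x v"
| "facet_form (Inr T) x = sum x (N T) - sum x T"

section \<open>Values of the facet forms on edges\<close>

definition edge_vec :: "'v \<Rightarrow> 'v \<Rightarrow> 'v \<Rightarrow> int" where
  "edge_vec a b v = of_bool (v = a) + of_bool (v = b)"

lemma edge_vec_commute: "edge_vec a b = edge_vec b a"
  by (auto simp: edge_vec_def)

lemma facet_form_vertex: "a \<noteq> b \<Longrightarrow> facet_form (Inl v) (edge_vec a b) = of_bool (v \<in> {a, b})"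
  by (auto simp: edge_vec_def)

text \<open>The value -1 does not occur, since a \<in> T forces b \<in> N T.\<close>

lemma facet_form_set:
  assumes "T \<subseteq> A" and "a \<in> A" and "b \<in> B" and "{a, b} \<in> E"
  shows "facet_form (Inr T) (edge_vec a b) = of_bool (a \<notin> T \<and> b \<in> N T)"
proof -
  have fin: "finite T" "finite (N T)"
    using assms(1) finite_A finite_B N_subset finite_subset by blast+
  have "a \<notin> N T" "b \<notin> T" using assms disjoint N_subset by blast+
  moreover have "a \<in> T \<Longrightarrow> b \<in> N T" using assms by (auto simp: N_def)
  moreover have "sum (edge_vec a b) W = of_bool (a \<in> W) + of_bool (b \<in> W)" if "finite W" for W
    unfolding edge_vec_def using that by (simp add: sum.distrib of_bool_def)
  ultimately show ?thesis using fin by auto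
qed

lemma facet_form_nonneg:
  assumes "i \<in> facets" and "{a, b} \<in> E"
  shows "0 \<le> facet_form i (edge_vec a b)"
proof (cases i)
  case (Inl v)
  then show ?thesis by (simp add: edge_vec_def)
next
  case (Inr T)
  then have T: "T \<subseteq> A" using assms by (auto simp: facets_def acceptable_def)
  have "a \<in> A \<and> b \<in> B \<or> b \<in> A \<and> a \<in> B" using edge_cases[OF assms(2)] by blast
  then obtain P where "facet_form (Inr T) (edge_vec a b) = of_bool P"
    using facet_form_set[OF T, of a b] facet_form_set[OF T, of b a] assms(2)
      edge_vec_commute[of b a] insert_commute[of a b "{}"] by metis
  then show ?thesis by (simp only: Inr zero_less_eq_of_bool)
qed

lemma crossing_edge:
  assumes T: "T \<in> acceptable" and x: "x \<in> T \<union> N T" and y: "y \<in> (A - T) \<union> (B - N T)" and "{x, y} \<in> E"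
  shows "x \<in> N T \<and> y \<in> A - T"
proof -
  have "x \<notin> T"
  proof
    assume "x \<in> T"
    then have "y \<in> B" using edge_cases[OF assms(4)] acceptable_parts(1)[OF T] disjoint by blast
    then show False using y acceptable_not_adjacent[OF T \<open>x \<in> T\<close>] assms(4) disjoint by blast
  qed
  then have "x \<in> N T" using x by blast
  then show ?thesis using edge_cases[OF assms(4)] N_subset disjoint y by blast
qed

lemma facet_form_crossing:
  assumes T: "T \<in> acceptable" and x: "x \<in> T \<union> N T" and y: "y \<in> (A - T) \<union> (B - N T)" and e: "{x, y} \<in> E"
  shows "facet_form (Inr T) (edge_vec x y) = 1"
  using crossing_edge[OF assms] facet_form_set[OF acceptable_parts(1)[OF T], of y x] e N_subset
  by (auto simp: insert_commute edge_vec_commute[of x y])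

lemma crossing_edge_exists:
  assumes T: "T \<in> acceptable" and W: "cut_connected E W" "W \<subseteq> A \<union> B"
    and "W \<inter> (T \<union> N T) \<noteq> {}" and "W \<inter> ((A - T) \<union> (B - N T)) \<noteq> {}"
  shows "\<exists>x\<in>W \<inter> (T \<union> N T). \<exists>y\<in>W \<inter> ((A - T) \<union> (B - N T)). {x, y} \<in> E"
proof (rule ccontr)
  assume no: "\<not> ?thesis"
  have disj: "(T \<union> N T) \<inter> ((A - T) \<union> (B - N T)) = {}"
    using acceptable_parts(1)[OF T] N_subset disjoint by blast
  have "W \<subseteq> T \<union> N T \<or> W \<subseteq> (A - T) \<union> (B - N T)"
    by (rule cut_connected_cases[OF W(1) _ disj]) (use W(2) no in blast)+
  then show False using assms(4,5) disj by blast
qed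

lemma facet_form_inner:
  assumes T: "T \<in> acceptable" and e: "{x, y} \<in> E"
    and xy: "x \<in> T \<union> N T \<and> y \<in> T \<union> N T \<or> x \<in> (A - T) \<union> (B - N T) \<and> y \<in> (A - T) \<union> (B - N T)"
  shows "facet_form (Inr T) (edge_vec x y) = 0"
proof -
  note TA = acceptable_parts(1)[OF T]
  have *: "facet_form (Inr T) (edge_vec a b) = 0"
    if "a \<in> A" "b \<in> B" "{a, b} \<in> E" "a \<in> T \<union> N T \<and> b \<in> T \<union> N T \<or> a \<in> (A - T) \<union> (B - N T) \<and> b \<in> (A - T) \<union> (B - N T)" for a b
    using facet_form_set[OF TA that(1,2,3)] that TA N_subset disjoint by auto
  from edge_cases[OF e] show ?thesis
  proof
    assume "x \<in> A \<and> y \<in> B"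
    then show ?thesis using * xy e by blast
  next
    assume yx: "x \<in> B \<and> y \<in> A"
    have "{y, x} \<in> E" using e by (simp add: insert_commute)
    then have "facet_form (Inr T) (edge_vec y x) = 0" using * yx xy by blast
    then show ?thesis by (simp only: edge_vec_commute[of x y])
  qed
qed

text \<open>Edge vectors serve as test points, here one on the facet i and at height 1 over the
  facet j. Their sum over j will be a point in the relative interior of the facet i, as irredundance
  demands, and the height 1 gives primitivity.\<close>

lemma facet_separation:
  assumes i: "i \<in> facets" and j: "j \<in> facets" and "i \<noteq> j"
  shows "\<exists>a b. {a, b} \<in> E \<and> facet_form i (edge_vec a b) = 0 \<and> facet_form j (edge_vec a b) = 1"
proof -
  have ne: "a \<noteq> b" if "{a, b} \<in> E" for a b using edge_cases[OF that] disjoint by blast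
  consider (vv) v w where "i = Inl v" "j = Inl w" "v \<in> A \<union> B" "w \<in> A \<union> B" "v \<noteq> w"
    | (vT) v T where "i = Inl v" "j = Inr T" "v \<in> A \<union> B" "T \<in> acceptable"
    | (Tv) T v where "i = Inr T" "j = Inl v" "T \<in> acceptable" "v \<in> A \<union> B"
    | (TT) T S where "i = Inr T" "j = Inr S" "T \<in> acceptable" "S \<in> acceptable" "T \<noteq> S"
    using assms unfolding facets_def by blast
  then show ?thesis
  proof cases
    case vv
    obtain u where u: "u \<in> A \<union> B" "u \<noteq> v" "u \<noteq> w" "{w, u} \<in> E"
      using neighbour_avoiding[OF vv(3,4,5)] by blast
    then show ?thesis using vv facet_form_vertex[OF ne[OF u(4)]]
      by (intro exI[of _ w] exI[of _ u]) auto
  next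
    \<comment> \<open>The graph without v is connected and meets both sides of the cut of T, so some
      crossing edge avoids v.\<close>
    case vT
    note p = acceptable_parts[OF vT(4)]
    have "(A \<union> B - {v}) \<inter> (T \<union> N T) \<noteq> {}" "(A \<union> B - {v}) \<inter> ((A - T) \<union> (B - N T)) \<noteq> {}"
      using p(1-5) disjoint N_subset by blast+
    then obtain x y where xy: "x \<in> (A \<union> B - {v}) \<inter> (T \<union> N T)"
        "y \<in> (A \<union> B - {v}) \<inter> ((A - T) \<union> (B - N T))" "{x, y} \<in> E"
      using crossing_edge_exists[OF vT(4) connected_minus[OF vT(3)]] by blast
    then have "facet_form (Inr T) (edge_vec x y) = 1" using facet_form_crossing[OF vT(4)] by blast
    moreover have "facet_form (Inl v) (edge_vec x y) = 0" using facet_form_vertex[OF ne[OF xy(3)]] xy by auto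
    ultimately show ?thesis using vT xy by blast
  next
    \<comment> \<open>Both sides of the cut of T are connected and have at least two vertices, so v
      has a neighbour on its own side.\<close>
    case Tv
    note p = acceptable_parts[OF Tv(3)]
    obtain t n where tn: "t \<in> T" "n \<in> N T" using p(2,3) by blast
    obtain a b where ab: "a \<in> A - T" "b \<in> B - N T" using p(4,5) by blast
    have ne2: "t \<noteq> n" "a \<noteq> b" using tn ab p(1) N_subset disjoint by blast+
    have "\<exists>w. {v, w} \<in> E \<and> facet_form (Inr T) (edge_vec v w) = 0"
    proof (cases "v \<in> T \<union> N T")
      case True
      have "T \<union> N T \<noteq> {v}" using tn ne2(1) by (metis UnI1 UnI2 singletonD)
      then obtain w where "w \<in> T \<union> N T" "{v, w} \<in> E"
        using cut_connected_neighbour[OF p(6) True] by blast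
      then show ?thesis using facet_form_inner[OF Tv(3)] True by blast
    next
      case False
      then have v: "v \<in> (A - T) \<union> (B - N T)" using Tv(4) by blast
      have "(A - T) \<union> (B - N T) \<noteq> {v}" using ab ne2(2) by (metis UnI1 UnI2 singletonD)
      then obtain w where "w \<in> (A - T) \<union> (B - N T)" "{v, w} \<in> E"
        using cut_connected_neighbour[OF p(7) v] by blast
      then show ?thesis using facet_form_inner[OF Tv(3)] v by blast
    qed
    then obtain w where "{v, w} \<in> E" "facet_form (Inr T) (edge_vec v w) = 0" by blast
    moreover from this have "facet_form (Inl v) (edge_vec v w) = 1"
      using facet_form_vertex[OF ne, of v w v] by simp
    ultimately show ?thesis using Tv(1,2) by blast
  next
    case TT
    note p = acceptable_parts[OF TT(3)] and q = acceptable_parts[OF TT(4)]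
    define W1 W2 V1 V2 where W: "W1 = T \<union> N T" "W2 = (A - T) \<union> (B - N T)"
      "V1 = S \<union> N S" "V2 = (A - S) \<union> (B - N S)"
    have part: "W1 \<union> W2 = A \<union> B" "W1 \<inter> W2 = {}" "V1 \<union> V2 = A \<union> B" "V1 \<inter> V2 = {}"
      unfolding W using p(1) q(1) N_subset disjoint by blast+
    show ?thesis
    proof (rule ccontr)
      assume no: "\<not> ?thesis"
      \<comment> \<open>If no edge separates the two facets, no edge inside a side of the cut of T
        crosses the cut of S. As these sides are connected, the two cuts coincide, possibly with
        their sides exchanged.\<close>
      have cross: "\<not> (\<exists>x\<in>C \<inter> V1. \<exists>y\<in>C \<inter> V2. {x, y} \<in> E)" if C: "C = W1 \<or> C = W2" for C
      proof
        assume "\<exists>x\<in>C \<inter> V1. \<exists>y\<in>C \<inter> V2. {x, y} \<in> E"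
        then obtain x y where xy: "x \<in> C" "x \<in> V1" "y \<in> C" "y \<in> V2" "{x, y} \<in> E" by blast
        have "facet_form (Inr S) (edge_vec x y) = 1"
          using facet_form_crossing[OF TT(4)] xy unfolding W by blast
        moreover have "facet_form (Inr T) (edge_vec x y) = 0"
          using facet_form_inner[OF TT(3) xy(5)] xy C unfolding W by blast
        ultimately show False using no TT xy by blast
      qed
      have "C \<subseteq> V1 \<or> C \<subseteq> V2" if C: "C = W1 \<or> C = W2" for C
      proof (rule cut_connected_cases)
        show "cut_connected E C" using C p(6,7) W by blast
        show "C \<subseteq> V1 \<union> V2" using C part by blast
        show "V1 \<inter> V2 = {}" by (rule part(4))
        show "{x, y} \<notin> E" if "x \<in> C" "y \<in> C" "x \<in> V1" "y \<in> V2" for x y using cross[OF C] that by blast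
      qed
      then have sub: "W1 \<subseteq> V1 \<or> W1 \<subseteq> V2" "W2 \<subseteq> V1 \<or> W2 \<subseteq> V2" by blast+
      have ne: "V1 \<noteq> {}" "V2 \<noteq> {}" using q(2,4) W by blast+
      have cov: "V1 \<subseteq> W1 \<union> W2" "V2 \<subseteq> W1 \<union> W2" using part(1,3) by blast+
      have "W1 = V1 \<or> W1 = V2 \<and> W2 = V1"
        using sub
      proof (elim disjE)
        assume "W1 \<subseteq> V1" "W2 \<subseteq> V1"
        then show ?thesis using cov(2) part(4) ne(2) by blast
      next
        assume "W1 \<subseteq> V2" "W2 \<subseteq> V2"
        then show ?thesis using cov(1) part(4) ne(1) by blast
      next
        assume "W1 \<subseteq> V1" "W2 \<subseteq> V2"
        then have "V1 \<subseteq> W1" using cov(1) part(4) by blast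
        then show ?thesis using \<open>W1 \<subseteq> V1\<close> by (intro disjI1 subset_antisym)
      next
        assume "W1 \<subseteq> V2" "W2 \<subseteq> V1"
        then have "V2 \<subseteq> W1" "V1 \<subseteq> W2" using cov part(4) by blast+
        then show ?thesis using \<open>W1 \<subseteq> V2\<close> \<open>W2 \<subseteq> V1\<close> by (intro disjI2 conjI subset_antisym)
      qed
      then consider "W1 = V1" | "W1 = V2" "W2 = V1" by blast
      then show False
      proof cases
        case 1
        then have "W1 \<inter> A = V1 \<inter> A" by simp
        then have "T = S" unfolding W using p(1) q(1) N_subset disjoint by blast
        then show False using TT by blast
      next
        case 2
        have "(A \<union> B) \<inter> (T \<union> N T) \<noteq> {}" "(A \<union> B) \<inter> ((A - T) \<union> (B - N T)) \<noteq> {}"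
          using p(1-5) by blast+
        then obtain x y where xy: "x \<in> T \<union> N T" "y \<in> (A - T) \<union> (B - N T)" "{x, y} \<in> E"
          using crossing_edge_exists[OF TT(3) connected] by blast
        \<comment> \<open>Exchanged sides are impossible: a crossing edge of the cut of T leads from
          N T, inside B, to A - T, so a cut determines which of its sides contains T.\<close>
        have "y \<in> N S \<and> x \<in> A - S"
          by (rule crossing_edge[OF TT(4)]) (use xy 2 W in \<open>auto simp: insert_commute\<close>)
        then show False using crossing_edge[OF TT(3) xy] disjoint N_subset by blast
      qed
    qed
  qed
qed

text \<open>Any other facet can be the partner in \<open>facet_separation\<close>, and the facets of
  two different vertices always supply one.\<close>

lemma facet_form_primitive:
  assumes "i \<in> facets"
  shows "\<exists>a b. {a, b} \<in> E \<and> facet_form i (edge_vec a b) = 1"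
proof -
  obtain v where v: "v \<in> A \<union> B" using connected by (auto simp: cut_connected_def)
  have "A \<union> B \<noteq> {v}" using card_ge_3 by auto
  then obtain w where "w \<in> A \<union> B" "v \<noteq> w" using v by blast
  with v have "Inl v \<in> facets" "Inl w \<in> facets" "Inl v \<noteq> (Inl w :: 'v + 'v set)" by (auto simp: facets_def)
  then obtain j where "j \<in> facets" "j \<noteq> i" by metis
  then show ?thesis using facet_separation[OF _ assms] by blast
qed

end

section \<open>Hall's condition and the decomposition into edges\<close>

context two_connected_bipartite
begin

text \<open>A smallest violating set is connected together with its neighbours, since otherwise one
  of two pieces would violate. Take a largest violating set T that is connected in this sense. If
  its complement splits, some piece has a smaller sum over A than over B, and merging the other
  piece into T by \<open>extend\<close> keeps the violation. So the complement is connected and T is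
  acceptable, a contradiction.\<close>

lemma facet_inequalities_imp_hall:
  fixes x :: "'v \<Rightarrow> int"
  assumes eq: "sum x A = sum x B" and nonneg: "\<And>v. v \<in> A \<union> B \<Longrightarrow> 0 \<le> x v"
    and acc: "\<And>T. T \<in> acceptable \<Longrightarrow> sum x T \<le> sum x (N T)" and S: "S \<subseteq> A"
  shows "sum x S \<le> sum x (N S)"
proof (rule ccontr)
  assume viol: "\<not> ?thesis"
  define P where "P T \<longleftrightarrow> T \<subseteq> A \<and> sum x (N T) < sum x T" for T
  have finT: "finite T" if "P T" for T
    using that finite_subset[OF _ finite_A] unfolding P_def by blast
  have "P S" using viol S by (simp add: P_def)
  then obtain T0 where T0: "P T0" "\<And>T. P T \<Longrightarrow> card T0 \<le> card T"
    using ex_has_least_nat[of P S card] by blast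
  have T0A: "T0 \<subseteq> A" using T0(1) by (simp add: P_def)
  have con: "cut_connected E (T0 \<union> N T0)"
  proof (rule ccontr)
    assume nc: "\<not> cut_connected E (T0 \<union> N T0)"
    have "T0 \<noteq> {}"
    proof
      assume "T0 = {}"
      moreover from this have "N T0 = {}" by (simp add: N_def)
      ultimately show False using T0(1) by (simp add: P_def)
    qed
    then obtain b where "b \<in> T0 \<union> N T0" by blast
    with nc obtain X Y where XY: "X \<union> Y = T0 \<union> N T0" "X \<inter> Y = {}" "b \<in> X" "Y \<noteq> {}"
      "\<And>x y. x \<in> X \<Longrightarrow> y \<in> Y \<Longrightarrow> {x, y} \<notin> E"
      by (rule not_cut_connected_split) blast
    have XY': "{y, x} \<notin> E" if "x \<in> X" "y \<in> Y" for x y using XY(5)[OF that] by (simp add: insert_commute)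
    \<comment> \<open>If T0 lay in one piece, the other piece would consist of neighbours of T0, and
      an edge would join the pieces. Hence both pieces contain fewer elements of T0 than T0
      has.\<close>
    have sub: "T0 \<inter> Z \<noteq> T0" if Z: "Z \<union> Z' = T0 \<union> N T0" "Z \<inter> Z' = {}" "Z' \<noteq> {}"
      "\<And>x y. x \<in> Z \<Longrightarrow> y \<in> Z' \<Longrightarrow> {x, y} \<notin> E" for Z Z'
    proof
      assume "T0 \<inter> Z = T0"
      then have "T0 \<subseteq> Z" by blast
      then have "Z' \<subseteq> N T0" using Z(1,2) by blast
      then obtain z where z: "z \<in> Z'" "z \<in> N T0" using Z(3) by blast
      then obtain a where "a \<in> T0" "{a, z} \<in> E" by (auto simp: N_def)
      then show False using Z(4) z \<open>T0 \<subseteq> Z\<close> by blast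
    qed
    have N_in: "N (T0 \<inter> Z) \<subseteq> Z" if Z: "Z \<union> Z' = T0 \<union> N T0"
      "\<And>x y. x \<in> Z \<Longrightarrow> y \<in> Z' \<Longrightarrow> {x, y} \<notin> E" for Z Z'
    proof
      fix b assume "b \<in> N (T0 \<inter> Z)"
      then obtain a where a: "a \<in> T0" "a \<in> Z" "{a, b} \<in> E" "b \<in> N T0" by (auto simp: N_def)
      then show "b \<in> Z" using Z by blast
    qed
    have YX: "Y \<union> X = T0 \<union> N T0" "Y \<inter> X = {}" "X \<noteq> {}" using XY by auto
    have part: "T0 = T0 \<inter> X \<union> T0 \<inter> Y" using XY(1) by blast
    have N1: "N (T0 \<inter> X) \<subseteq> X" by (rule N_in[OF XY(1,5)])
    have N2: "N (T0 \<inter> Y) \<subseteq> Y" by (rule N_in[OF YX(1) XY'])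
    have "N T0 = N (T0 \<inter> X) \<union> N (T0 \<inter> Y)" using arg_cong[OF part, of N] by (simp only: N_Un)
    then have "sum x (N T0) = sum x (N (T0 \<inter> X) \<union> N (T0 \<inter> Y))" by (rule arg_cong)
    also have "\<dots> = sum x (N (T0 \<inter> X)) + sum x (N (T0 \<inter> Y))"
      using N1 N2 XY(2) by (intro sum.union_disjoint finite_subset[OF N_subset finite_B]) auto
    finally have 1: "sum x (N T0) = sum x (N (T0 \<inter> X)) + sum x (N (T0 \<inter> Y))" .
    have "sum x T0 = sum x (T0 \<inter> X \<union> T0 \<inter> Y)" using part by (rule arg_cong)
    also have "\<dots> = sum x (T0 \<inter> X) + sum x (T0 \<inter> Y)"
      using finT[OF T0(1)] XY(2) by (intro sum.union_disjoint) auto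
    finally have 2: "sum x T0 = sum x (T0 \<inter> X) + sum x (T0 \<inter> Y)" .
    have "sum x (N T0) < sum x T0" using T0(1) by (simp add: P_def)
    then have "sum x (N (T0 \<inter> X)) < sum x (T0 \<inter> X) \<or> sum x (N (T0 \<inter> Y)) < sum x (T0 \<inter> Y)"
      using 1 2 by linarith
    then have "P (T0 \<inter> X) \<or> P (T0 \<inter> Y)" using T0A unfolding P_def by auto
    moreover have "card (T0 \<inter> X) < card T0"
      using sub[OF XY(1,2,4,5)] finT[OF T0(1)] by (intro psubset_card_mono) auto
    moreover have "card (T0 \<inter> Y) < card T0"
      using sub[OF YX XY'] finT[OF T0(1)] by (intro psubset_card_mono) auto
    ultimately show False using T0(2) by (meson leD)
  qed
  define Q where "Q T \<longleftrightarrow> P T \<and> cut_connected E (T \<union> N T)" for T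
  have "Q T0" using T0(1) con by (simp add: Q_def)
  moreover have "\<forall>T. Q T \<longrightarrow> card T < card A + 1"
    using finite_A by (auto simp: Q_def P_def less_Suc_eq_le intro: card_mono)
  ultimately obtain T where T: "Q T" "\<And>S. Q S \<Longrightarrow> card S \<le> card T"
    using ex_has_greatest_nat[of Q T0 card "card A + 1"] by blast
  have TA: "T \<subseteq> A" and Tviol: "sum x (N T) < sum x T" and Tcon: "cut_connected E (T \<union> N T)"
    using T(1) by (auto simp: Q_def P_def)
  have "N T \<noteq> B"
  proof
    assume "N T = B"
    moreover have "sum x T \<le> sum x A" using TA nonneg finite_A by (intro sum_mono2) auto
    ultimately show False using Tviol eq by simp
  qed
  then obtain b where b: "b \<in> (A - T) \<union> (B - N T)" using N_subset by blast
  have "T \<noteq> {}" using Tviol by (auto simp: N_def)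
  have "T \<notin> acceptable" using acc[of T] Tviol by fastforce
  then have "\<not> cut_connected E ((A - T) \<union> (B - N T))"
    using TA Tcon \<open>N T \<noteq> B\<close> \<open>T \<noteq> {}\<close> by (simp add: acceptable_def)
  then obtain X Y where XY: "X \<union> Y = (A - T) \<union> (B - N T)" "X \<inter> Y = {}" "b \<in> X" "Y \<noteq> {}"
    "\<And>x y. x \<in> X \<Longrightarrow> y \<in> Y \<Longrightarrow> {x, y} \<notin> E"
    using b by (rule not_cut_connected_split) blast
  have XY': "{y, x} \<notin> E" if "x \<in> X" "y \<in> Y" for x y using XY(5)[OF that] by (simp add: insert_commute)
  have YX: "Y \<union> X = (A - T) \<union> (B - N T)" "Y \<inter> X = {}" "X \<noteq> {}" using XY by auto
  have grow: False if Z: "Z \<union> Z' = (A - T) \<union> (B - N T)" "Z \<inter> Z' = {}" "Z' \<noteq> {}"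
      "\<And>x y. x \<in> Z \<Longrightarrow> y \<in> Z' \<Longrightarrow> {x, y} \<notin> E" and neg: "sum x (A \<inter> Z) < sum x (B \<inter> Z)" for Z Z'
  proof -
    note ext = extend[OF TA Tcon Z]
    have "sum x A = sum x (A \<inter> Z) + sum x (A - Z)" by (rule sum.Int_Diff[OF finite_A])
    moreover have "sum x B = sum x (B \<inter> Z) + sum x (B - Z)" by (rule sum.Int_Diff[OF finite_B])
    ultimately have "P (A - Z)" using eq neg ext(1) by (simp add: P_def)
    then have "Q (A - Z)" using ext(1,2) by (simp add: Q_def)
    moreover have "card T < card (A - Z)" using ext(3) finite_A by (intro psubset_card_mono) auto
    ultimately show False using T(2) by (meson leD)
  qed
  have "A - T = A \<inter> X \<union> A \<inter> Y" "B - N T = B \<inter> X \<union> B \<inter> Y" using XY(1) TA N_subset disjoint by blast+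
  then have "sum x (A - T) = sum x (A \<inter> X) + sum x (A \<inter> Y)"
    "sum x (B - N T) = sum x (B \<inter> X) + sum x (B \<inter> Y)"
    using XY(2) finite_A finite_B by (auto intro!: sum.union_disjoint)
  moreover have "sum x (A - T) = sum x A - sum x T" using TA finite_A by (intro sum_diff) auto
  moreover have "sum x (B - N T) = sum x B - sum x (N T)" using finite_B N_subset by (intro sum_diff) auto
  ultimately have "sum x (A \<inter> X) < sum x (B \<inter> X) \<or> sum x (A \<inter> Y) < sum x (B \<inter> Y)"
    using eq Tviol by linarith
  then show False using grow[OF XY(1,2,4,5)] grow[OF YX XY'] by blast
qed

text \<open>Hall's theorem with weights: x is a sum of edges. P is any property of the edges that is
  closed under sums, which avoids naming the summands. Either a tight set T of intermediate weight
  exists and x splits into its parts on T \<union> N T and outside, or there is none and an edge can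
  be subtracted.\<close>

lemma hall_decomposition:
  fixes x :: "'v \<Rightarrow> nat"
  assumes zero: "P (\<lambda>_. 0)"
    and add: "\<And>x y. P x \<Longrightarrow> P y \<Longrightarrow> P (\<lambda>v. x v + y v)"
    and edge: "\<And>a b. a \<in> A \<Longrightarrow> b \<in> B \<Longrightarrow> {a, b} \<in> E \<Longrightarrow> P (\<lambda>v. of_bool (v = a) + of_bool (v = b))"
    and "\<And>v. v \<notin> A \<union> B \<Longrightarrow> x v = 0" and "sum x A = sum x B"
    and "\<And>T. T \<subseteq> A \<Longrightarrow> sum x T \<le> sum x (N T)"
  shows "P x"
  using assms(4-6)
proof (induction "sum x A" arbitrary: x rule: less_induct)
  case less
  note supp = less.prems(1) and eq = less.prems(2) and hall = less.prems(3)
  show ?case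
  proof (cases "sum x A = 0")
    case True
    then have "x v = 0" if "v \<in> A \<union> B" for v
      using that eq finite_A finite_B by auto
    then have "x = (\<lambda>_. 0)" using supp by blast
    then show ?thesis using zero by simp
  next
    case pos: False
    show ?thesis
    proof (cases "\<exists>T\<subseteq>A. 0 < sum x T \<and> sum x T < sum x A \<and> sum x (N T) = sum x T")
      case True
      then obtain T where T: "T \<subseteq> A" "0 < sum x T" "sum x T < sum x A" "sum x (N T) = sum x T" by blast
      define y where "y v = (if v \<in> T \<union> N T then x v else 0)" for v
      define z where "z v = (if v \<in> T \<union> N T then 0 else x v)" for v
      have xyz: "x = (\<lambda>v. y v + z v)" by (auto simp: y_def z_def)
      have yA: "sum y S = sum x (S \<inter> T)" and zA: "sum z S = sum x (S - T)" if "S \<subseteq> A" for S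
      proof -
        have S: "finite S" using that finite_A finite_subset by blast
        have mem: "v \<notin> N T" if "v \<in> S" for v
          using that \<open>S \<subseteq> A\<close> disjoint N_subset by blast
        have "sum y S = (\<Sum>v\<in>S. if v \<in> T then x v else 0)"
          by (rule sum.cong) (auto simp: y_def mem)
        then show "sum y S = sum x (S \<inter> T)" by (simp add: sum.inter_restrict[OF S])
        have "sum z S = (\<Sum>v\<in>S. if v \<in> - T then x v else 0)"
          by (rule sum.cong) (auto simp: z_def mem)
        then show "sum z S = sum x (S - T)" by (simp add: sum.inter_restrict[OF S] Diff_eq)
      qed
      have yB: "sum y S = sum x (S \<inter> N T)" and zB: "sum z S = sum x (S - N T)" if "S \<subseteq> B" for S
      proof -
        have S: "finite S" using that finite_B finite_subset by blast
        have mem: "v \<notin> T" if "v \<in> S" for v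
          using that \<open>S \<subseteq> B\<close> disjoint T(1) by blast
        have "sum y S = (\<Sum>v\<in>S. if v \<in> N T then x v else 0)"
          by (rule sum.cong) (auto simp: y_def mem)
        then show "sum y S = sum x (S \<inter> N T)" by (simp add: sum.inter_restrict[OF S])
        have "sum z S = (\<Sum>v\<in>S. if v \<in> - N T then x v else 0)"
          by (rule sum.cong) (auto simp: z_def mem)
        then show "sum z S = sum x (S - N T)" by (simp add: sum.inter_restrict[OF S] Diff_eq)
      qed
      have inter: "A \<inter> T = T" "B \<inter> N T = N T" using T(1) N_subset by blast+
      have diff: "sum x (A - T) = sum x A - sum x T" "sum x (B - N T) = sum x B - sum x (N T)"
        using T(1) N_subset finite_A finite_B by (auto intro!: sum_diff_nat intro: finite_subset)
      have "P y"
      proof (rule less.hyps)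
        show "sum y A < sum x A" using yA[OF subset_refl] inter T by simp
        show "y v = 0" if "v \<notin> A \<union> B" for v using supp[OF that] by (simp add: y_def)
        show "sum y A = sum y B" using yA[OF subset_refl] yB[OF subset_refl] inter T by simp
        fix S assume S: "S \<subseteq> A"
        have "sum y S \<le> sum x (N (S \<inter> T))" using yA[OF S] hall[of "S \<inter> T"] S by auto
        also have "\<dots> = sum y (N (S \<inter> T))"
        proof -
          have "N (S \<inter> T) \<inter> N T = N (S \<inter> T)" using N_mono[of "S \<inter> T" T] by blast
          then show ?thesis using yB[OF N_subset, of "S \<inter> T"] by simp
        qed
        also have "\<dots> \<le> sum y (N S)"
          using N_mono[of "S \<inter> T" S] finite_B N_subset by (intro sum_mono2) (auto intro: finite_subset)
        finally show "sum y S \<le> sum y (N S)" .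
      qed
      moreover have "P z"
      proof (rule less.hyps)
        show "sum z A < sum x A" using zA[OF subset_refl] diff T by simp
        show "z v = 0" if "v \<notin> A \<union> B" for v using supp[OF that] by (simp add: z_def)
        show "sum z A = sum z B" using zA[OF subset_refl] zB[OF subset_refl] diff T eq by simp
        fix S assume S: "S \<subseteq> A"
        have fin: "finite S" "finite T" "finite (N S)" "finite (N T)"
          by (rule finite_subset[OF S finite_A] finite_subset[OF T(1) finite_A]
            finite_subset[OF N_subset finite_B])+
        \<comment> \<open>Hall's condition for the outer part: the condition of x at S \<union> T,
          minus the equality at T.\<close>
        have "sum x (S - T) + sum x T = sum x (S \<union> T)"
          using fin by (subst sum.union_disjoint[symmetric]) auto
        also have "\<dots> \<le> sum x (N (S \<union> T))" using S T(1) by (intro hall) auto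
        also have "N (S \<union> T) = (N S - N T) \<union> N T" unfolding N_Un by blast
        also have "sum x \<dots> = sum x (N S - N T) + sum x (N T)"
          using fin by (intro sum.union_disjoint) auto
        finally have "sum x (S - T) \<le> sum x (N S - N T)" using T(4) by simp
        then show "sum z S \<le> sum z (N S)" using zA[OF S] zB[OF N_subset] by simp
      qed
      ultimately show ?thesis using add xyz by metis
    next
      case no: False
      obtain a where a: "a \<in> A" "x a > 0" using pos by (metis gr0I sum.neutral)
      have "x a \<le> sum x (N {a})" using hall[of "{a}"] a by simp
      then have "sum x (N {a}) \<noteq> 0" using a by simp
      then obtain b where "b \<in> N {a}" "x b > 0" by (metis gr0I sum.neutral)
      then have b: "b \<in> B" "{a, b} \<in> E" "x b > 0" by (auto simp: N_def)
      have ab: "a \<noteq> b" using a b disjoint by blast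
      \<comment> \<open>Any edge with positive weight at both ends can be subtracted. Only sets S
        that avoid a but have b as a neighbour could suffer, and these have a unit to spare because
        no set of intermediate weight is tight.\<close>
      define x' where "x' v = x v - (of_bool (v = a) + of_bool (v = b))" for v
      have xx': "x v = x' v + (of_bool (v = a) + of_bool (v = b))" for v
        using a(2) b(3) ab by (auto simp: x'_def of_bool_def)
      have sumx: "sum x S = sum x' S + of_bool (a \<in> S) + of_bool (b \<in> S)" if "finite S" for S
      proof -
        have "sum x S = (\<Sum>v\<in>S. x' v + (of_bool (v = a) + of_bool (v = b)))"
          by (rule sum.cong) (auto simp: xx')
        then show ?thesis using that by (simp add: sum.distrib of_bool_def)
      qed
      have nm: "a \<notin> B" "b \<notin> A" using a b disjoint by blast+
      have "P x'"
      proof (rule less.hyps)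
        show "sum x' A < sum x A" using sumx[OF finite_A] a nm by simp
        show "x' v = 0" if "v \<notin> A \<union> B" for v using supp[OF that] by (simp add: x'_def)
        show "sum x' A = sum x' B" using sumx[OF finite_A] sumx[OF finite_B] a b nm eq by simp
        fix S assume S: "S \<subseteq> A"
        have fin: "finite S" "finite (N S)" 
          by (rule finite_subset[OF S finite_A] finite_subset[OF N_subset finite_B])+
        have "b \<notin> S" "a \<notin> N S" using nm S N_subset by blast+
        then have s: "sum x S = sum x' S + of_bool (a \<in> S)" "sum x (N S) = sum x' (N S) + of_bool (b \<in> N S)"
          using sumx[OF fin(1)] sumx[OF fin(2)] by auto
        show "sum x' S \<le> sum x' (N S)"
        proof (cases "a \<in> S")
          case True
          then have "b \<in> N S" using b by (auto simp: N_def)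
          then show ?thesis using s True hall[OF S] by simp
        next
          case False
          have "sum x S < sum x A"
            using S False a finite_A by (intro sum_strict_mono2[of _ _ a]) auto
          show ?thesis
          proof (cases "b \<in> N S")
            case True
            have "sum x S < sum x (N S)"
            \<comment> \<open>Tightness is excluded for positive weight only; a set of weight 0 has
              its spare unit from the weight of b.\<close>
            proof (cases "sum x S = 0")
              case True
              have "x b \<le> sum x (N S)" using \<open>b \<in> N S\<close> fin by (intro member_le_sum) auto
              then show ?thesis using True b by simp
            next
              case False
              then show ?thesis using no S \<open>sum x S < sum x A\<close> hall[OF S] by (metis gr0I le_neq_implies_less)
            qed
            then show ?thesis using s \<open>a \<notin> S\<close> True by simp
          next
            case False
            then show ?thesis using s \<open>a \<notin> S\<close> hall[OF S] by simp
          qed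
        qed
      qed
      then have "P (\<lambda>v. x' v + (of_bool (v = a) + of_bool (v = b)))"
        using edge[OF a(1) b(1,2)] by (rule add)
      then show ?thesis using xx' by presburger
    qed
  qed
qed

section \<open>Graphs with no acceptable set or exactly one\<close>

lemma acceptable_eq_empty_iff: "acceptable = {} \<longleftrightarrow> (\<forall>a\<in>A. \<forall>b\<in>B. {a, b} \<in> E)"
proof
  assume "acceptable = {}"
  then show "\<forall>a\<in>A. \<forall>b\<in>B. {a, b} \<in> E" using exists_acceptable by blast
next
  assume all: "\<forall>a\<in>A. \<forall>b\<in>B. {a, b} \<in> E"
  have False if T: "T \<in> acceptable" for T
  proof -
    obtain a b where "a \<in> T" "b \<in> B - N T" using acceptable_parts(2,5)[OF T] by blast
    then show False using acceptable_not_adjacent[OF T] all acceptable_parts(1)[OF T] by blast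
  qed
  then show "acceptable = {}" by blast
qed

text \<open>For a in A and b in B, the vertex b keeps a neighbour when a is removed, and this is a
  second element of A; symmetrically for B.\<close>

lemma card_sides: "card A \<ge> 2" "card B \<ge> 2"
proof -
  have two: "card S \<ge> 2" if "finite S" "u \<in> S" "v \<in> S" "u \<noteq> v" for S and u v :: 'v
  proof -
    have "card {u, v} \<le> card S" using that by (intro card_mono) auto
    then show ?thesis using that by simp
  qed
  obtain v where v: "v \<in> A \<union> B" using connected by (auto simp: cut_connected_def)
  obtain a b where ab: "a \<in> A" "b \<in> B"
    using v neighbour_A neighbour_B by (metis UnE)
  have "a \<noteq> b" using ab disjoint by blast
  obtain u where "u \<noteq> a" "{b, u} \<in> E"
    using neighbour_avoiding[of a b] ab \<open>a \<noteq> b\<close> by blast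
  moreover from this have "u \<in> A" using edge_cases ab disjoint by blast
  ultimately show "card A \<ge> 2" using two[OF finite_A ab(1)] by metis
  obtain w where "w \<noteq> b" "{a, w} \<in> E"
    using neighbour_avoiding[of b a] ab \<open>a \<noteq> b\<close> by blast
  moreover from this have "w \<in> B" using edge_cases ab disjoint by blast
  ultimately show "card B \<ge> 2" using two[OF finite_B ab(2)] by metis
qed

text \<open>A non-adjacent pair is separated by an acceptable set, which can only be T, so the
  missing edges are the pairs from T and B - N T. If A - T or N T were a single vertex, its removal
  would isolate a vertex of B - N T or of T; this is the origin of the bounds s1, s2 \<ge>
  2.\<close>

lemma acceptable_singletonD:
  assumes "acceptable = {T}"
  shows "\<forall>a\<in>A. \<forall>b\<in>B. {a, b} \<in> E \<longleftrightarrow> \<not> (a \<in> T \<and> b \<in> B - N T)"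
    and "card (A - T) \<ge> 2" and "card (N T) \<ge> 2"
proof -
  have T: "T \<in> acceptable" using assms by simp
  note p = acceptable_parts[OF T]
  show "\<forall>a\<in>A. \<forall>b\<in>B. {a, b} \<in> E \<longleftrightarrow> \<not> (a \<in> T \<and> b \<in> B - N T)"
  proof (intro ballI iffI)
    fix a b assume "a \<in> A" "b \<in> B" "{a, b} \<in> E"
    then show "\<not> (a \<in> T \<and> b \<in> B - N T)" using acceptable_not_adjacent[OF T] by blast
  next
    fix a b assume ab: "a \<in> A" "b \<in> B" "\<not> (a \<in> T \<and> b \<in> B - N T)"
    show "{a, b} \<in> E"
    proof (rule ccontr)
      assume "{a, b} \<notin> E"
      then have "\<exists>S\<in>acceptable. a \<in> S \<and> b \<notin> N S" by (rule exists_acceptable[OF ab(1,2)])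
      then show False using assms ab by simp
    qed
  qed
  show "card (A - T) \<ge> 2"
  proof (rule ccontr)
    assume "\<not> ?thesis"
    moreover have "card (A - T) \<noteq> 0" using p(4) finite_A by simp
    ultimately have "card (A - T) = 1" by linarith
    then obtain s where s: "A - T = {s}" by (rule card_1_singletonE)
    obtain b where b: "b \<in> B" "b \<notin> N T" using p(5) by blast
    have "s \<noteq> b" "s \<in> A" using s b disjoint by blast+
    then obtain u where "u \<noteq> s" "{b, u} \<in> E" using neighbour_avoiding[of s b] b by blast
    moreover from this have "u \<in> A" using edge_cases b disjoint by blast
    ultimately have "u \<in> T" "{u, b} \<in> E" using s by (auto simp: insert_commute)
    then show False using b by (auto simp: N_def)
  qed
  show "card (N T) \<ge> 2"
  proof (rule ccontr)
    assume "\<not> ?thesis"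
    moreover have "card (N T) \<noteq> 0" using p(3) finite_subset[OF N_subset finite_B] by simp
    ultimately have "card (N T) = 1" by linarith
    then obtain s where s: "N T = {s}" by (rule card_1_singletonE)
    obtain t where t: "t \<in> T" "t \<in> A" using p(1,2) by blast
    have "s \<in> B" "s \<noteq> t" using s t N_subset disjoint by blast+
    then obtain u where u: "u \<noteq> s" "{t, u} \<in> E" using neighbour_avoiding[of s t] t by blast
    then have "u \<in> B" using edge_cases t disjoint by blast
    then have "u \<in> N T" using u t by (auto simp: N_def)
    then show False using s u by blast
  qed
qed

lemma cut_connected_complete:
  assumes "P \<noteq> {}" and "Q \<noteq> {}" and all: "\<And>a b. a \<in> P \<Longrightarrow> b \<in> Q \<Longrightarrow> {a, b} \<in> E"
  shows "cut_connected E (P \<union> Q)"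
  unfolding cut_connected_def
proof (intro conjI allI impI)
  show "P \<union> Q \<noteq> {}" using assms by blast
  fix X assume X: "X \<subseteq> P \<union> Q" "X \<noteq> {}" "X \<noteq> P \<union> Q"
  have all': "{b, a} \<in> E" if "a \<in> P" "b \<in> Q" for a b using all[OF that] by (simp add: insert_commute)
  show "\<exists>x\<in>X. \<exists>y\<in>P \<union> Q - X. {x, y} \<in> E"
  proof (rule ccontr)
    assume no: "\<not> ?thesis"
    obtain p q where pq: "p \<in> P" "q \<in> Q" using assms by blast
    have 1: "b \<in> X" if "a \<in> X" "a \<in> P" "b \<in> Q" for a b using no all that by blast
    have 2: "a \<in> X" if "b \<in> X" "a \<in> P" "b \<in> Q" for a b using no all' that by blast
    obtain x where x: "x \<in> X" using X by blast
    have "q \<in> X"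
    proof (cases "x \<in> P")
      case True
      then show ?thesis using 1 x pq by blast
    next
      case False
      then have "x \<in> Q" using x X by blast
      then show ?thesis using 1 2 x pq by blast
    qed
    then have "P \<subseteq> X" using 2 pq by blast
    then have "Q \<subseteq> X" using 1 pq by blast
    then show False using X \<open>P \<subseteq> X\<close> by blast
  qed
qed

text \<open>Every vertex of an acceptable S has a non-neighbour, so S \<subseteq> T and N S = B - U.
  A vertex of T outside S would have all its neighbours in N S and be isolated in the complement,
  which is connected.\<close>

lemma acceptable_singletonI:
  assumes T: "T \<subseteq> A" "T \<noteq> {}" "T \<noteq> A" and U: "U \<subseteq> B" "U \<noteq> {}" "U \<noteq> B"
    and adj: "\<And>a b. a \<in> A \<Longrightarrow> b \<in> B \<Longrightarrow> {a, b} \<in> E \<longleftrightarrow> \<not> (a \<in> T \<and> b \<in> U)"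
  shows "acceptable = {T}"
proof
  have NT: "N S = B - U" if "S \<subseteq> T" "S \<noteq> {}" for S
    unfolding N_def using that T(1) adj by blast
  have BU: "B - N T = U" using NT[OF subset_refl T(2)] U(1) by blast
  have "cut_connected E (T \<union> (B - U))"
    by (rule cut_connected_complete) (use T U adj in blast)+
  moreover have "cut_connected E ((A - T) \<union> U)"
    by (rule cut_connected_complete) (use T U adj in blast)+
  ultimately show "{T} \<subseteq> acceptable"
    using T U NT[OF subset_refl T(2)] BU by (auto simp: acceptable_def)
  show "acceptable \<subseteq> {T}"
  proof
    fix S assume S: "S \<in> acceptable"
    note p = acceptable_parts[OF S]
    obtain s where s: "s \<in> S" using p(2) by blast
    obtain b where b: "b \<in> B - N S" using p(5) by blast
    have ST: "S \<subseteq> T"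
    proof
      fix a assume "a \<in> S"
      then have "{a, b} \<notin> E" using acceptable_not_adjacent[OF S] b by blast
      then show "a \<in> T" using adj[of a b] \<open>a \<in> S\<close> p(1) b by blast
    qed
    have NS: "B - N S = U" using NT[OF ST p(2)] U(1) by blast
    have "T \<subseteq> S"
    proof
      fix a assume a: "a \<in> T"
      show "a \<in> S"
      proof (rule ccontr)
        assume "a \<notin> S"
        then have a': "a \<in> (A - S) \<union> (B - N S)" using a T(1) by blast
        have "(A - S) \<union> (B - N S) \<noteq> {a}" using b a T(1) disjoint by blast
        then obtain w where w: "w \<in> (A - S) \<union> (B - N S)" "{a, w} \<in> E"
          using cut_connected_neighbour[OF p(7) a'] by blast
        have "w \<in> B" using edge_cases[OF w(2)] a T(1) disjoint by blast
        then have "w \<in> U" using w(1) NS disjoint by blast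
        then show False using adj[of a w] a T(1) w(2) \<open>w \<in> B\<close> by blast
      qed
    qed
    then show "S \<in> {T}" using ST by blast
  qed
qed

end

section \<open>The graphs \<open>K_edges\<close> described by a bipartition\<close>

lemma K_edges_iff:
  assumes "u \<in> {1..s1 + t1}" and "v \<in> {s1 + t1 + 1..s1 + s2 + t1 + t2}"
  shows "{u, v} \<in> K_edges s1 s2 t1 t2 \<longleftrightarrow> \<not> (s1 < u \<and> v \<le> s1 + t1 + t2)"
proof
  assume "{u, v} \<in> K_edges s1 s2 t1 t2"
  then show "\<not> (s1 < u \<and> v \<le> s1 + t1 + t2)"
    using assms by (auto simp: K_edges_def doubleton_eq_iff)
next
  assume "\<not> (s1 < u \<and> v \<le> s1 + t1 + t2)"
  then show "{u, v} \<in> K_edges s1 s2 t1 t2"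
    using assms unfolding K_edges_def by (cases "u \<le> s1") auto
qed

lemma K_edges_sides:
  assumes "{u, v} \<in> K_edges s1 s2 t1 t2"
  shows "u \<le> s1 + t1 \<and> s1 + t1 < v \<or> v \<le> s1 + t1 \<and> s1 + t1 < u"
  using assms by (auto simp: K_edges_def doubleton_eq_iff)

text \<open>The labels run through A - T, T, U and B - U in this order, with s1, t1, t2 and s2
  labels respectively; an isomorphism amounts to such a partition. The case t1 = t2 = 0 covers the
  complete bipartite graphs.\<close>

lemma graph_iso_K_edges_iff:
  assumes V: "simple_graph V E"
  shows "graph_iso V E {1..s1 + s2 + t1 + t2} (K_edges s1 s2 t1 t2) \<longleftrightarrow>
    (\<exists>A B T U. A \<union> B = V \<and> A \<inter> B = {} \<and> (\<forall>e\<in>E. \<exists>a\<in>A. \<exists>b\<in>B. e = {a, b}) \<and> T \<subseteq> A \<and> U \<subseteq> B \<and>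
      card (A - T) = s1 \<and> card (B - U) = s2 \<and> card T = t1 \<and> card U = t2 \<and>
      (\<forall>a\<in>A. \<forall>b\<in>B. {a, b} \<in> E \<longleftrightarrow> \<not> (a \<in> T \<and> b \<in> U)))"
proof
  let ?n = "s1 + s2 + t1 + t2"
  assume "graph_iso V E {1..?n} (K_edges s1 s2 t1 t2)"
  then obtain f where f: "bij_betw f V {1..?n}"
    and fE: "\<And>u v. u \<in> V \<Longrightarrow> v \<in> V \<Longrightarrow> {u, v} \<in> E \<longleftrightarrow> {f u, f v} \<in> K_edges s1 s2 t1 t2"
    unfolding graph_iso_def by blast
  have range: "f v \<in> {1..?n}" if "v \<in> V" for v using f that by (auto simp: bij_betw_def)
  have card: "card {v \<in> V. f v \<in> S} = card S" if "S \<subseteq> {1..?n}" for S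
  proof -
    have "f ` {v \<in> V. f v \<in> S} = f ` V \<inter> S" by blast
    also have "\<dots> = S" using f that by (auto simp: bij_betw_def)
    finally have "f ` {v \<in> V. f v \<in> S} = S" .
    moreover have "inj_on f {v \<in> V. f v \<in> S}" using f unfolding bij_betw_def by (auto intro: inj_on_subset)
    ultimately show ?thesis by (metis card_image)
  qed
  define A where "A = {v \<in> V. f v \<in> {1..s1 + t1}}"
  define B where "B = {v \<in> V. f v \<in> {s1 + t1 + 1..?n}}"
  define T where "T = {v \<in> V. f v \<in> {s1 + 1..s1 + t1}}"
  define U where "U = {v \<in> V. f v \<in> {s1 + t1 + 1..s1 + t1 + t2}}"
  have AT: "A - T = {v \<in> V. f v \<in> {1..s1}}" by (auto simp: A_def T_def)
  have BU: "B - U = {v \<in> V. f v \<in> {s1 + t1 + t2 + 1..?n}}" by (auto simp: B_def U_def)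
  show "\<exists>A B T U. A \<union> B = V \<and> A \<inter> B = {} \<and> (\<forall>e\<in>E. \<exists>a\<in>A. \<exists>b\<in>B. e = {a, b}) \<and> T \<subseteq> A \<and> U \<subseteq> B \<and>
      card (A - T) = s1 \<and> card (B - U) = s2 \<and> card T = t1 \<and> card U = t2 \<and>
      (\<forall>a\<in>A. \<forall>b\<in>B. {a, b} \<in> E \<longleftrightarrow> \<not> (a \<in> T \<and> b \<in> U))"
  proof (intro exI conjI)
    show "A \<union> B = V" using range by (fastforce simp: A_def B_def)
    show "A \<inter> B = {}" by (auto simp: A_def B_def)
    show "T \<subseteq> A" "U \<subseteq> B" by (auto simp: A_def B_def T_def U_def)
    show "card (A - T) = s1" unfolding AT by (subst card) auto
    show "card (B - U) = s2" unfolding BU by (subst card) auto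
    show "card T = t1" unfolding T_def by (subst card) auto
    show "card U = t2" unfolding U_def by (subst card) auto
    show "\<forall>e\<in>E. \<exists>a\<in>A. \<exists>b\<in>B. e = {a, b}"
    proof
      fix e assume e: "e \<in> E"
      then obtain u v where uv: "e = {u, v}" "u \<in> V" "v \<in> V"
        using V unfolding simple_graph_def by (metis card_2_iff insert_subset)
      have "f u \<le> s1 + t1 \<and> s1 + t1 < f v \<or> f v \<le> s1 + t1 \<and> s1 + t1 < f u"
        by (rule K_edges_sides[of _ _ s1 s2 t1 t2]) (use uv e fE in blast)
      then have "u \<in> A \<and> v \<in> B \<or> v \<in> A \<and> u \<in> B"
        using range[OF uv(2)] range[OF uv(3)] uv by (auto simp: A_def B_def)
      then show "\<exists>a\<in>A. \<exists>b\<in>B. e = {a, b}" using uv(1) by (metis insert_commute)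
    qed
    show "\<forall>a\<in>A. \<forall>b\<in>B. {a, b} \<in> E \<longleftrightarrow> \<not> (a \<in> T \<and> b \<in> U)"
    proof (intro ballI)
      fix a b assume ab: "a \<in> A" "b \<in> B"
      then have "{a, b} \<in> E \<longleftrightarrow> {f a, f b} \<in> K_edges s1 s2 t1 t2" by (intro fE) (auto simp: A_def B_def)
      also have "\<dots> \<longleftrightarrow> \<not> (s1 < f a \<and> f b \<le> s1 + t1 + t2)"
        using ab by (intro K_edges_iff) (auto simp: A_def B_def)
      also have "\<dots> \<longleftrightarrow> \<not> (a \<in> T \<and> b \<in> U)" using ab by (auto simp: A_def B_def T_def U_def)
      finally show "{a, b} \<in> E \<longleftrightarrow> \<not> (a \<in> T \<and> b \<in> U)" .
    qed
  qed
next
  let ?n = "s1 + s2 + t1 + t2"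
  assume "\<exists>A B T U. A \<union> B = V \<and> A \<inter> B = {} \<and> (\<forall>e\<in>E. \<exists>a\<in>A. \<exists>b\<in>B. e = {a, b}) \<and> T \<subseteq> A \<and> U \<subseteq> B \<and>
      card (A - T) = s1 \<and> card (B - U) = s2 \<and> card T = t1 \<and> card U = t2 \<and>
      (\<forall>a\<in>A. \<forall>b\<in>B. {a, b} \<in> E \<longleftrightarrow> \<not> (a \<in> T \<and> b \<in> U))"
  then obtain A B T U where AB: "A \<union> B = V" "A \<inter> B = {}" and edges: "\<forall>e\<in>E. \<exists>a\<in>A. \<exists>b\<in>B. e = {a, b}"
    and TU: "T \<subseteq> A" "U \<subseteq> B" and cards: "card (A - T) = s1" "card (B - U) = s2" "card T = t1" "card U = t2"
    and adj: "\<And>a b. a \<in> A \<Longrightarrow> b \<in> B \<Longrightarrow> {a, b} \<in> E \<longleftrightarrow> \<not> (a \<in> T \<and> b \<in> U)" by blast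
  have "finite V" using V by (simp add: simple_graph_def)
  then have fin: "finite (A - T)" "finite T" "finite U" "finite (B - U)"
    using AB TU by (auto intro: finite_subset)
  obtain f1 where f1: "bij_betw f1 (A - T) {1..s1}"
    using finite_same_card_bij[OF fin(1), of "{1..s1}"] cards by auto
  obtain f2 where f2: "bij_betw f2 T {s1 + 1..s1 + t1}"
    using finite_same_card_bij[OF fin(2), of "{s1 + 1..s1 + t1}"] cards by auto
  obtain f3 where f3: "bij_betw f3 U {s1 + t1 + 1..s1 + t1 + t2}"
    using finite_same_card_bij[OF fin(3), of "{s1 + t1 + 1..s1 + t1 + t2}"] cards by auto
  obtain f4 where f4: "bij_betw f4 (B - U) {s1 + t1 + t2 + 1..?n}"
    using finite_same_card_bij[OF fin(4), of "{s1 + t1 + t2 + 1..?n}"] cards by auto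
  define f where "f v = (if v \<in> T then f2 v else if v \<in> A then f1 v else if v \<in> U then f3 v else f4 v)" for v
  have b1: "bij_betw f (A - T) {1..s1}" using f1 by (rule bij_betw_cong[THEN iffD1, rotated]) (auto simp: f_def)
  have b2: "bij_betw f T {s1 + 1..s1 + t1}" using f2 by (rule bij_betw_cong[THEN iffD1, rotated]) (auto simp: f_def)
  have b3: "bij_betw f U {s1 + t1 + 1..s1 + t1 + t2}"
    using f3 by (rule bij_betw_cong[THEN iffD1, rotated]) (use TU AB(2) in \<open>auto simp: f_def\<close>)
  have b4: "bij_betw f (B - U) {s1 + t1 + t2 + 1..?n}"
    using f4 by (rule bij_betw_cong[THEN iffD1, rotated]) (use TU AB(2) in \<open>auto simp: f_def\<close>)
  have "bij_betw f ((A - T) \<union> T) ({1..s1} \<union> {s1 + 1..s1 + t1})" by (rule bij_betw_combine[OF b1 b2]) auto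
  moreover have "(A - T) \<union> T = A" "{1..s1} \<union> {s1 + 1..s1 + t1} = {1..s1 + t1}" using TU by auto
  ultimately have bA: "bij_betw f A {1..s1 + t1}" by simp
  have "bij_betw f (U \<union> (B - U)) ({s1 + t1 + 1..s1 + t1 + t2} \<union> {s1 + t1 + t2 + 1..?n})"
    by (rule bij_betw_combine[OF b3 b4]) auto
  moreover have "U \<union> (B - U) = B" "{s1 + t1 + 1..s1 + t1 + t2} \<union> {s1 + t1 + t2 + 1..?n} = {s1 + t1 + 1..?n}"
    using TU by auto
  ultimately have bB: "bij_betw f B {s1 + t1 + 1..?n}" by simp
  have "bij_betw f (A \<union> B) ({1..s1 + t1} \<union> {s1 + t1 + 1..?n})" by (rule bij_betw_combine[OF bA bB]) auto
  moreover have "{1..s1 + t1} \<union> {s1 + t1 + 1..?n} = {1..?n}" by auto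
  ultimately have bV: "bij_betw f V {1..?n}" using AB by simp
  have fA: "f a \<in> {1..s1 + t1}" if "a \<in> A" for a using bA that by (auto simp: bij_betw_def)
  have fB: "f b \<in> {s1 + t1 + 1..?n}" if "b \<in> B" for b using bB that by (auto simp: bij_betw_def)
  have fT: "s1 < f a \<longleftrightarrow> a \<in> T" if "a \<in> A" for a
  proof (cases "a \<in> T")
    case True
    then have "f a \<in> {s1 + 1..s1 + t1}" using b2 by (auto simp: bij_betw_def)
    then show ?thesis using True by simp
  next
    case False
    then have "f a \<in> {1..s1}" using b1 that by (auto simp: bij_betw_def)
    then show ?thesis using False by simp
  qed
  have fU: "f b \<le> s1 + t1 + t2 \<longleftrightarrow> b \<in> U" if "b \<in> B" for b
  proof (cases "b \<in> U")
    case True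
    then have "f b \<in> {s1 + t1 + 1..s1 + t1 + t2}" using b3 by (auto simp: bij_betw_def)
    then show ?thesis using True by simp
  next
    case False
    then have "f b \<in> {s1 + t1 + t2 + 1..?n}" using b4 that by (auto simp: bij_betw_def)
    then show ?thesis using False by simp
  qed
  have key: "{a, b} \<in> E \<longleftrightarrow> {f a, f b} \<in> K_edges s1 s2 t1 t2" if "a \<in> A" "b \<in> B" for a b
    using adj[OF that] fT[OF that(1)] fU[OF that(2)] K_edges_iff[OF fA[OF that(1)] fB[OF that(2)]] by simp
  have same: "{u, v} \<notin> E \<and> {f u, f v} \<notin> K_edges s1 s2 t1 t2" if "u \<in> A \<and> v \<in> A \<or> u \<in> B \<and> v \<in> B" for u v
  proof
    show "{u, v} \<notin> E"
    proof
      assume "{u, v} \<in> E"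
      then obtain a b where "a \<in> A" "b \<in> B" "{u, v} = {a, b}" using edges by blast
      then show False using that AB(2) by (auto simp: doubleton_eq_iff)
    qed
    show "{f u, f v} \<notin> K_edges s1 s2 t1 t2"
      using that K_edges_sides[of "f u" "f v" s1 s2 t1 t2] fA[of u] fA[of v] fB[of u] fB[of v] by auto
  qed
  have "{u, v} \<in> E \<longleftrightarrow> {f u, f v} \<in> K_edges s1 s2 t1 t2" if "u \<in> V" "v \<in> V" for u v
  proof -
    consider "u \<in> A" "v \<in> B" | "v \<in> A" "u \<in> B" | "u \<in> A \<and> v \<in> A \<or> u \<in> B \<and> v \<in> B"
      using \<open>u \<in> V\<close> \<open>v \<in> V\<close> AB(1) by blast
    then show ?thesis
      by cases (use key[of u v] key[of v u] same[of u v] in \<open>auto simp: insert_commute\<close>)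
  qed
  then show "graph_iso V E {1..?n} (K_edges s1 s2 t1 t2)"
    unfolding graph_iso_def using bV by blast
qed


section \<open>The edge ring inside a Laurent polynomial ring\<close>

text \<open>As \<open>nat\<close> sends negative integers to 0, this is the positive part of m, and
  m is the difference of \<open>nat_part m\<close> and \<open>nat_part (- m)\<close>.\<close>

definition nat_part :: "(nat \<Rightarrow>\<^sub>0 int) \<Rightarrow> (nat \<Rightarrow>\<^sub>0 nat)" where
  "nat_part m = Poly_Mapping.map nat m"

definition int_exponent :: "(nat \<Rightarrow>\<^sub>0 nat) \<Rightarrow> (nat \<Rightarrow>\<^sub>0 int)" where
  "int_exponent a = Poly_Mapping.map int a"

definition monomial_fract :: "(nat \<Rightarrow>\<^sub>0 nat) \<Rightarrow> 'k::field mpoly_ring fract" where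
  "monomial_fract a = to_fract (Poly_Mapping.single a 1)"

definition laurent_monomial :: "(nat \<Rightarrow>\<^sub>0 int) \<Rightarrow> 'k::field mpoly_ring fract" where
  "laurent_monomial m = monomial_fract (nat_part m) / monomial_fract (nat_part (- m))"

text \<open>Laurent polynomials are realised in the fraction field of the polynomial ring, because
  this is the field in which \<open>Cl\<close> forms its ideals.\<close>

definition laurent_eval :: "((nat \<Rightarrow>\<^sub>0 int) \<Rightarrow>\<^sub>0 'k) \<Rightarrow> 'k::field mpoly_ring fract" where
  "laurent_eval p = (\<Sum>m\<in>Poly_Mapping.keys p.
     to_fract (Poly_Mapping.single 0 (Poly_Mapping.lookup p m)) * laurent_monomial m)"

lemma lookup_nat_part [simp]: "Poly_Mapping.lookup (nat_part m) i = nat (Poly_Mapping.lookup m i)"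
  by (simp add: nat_part_def Poly_Mapping.map.rep_eq when_def)

lemma lookup_int_exponent [simp]: "Poly_Mapping.lookup (int_exponent a) i = int (Poly_Mapping.lookup a i)"
  by (simp add: int_exponent_def Poly_Mapping.map.rep_eq when_def)

lemma int_exponent_inj: "int_exponent a = int_exponent b \<longleftrightarrow> a = b"
  by (metis lookup_int_exponent of_nat_eq_iff poly_mapping_eqI)

lemma int_exponent_nat_part:
  "(\<And>i. 0 \<le> Poly_Mapping.lookup m i) \<Longrightarrow> int_exponent (nat_part m) = m"
  by (rule poly_mapping_eqI) simp

lemma monomial_fract_add: "monomial_fract (a + b) = monomial_fract a * monomial_fract b"
  by (simp add: monomial_fract_def mult_single flip: to_fract_mult)

lemma monomial_fract_nonzero: "monomial_fract a \<noteq> 0"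
  by (metis monomial_fract_def to_fract_eq_0_iff lookup_single_eq lookup_zero zero_neq_one)

text \<open>Positive parts are not additive, but the positive and the negative parts fail by the
  same amount, so the identity holds after cross multiplication.\<close>

lemma laurent_monomial_add: "laurent_monomial (m + n) = laurent_monomial m * laurent_monomial n"
proof -
  have "nat (a + b) + (nat (- a) + nat (- b)) = nat (- (a + b)) + (nat a + nat b)" for a b :: int
    by (cases "a \<ge> 0"; cases "b \<ge> 0"; cases "a + b \<ge> 0") simp_all
  then have "nat_part (m + n) + (nat_part (- m) + nat_part (- n)) = nat_part (- (m + n)) + (nat_part m + nat_part n)"
    by (intro poly_mapping_eqI) (simp only: lookup_add lookup_nat_part lookup_uminus)
  then have "monomial_fract (nat_part (m + n)) * (monomial_fract (nat_part (- m)) * monomial_fract (nat_part (- n)))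
      = (monomial_fract (nat_part (- (m + n))) * (monomial_fract (nat_part m) * monomial_fract (nat_part n))
        :: 'a mpoly_ring fract)"
    by (metis monomial_fract_add)
  moreover have "p / s = (u / q) * (v / r)"
    if "q \<noteq> 0" "r \<noteq> 0" "s \<noteq> 0" "p * (q * r) = s * (u * v)" for p q r s u v :: "'a mpoly_ring fract"
    using that by (simp add: field_simps)
  ultimately show ?thesis unfolding laurent_monomial_def using monomial_fract_nonzero by blast
qed

lemma laurent_monomial_int_exponent: "laurent_monomial (int_exponent a) = monomial_fract a"
proof -
  have "nat_part (int_exponent a) = a" "nat_part (- int_exponent a) = 0"
    by (rule poly_mapping_eqI, simp)+
  moreover have "monomial_fract 0 = (1 :: 'a mpoly_ring fract)"
    by (simp add: monomial_fract_def)
  ultimately show ?thesis by (simp add: laurent_monomial_def)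
qed

lemma laurent_eval_single:
  "laurent_eval (Poly_Mapping.single m c) = to_fract (Poly_Mapping.single 0 c) * laurent_monomial m"
  by (simp add: laurent_eval_def)

lemma laurent_eval_add: "laurent_eval (p + q) = laurent_eval p + laurent_eval q"
  unfolding laurent_eval_def
  by (rule setsum_keys_plus_distrib) (auto simp: single_add distrib_right)

lemma laurent_eval_zero: "laurent_eval 0 = 0"
  by (simp add: laurent_eval_def)

lemma laurent_eval_mult:
  "laurent_eval (p * q) = (laurent_eval p * laurent_eval q :: 'k::field mpoly_ring fract)"
proof -
  have single: "laurent_eval (Poly_Mapping.single m c * q) = laurent_eval (Poly_Mapping.single m c) * laurent_eval q"
    for m and c :: 'k and q
  proof -
    have "Poly_Mapping.keys q \<subseteq> UNIV" by simp
    then show ?thesis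
    proof (induction q rule: poly_mapping_keys_induct)
      case (single n d)
      have "to_fract (Poly_Mapping.single 0 (c * d)) =
          (to_fract (Poly_Mapping.single 0 c) * to_fract (Poly_Mapping.single 0 d) :: 'k mpoly_ring fract)"
        by (simp add: mult_single flip: to_fract_mult)
      then show ?case
        by (simp add: mult_single laurent_eval_single laurent_monomial_add mult_ac)
    qed (simp_all add: laurent_eval_zero laurent_eval_add distrib_left)
  qed
  have "Poly_Mapping.keys p \<subseteq> UNIV" by simp
  then show ?thesis
    by (induction p rule: poly_mapping_keys_induct)
      (simp_all add: single laurent_eval_zero laurent_eval_add distrib_right)
qed

lemma laurent_eval_one: "laurent_eval 1 = 1"
proof -
  have "laurent_eval (Poly_Mapping.single (int_exponent 0) 1) = (1 :: 'a mpoly_ring fract)"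
    unfolding laurent_eval_single laurent_monomial_int_exponent by (simp add: monomial_fract_def)
  moreover have "int_exponent 0 = 0" by (rule poly_mapping_eqI) simp
  ultimately show ?thesis by simp
qed

lemma laurent_eval_int_exponent:
  "laurent_eval (Poly_Mapping.single (int_exponent a) c) = to_fract (Poly_Mapping.single a c)"
  by (simp add: laurent_eval_single laurent_monomial_int_exponent monomial_fract_def mult_single flip: to_fract_mult)

lemma laurent_eval_polynomial:
  assumes "Poly_Mapping.keys p \<subseteq> range int_exponent"
  shows "\<exists>q. laurent_eval p = to_fract q \<and> (\<forall>a. Poly_Mapping.lookup q a = Poly_Mapping.lookup p (int_exponent a))"
  using assms
proof (induction p rule: poly_mapping_keys_induct)
  case zero
  then show ?case by (intro exI[of _ 0]) (simp add: laurent_eval_zero)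
next
  case (single m c)
  then obtain a where "m = int_exponent a" by blast
  then show ?case
    by (intro exI[of _ "Poly_Mapping.single a c"])
      (auto simp: laurent_eval_int_exponent lookup_single when_def int_exponent_inj)
next
  case (add p q)
  then obtain p' q' where "laurent_eval p = to_fract p'" "laurent_eval q = to_fract q'"
    "\<forall>a. Poly_Mapping.lookup p' a = Poly_Mapping.lookup p (int_exponent a)"
    "\<forall>a. Poly_Mapping.lookup q' a = Poly_Mapping.lookup q (int_exponent a)" by blast
  then show ?case by (intro exI[of _ "p' + q'"]) (simp add: laurent_eval_add lookup_add)
qed

lemma polynomial_laurent_eval:
  assumes "Poly_Mapping.keys q \<subseteq> S"
  shows "\<exists>p. laurent_eval p = to_fract q \<and> Poly_Mapping.keys p \<subseteq> int_exponent ` S"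
  using assms
proof (induction q rule: poly_mapping_keys_induct)
  case zero
  then show ?case by (intro exI[of _ 0]) (simp add: laurent_eval_zero)
next
  case (single m c)
  then show ?case
    by (intro exI[of _ "Poly_Mapping.single (int_exponent m) c"]) (auto simp: laurent_eval_int_exponent)
next
  case (add q r)
  then obtain q' r' where qr: "laurent_eval q' = to_fract q" "laurent_eval r' = to_fract r"
    "Poly_Mapping.keys q' \<subseteq> int_exponent ` S" "Poly_Mapping.keys r' \<subseteq> int_exponent ` S" by blast
  then have "Poly_Mapping.keys (q' + r') \<subseteq> int_exponent ` S" using keys_add[of q' r'] by blast
  then show ?case using qr by (intro exI[of _ "q' + r'"]) (simp add: laurent_eval_add)
qed

text \<open>A high monomial clears all negative exponents. The result is an ordinary polynomial with
  the same coefficients, and polynomials embed into the fraction field.\<close>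

lemma laurent_eval_eq_0:
  assumes "laurent_eval p = 0"
  shows "p = 0"
proof -
  \<comment> \<open>The sum of the negative parts of all exponents dominates each single
    one.\<close>
  define s where "s = (\<Sum>m\<in>Poly_Mapping.keys p. nat_part (- m))"
  define p' where "p' = p * Poly_Mapping.single (int_exponent s) 1"
  have "k \<in> range int_exponent" if k: "k \<in> Poly_Mapping.keys p'" for k
  proof -
    have "k - int_exponent s \<in> Poly_Mapping.keys p"
      using k by (auto simp: p'_def in_keys_iff lookup_times_single)
    then have "nat (- Poly_Mapping.lookup (k - int_exponent s) i) \<le> Poly_Mapping.lookup s i" for i
      using member_le_sum[of _ _ "\<lambda>m. nat (- Poly_Mapping.lookup m i)"]
      by (simp add: s_def lookup_sum)
    then have "0 \<le> Poly_Mapping.lookup k i" for i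
      by (simp add: lookup_minus) (metis add_diff_cancel_left' diff_ge_0_iff_ge nat_le_iff nle_le of_nat_0_le_iff minus_diff_eq diff_le_eq)
    then have "int_exponent (nat_part k) = k" by (rule int_exponent_nat_part)
    then show ?thesis by (metis rangeI)
  qed
  then obtain q where q: "laurent_eval p' = to_fract q"
    "\<And>a. Poly_Mapping.lookup q a = Poly_Mapping.lookup p' (int_exponent a)"
    using laurent_eval_polynomial[of p'] by blast
  have "to_fract q = 0" using assms by (simp add: p'_def laurent_eval_mult flip: q(1))
  then have "q = 0" by simp
  then have "Poly_Mapping.lookup p' k = 0" for k
    using q(2) \<open>\<And>k. k \<in> Poly_Mapping.keys p' \<Longrightarrow> k \<in> range int_exponent\<close>
    by (metis imageE in_keys_iff lookup_zero)
  then have "p' = 0" by (intro poly_mapping_eqI) simp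
  moreover have "Poly_Mapping.single (int_exponent s) (1::'a) \<noteq> 0"
    by (metis lookup_single_eq lookup_zero zero_neq_one)
  ultimately show ?thesis by (simp add: p'_def)
qed

section \<open>The edge ring as a toric ring\<close>

locale edge_ring_graph = two_connected_bipartite A B E for A B :: "nat set" and E :: "nat set set"
begin

text \<open>For W = A \<union> B this is the lattice M; smaller W allow for adding the vertices one
  by one.\<close>

definition balanced :: "nat set \<Rightarrow> (nat \<Rightarrow>\<^sub>0 int) set" where
  "balanced W = {m. Poly_Mapping.keys m \<subseteq> W \<and> sum (Poly_Mapping.lookup m) A = sum (Poly_Mapping.lookup m) B}"

definition form :: "nat + nat set \<Rightarrow> (nat \<Rightarrow>\<^sub>0 int) \<Rightarrow> int" where
  "form i m = facet_form i (Poly_Mapping.lookup m)"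

definition edge_exponent :: "nat \<Rightarrow> nat \<Rightarrow> (nat \<Rightarrow>\<^sub>0 int)" where
  "edge_exponent a b = Poly_Mapping.single a 1 + Poly_Mapping.single b 1"

lemma add_subgroup_balanced: "add_subgroup (balanced W)"
  unfolding add_subgroup_def
proof (intro conjI ballI)
  show "0 \<in> balanced W" by (simp add: balanced_def)
  fix x y assume xy: "x \<in> balanced W" "y \<in> balanced W"
  then have "Poly_Mapping.keys (x + y) \<subseteq> W" using keys_add[of x y] by (auto simp: balanced_def)
  then show "x + y \<in> balanced W" using xy by (simp add: balanced_def lookup_add sum.distrib)
next
  fix x assume "x \<in> balanced W"
  then show "- x \<in> balanced W" by (auto simp: balanced_def sum_negf in_keys_iff)
qed

lemma form_add: "form i (x + y) = form i x + form i y"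
  by (cases i) (simp_all add: form_def lookup_add sum.distrib)

lemma form_zero: "form i 0 = 0"
  by (cases i) (simp_all add: form_def)

lemma form_sum: "form i (sum f K) = (\<Sum>k\<in>K. form i (f k))"
  by (induction K rule: infinite_finite_induct) (simp_all add: form_add form_zero)

lemma lookup_edge_exponent: "Poly_Mapping.lookup (edge_exponent a b) = edge_vec a b"
  by (auto simp: edge_exponent_def edge_vec_def lookup_add lookup_single when_def fun_eq_iff)

lemma form_edge: "form i (edge_exponent a b) = facet_form i (edge_vec a b)"
  by (simp add: form_def lookup_edge_exponent)

lemma sum_edge_vec: "finite W \<Longrightarrow> sum (edge_vec a b) W = of_bool (a \<in> W) + of_bool (b \<in> W)"
  unfolding edge_vec_def by (simp add: sum.distrib of_bool_def)

lemma edge_exponent_balanced: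
  assumes "{a, b} \<in> E"
  shows "edge_exponent a b \<in> balanced (A \<union> B)"
proof -
  have ab: "a \<in> A \<and> b \<in> B \<or> a \<in> B \<and> b \<in> A" by (rule edge_cases[OF assms])
  have "Poly_Mapping.keys (edge_exponent a b) \<subseteq> A \<union> B"
    using keys_add[of "Poly_Mapping.single a (1::int)" "Poly_Mapping.single b 1"] ab
    by (auto simp: edge_exponent_def)
  moreover have "sum (edge_vec a b) A = sum (edge_vec a b) B"
    using ab disjoint unfolding sum_edge_vec[OF finite_A] sum_edge_vec[OF finite_B] by auto
  ultimately show ?thesis by (simp add: balanced_def lookup_edge_exponent)
qed

text \<open>The balance equation determines the coordinate at \<open>b0\<close>. Hence {b0} supports
  only the zero vector, and every further vertex contributes one free direction.\<close>

lemma factorial_balanced: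
  assumes b0: "b0 \<in> B" and W: "finite W" "W \<subseteq> A \<union> B - {b0}"
  shows "factorial_in (group_algebra (balanced (insert b0 W)) :: ((nat \<Rightarrow>\<^sub>0 int) \<Rightarrow>\<^sub>0 'k::field) set)"
  using W
proof (induction W)
  case empty
  have "m = 0" if m: "m \<in> balanced {b0}" for m
  proof -
    have 0: "Poly_Mapping.lookup m v = 0" if "v \<noteq> b0" for v
      using m that by (auto simp: balanced_def in_keys_iff)
    have "sum (Poly_Mapping.lookup m) A = 0"
    proof (rule sum.neutral, rule ballI)
      fix v assume "v \<in> A"
      then have "v \<noteq> b0" using b0 disjoint by blast
      then show "Poly_Mapping.lookup m v = 0" by (rule 0)
    qed
    moreover have "sum (Poly_Mapping.lookup m) B = Poly_Mapping.lookup m b0 + sum (Poly_Mapping.lookup m) (B - {b0})"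
      using finite_B b0 by (rule sum.remove)
    moreover have "sum (Poly_Mapping.lookup m) (B - {b0}) = 0"
      by (rule sum.neutral, rule ballI, rule 0) simp
    ultimately have "Poly_Mapping.lookup m b0 = 0" using m by (simp add: balanced_def)
    then show ?thesis using 0 by (intro poly_mapping_eqI) (metis lookup_zero)
  qed
  then have "balanced {b0} = {0}" using add_subgroup_0[OF add_subgroup_balanced] by blast
  then show ?case using factorial_in_group_algebra_trivial by metis
next
  case (insert v W)
  have v: "v \<in> A \<union> B" "v \<noteq> b0" "v \<notin> W" using insert by auto
  \<comment> \<open>The entry at \<open>b0\<close> restores the balance: it is 1 if v lies on the
    opposite side A and -1 if v lies on the side of \<open>b0\<close>. In neither case need b be an
    edge vector.\<close>
  define b :: "nat \<Rightarrow>\<^sub>0 int" where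
    "b = (if v \<in> A then Poly_Mapping.single v 1 + Poly_Mapping.single b0 1
      else Poly_Mapping.single v 1 - Poly_Mapping.single b0 1)"
  have lb: "Poly_Mapping.lookup b u = (if u = v then 1 else if u = b0 then (if v \<in> A then 1 else - 1) else 0)" for u
    using v(2) by (simp add: b_def lookup_add lookup_minus lookup_single when_def)
  have b_sum: "sum (Poly_Mapping.lookup b) A = sum (Poly_Mapping.lookup b) B"
  proof -
    have s: "sum (Poly_Mapping.lookup b) S = of_bool (v \<in> S) + (if v \<in> A then 1 else - 1) * of_bool (b0 \<in> S)"
      if "finite S" for S
    proof -
      have "sum (Poly_Mapping.lookup b) S =
          (\<Sum>u\<in>S. (if u = v then 1 else 0) + (if u = b0 then (if v \<in> A then 1 else - 1) else 0))"
        using v(2) by (intro sum.cong) (auto simp: lb)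
      then show ?thesis using that by (simp add: sum.distrib)
    qed
    show ?thesis using v b0 disjoint unfolding s[OF finite_A] s[OF finite_B] by auto
  qed
  show ?case
  proof (rule factorial_in_group_algebra_extend[OF _ add_subgroup_balanced add_subgroup_balanced])
    show "factorial_in (group_algebra (balanced (insert b0 W)) :: ((nat \<Rightarrow>\<^sub>0 int) \<Rightarrow>\<^sub>0 'k) set)"
      using insert by auto
    show "balanced (insert b0 W) \<subseteq> balanced (insert b0 (insert v W))" by (auto simp: balanced_def)
    show "b \<in> balanced (insert b0 (insert v W))"
      using b_sum by (auto simp: balanced_def in_keys_iff lb split: if_splits)
    show "Poly_Mapping.lookup b v = 1" by (simp add: lb)
    show "Poly_Mapping.lookup m v = 0" if "m \<in> balanced (insert b0 W)" for m
      using that v by (auto simp: balanced_def in_keys_iff)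
    fix m assume m: "m \<in> balanced (insert b0 (insert v W))"
    let ?d = "m - frag_cmul (Poly_Mapping.lookup m v) b"
    have ld: "Poly_Mapping.lookup ?d u = Poly_Mapping.lookup m u - Poly_Mapping.lookup m v * Poly_Mapping.lookup b u" for u
      by (simp add: lookup_minus)
    have "Poly_Mapping.lookup ?d u = 0" if "u \<notin> insert b0 W" for u
      using that m v by (cases "u = v") (auto simp: ld lb balanced_def in_keys_iff)
    then have "Poly_Mapping.keys ?d \<subseteq> insert b0 W" by (auto simp: in_keys_iff)
    moreover have "sum (Poly_Mapping.lookup ?d) A = sum (Poly_Mapping.lookup ?d) B"
      using m b_sum unfolding ld by (simp add: balanced_def sum_subtractf sum_distrib_left[symmetric])
    ultimately show "?d \<in> balanced (insert b0 W)" by (simp add: balanced_def)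
  qed
qed

lemma finite_facets: "finite facets"
  unfolding facets_def using finite_A finite_B finite_acceptable by simp

text \<open>The points that the locale asks for are edge vectors and sums of them. All facet forms
  are nonnegative on edges, so one summand of value 1 makes a form positive on the sum; for the
  facet i only edges at which form i vanishes are summed.\<close>

lemma toric_ring_graph:
  "toric_ring (laurent_eval :: ((nat \<Rightarrow>\<^sub>0 int) \<Rightarrow>\<^sub>0 'k::field) \<Rightarrow> _) (balanced (A \<union> B)) facets form"
proof
  note M = add_subgroup_balanced[of "A \<union> B"]
  have sum_M: "sum f K \<in> balanced (A \<union> B)" if "\<And>k. k \<in> K \<Longrightarrow> f k \<in> balanced (A \<union> B)"
    for f and K :: "(nat + nat set) set"
    using that by (induction K rule: infinite_finite_induct) (auto intro: add_subgroup_add[OF M] add_subgroup_0[OF M])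
  show "add_subgroup (balanced (A \<union> B))" by (rule M)
  show "factorial_in (group_algebra (balanced (A \<union> B)) :: ((nat \<Rightarrow>\<^sub>0 int) \<Rightarrow>\<^sub>0 'k) set)"
  proof -
    obtain b0 where b0: "b0 \<in> B" using card_sides(2) by fastforce
    have "insert b0 (A \<union> B - {b0}) = A \<union> B" using b0 by blast
    then show ?thesis
      using factorial_balanced[OF b0, of "A \<union> B - {b0}"] finite_A finite_B by simp
  qed
  show "finite facets" by (rule finite_facets)
  show "form i (x + y) = form i x + form i y" for i x y by (rule form_add)
  show "\<exists>s\<in>balanced (A \<union> B). form i s = 0 \<and> (\<forall>j\<in>facets - {i}. 0 < form j s)" if i: "i \<in> facets" for i
  proof -
    have "\<forall>j\<in>facets - {i}. \<exists>e. e \<in> balanced (A \<union> B) \<and> form i e = 0 \<and> form j e = 1 \<and> (\<forall>k\<in>facets. 0 \<le> form k e)"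
    proof
      fix j assume "j \<in> facets - {i}"
      then obtain a b where "{a, b} \<in> E" "facet_form i (edge_vec a b) = 0" "facet_form j (edge_vec a b) = 1"
        using facet_separation[OF i, of j] by blast
      then show "\<exists>e. e \<in> balanced (A \<union> B) \<and> form i e = 0 \<and> form j e = 1 \<and> (\<forall>k\<in>facets. 0 \<le> form k e)"
        using edge_exponent_balanced facet_form_nonneg by (intro exI[of _ "edge_exponent a b"]) (auto simp: form_edge)
    qed
    then obtain e where e: "\<And>j. j \<in> facets - {i} \<Longrightarrow>
        e j \<in> balanced (A \<union> B) \<and> form i (e j) = 0 \<and> form j (e j) = 1 \<and> (\<forall>k\<in>facets. 0 \<le> form k (e j))"
      by metis
    have "0 < form j (sum e (facets - {i}))" if j: "j \<in> facets - {i}" for j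
    proof -
      have "form j (e j) \<le> (\<Sum>k\<in>facets - {i}. form j (e k))"
        using e j finite_facets by (intro member_le_sum) auto
      then show ?thesis using e[OF j] by (simp add: form_sum)
    qed
    moreover have "form i (sum e (facets - {i})) = 0" using e by (simp add: form_sum)
    moreover have "sum e (facets - {i}) \<in> balanced (A \<union> B)" using e by (intro sum_M) auto
    ultimately show ?thesis by blast
  qed
  show "\<exists>m\<in>balanced (A \<union> B). form i m = 1" if "i \<in> facets" for i
    using facet_form_primitive[OF that] edge_exponent_balanced form_edge by metis
  show "\<exists>s\<in>balanced (A \<union> B). \<forall>i\<in>facets. 0 < form i s"
  proof -
    have "\<forall>j\<in>facets. \<exists>e. e \<in> balanced (A \<union> B) \<and> form j e = 1 \<and> (\<forall>k\<in>facets. 0 \<le> form k e)"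
    proof
      fix j assume "j \<in> facets"
      then obtain a b where "{a, b} \<in> E" "facet_form j (edge_vec a b) = 1"
        using facet_form_primitive by blast
      then show "\<exists>e. e \<in> balanced (A \<union> B) \<and> form j e = 1 \<and> (\<forall>k\<in>facets. 0 \<le> form k e)"
        using edge_exponent_balanced facet_form_nonneg by (intro exI[of _ "edge_exponent a b"]) (auto simp: form_edge)
    qed
    then obtain e where e: "\<And>j. j \<in> facets \<Longrightarrow>
        e j \<in> balanced (A \<union> B) \<and> form j (e j) = 1 \<and> (\<forall>k\<in>facets. 0 \<le> form k (e j))"
      by metis
    have "0 < form j (sum e facets)" if j: "j \<in> facets" for j
    proof -
      have "form j (e j) \<le> (\<Sum>k\<in>facets. form j (e k))"
        using e j finite_facets by (intro member_le_sum) auto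
      then show ?thesis using e[OF j] by (simp add: form_sum)
    qed
    moreover have "sum e facets \<in> balanced (A \<union> B)" using e by (intro sum_M) auto
    ultimately show ?thesis by blast
  qed
qed (simp_all add: laurent_eval_add laurent_eval_mult laurent_eval_one laurent_eval_eq_0)

text \<open>The exponents are natural numbers, so the inequalities of the vertex facets are built
  in.\<close>

definition edge_monoid :: "(nat \<Rightarrow>\<^sub>0 nat) set" where
  "edge_monoid = {a. Poly_Mapping.keys a \<subseteq> A \<union> B \<and> sum (Poly_Mapping.lookup a) A = sum (Poly_Mapping.lookup a) B \<and>
     (\<forall>T\<in>acceptable. sum (Poly_Mapping.lookup a) T \<le> sum (Poly_Mapping.lookup a) (N T))}"

lemma edge_monoid_add: "a \<in> edge_monoid \<Longrightarrow> b \<in> edge_monoid \<Longrightarrow> a + b \<in> edge_monoid"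
  using keys_add[of a b] unfolding edge_monoid_def
  by (auto simp: lookup_add sum.distrib add_mono)

lemma int_exponent_add: "int_exponent (a + b) = int_exponent a + int_exponent b"
  by (rule poly_mapping_eqI) (simp add: lookup_add)

lemma int_exponent_single: "int_exponent (Poly_Mapping.single v n) = Poly_Mapping.single v (int n)"
  by (rule poly_mapping_eqI) (simp add: lookup_single when_def)

lemma edge_monoid_iff:
  "a \<in> edge_monoid \<longleftrightarrow> int_exponent a \<in> balanced (A \<union> B) \<and> (\<forall>i\<in>facets. 0 \<le> form i (int_exponent a))"
proof -
  have k: "Poly_Mapping.keys (int_exponent a) = Poly_Mapping.keys a" by (auto simp: in_keys_iff)
  have s: "sum (Poly_Mapping.lookup (int_exponent a)) S = int (sum (Poly_Mapping.lookup a) S)" for S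
    by simp
  have "int_exponent a \<in> balanced (A \<union> B) \<longleftrightarrow>
      Poly_Mapping.keys a \<subseteq> A \<union> B \<and> sum (Poly_Mapping.lookup a) A = sum (Poly_Mapping.lookup a) B"
    unfolding balanced_def mem_Collect_eq k s by (simp only: of_nat_eq_iff)
  moreover have "(\<forall>i\<in>facets. 0 \<le> form i (int_exponent a)) \<longleftrightarrow>
      (\<forall>T\<in>acceptable. sum (Poly_Mapping.lookup a) T \<le> sum (Poly_Mapping.lookup a) (N T))"
    by (simp add: facets_def form_def ball_Un flip: of_nat_sum)
  ultimately show ?thesis by (simp add: edge_monoid_def)
qed

lemma edge_in_edge_monoid:
  assumes "{i, j} \<in> E"
  shows "Poly_Mapping.single i 1 + Poly_Mapping.single j 1 \<in> edge_monoid"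
proof -
  have "int_exponent (Poly_Mapping.single i 1 + Poly_Mapping.single j 1) = edge_exponent i j"
    by (simp add: int_exponent_add int_exponent_single edge_exponent_def)
  then show ?thesis
    unfolding edge_monoid_iff using edge_exponent_balanced[OF assms] facet_form_nonneg assms form_edge by simp
qed

lemma keys_edge_ring:
  assumes "p \<in> (edge_ring E :: 'k::field mpoly_ring set)"
  shows "Poly_Mapping.keys p \<subseteq> edge_monoid"
  using assms
proof induction
  case (const c)
  then show ?case by (auto simp: edge_monoid_def)
next
  case (edge i j)
  then show ?case using edge_in_edge_monoid by (simp add: var_def mult_single)
next
  case (add p q)
  then show ?case using keys_add[of p q] by blast
next
  case (mult p q)
  then show ?case using keys_mult[of p q] edge_monoid_add by blast
qed

text \<open>The inequalities of the acceptable sets yield Hall's condition for every subset of A, so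
  the exponent is a sum of edges and the monomial a product of generators. In effect this is the
  normality of the edge ring.\<close>

lemma monomial_in_edge_ring:
  assumes a: "a \<in> edge_monoid"
  shows "Poly_Mapping.single a 1 \<in> (edge_ring E :: 'k::field mpoly_ring set)"
proof -
  have "\<exists>b. Poly_Mapping.lookup b = Poly_Mapping.lookup a \<and> Poly_Mapping.single b 1 \<in> (edge_ring E :: 'k mpoly_ring set)"
  proof (rule hall_decomposition[where x = "Poly_Mapping.lookup a" and
      P = "\<lambda>x. \<exists>b. Poly_Mapping.lookup b = x \<and> Poly_Mapping.single b 1 \<in> (edge_ring E :: 'k mpoly_ring set)"])
    show "\<exists>b. Poly_Mapping.lookup b = (\<lambda>_. 0) \<and> Poly_Mapping.single b 1 \<in> (edge_ring E :: 'k mpoly_ring set)"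
    proof (intro exI[of _ 0] conjI)
      show "Poly_Mapping.lookup 0 = (\<lambda>_. 0)" by (rule ext) simp
      show "Poly_Mapping.single 0 1 \<in> (edge_ring E :: 'k mpoly_ring set)" by (rule edge_ring.const)
    qed
    show "\<exists>b. Poly_Mapping.lookup b = (\<lambda>v. x v + y v) \<and> Poly_Mapping.single b 1 \<in> (edge_ring E :: 'k mpoly_ring set)"
      if x: "\<exists>b. Poly_Mapping.lookup b = x \<and> Poly_Mapping.single b 1 \<in> (edge_ring E :: 'k mpoly_ring set)"
      and y: "\<exists>b. Poly_Mapping.lookup b = y \<and> Poly_Mapping.single b 1 \<in> (edge_ring E :: 'k mpoly_ring set)" for x y
    proof -
      from x obtain b where
        b: "Poly_Mapping.lookup b = x \<and> Poly_Mapping.single b 1 \<in> (edge_ring E :: 'k mpoly_ring set)"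
        by (rule exE)
      from y obtain c where
        c: "Poly_Mapping.lookup c = y \<and> Poly_Mapping.single c 1 \<in> (edge_ring E :: 'k mpoly_ring set)"
        by (rule exE)
      have "Poly_Mapping.single (b + c) 1 \<in> (edge_ring E :: 'k mpoly_ring set)"
        using edge_ring.mult[OF conjunct2[OF b] conjunct2[OF c]] by (simp add: mult_single)
      then show ?thesis
        using conjunct1[OF b] conjunct1[OF c] by (intro exI[of _ "b + c"]) (auto simp: lookup_add)
    qed
    show "\<exists>c. Poly_Mapping.lookup c = (\<lambda>v. of_bool (v = i) + of_bool (v = j)) \<and>
        Poly_Mapping.single c 1 \<in> (edge_ring E :: 'k mpoly_ring set)" if "{i, j} \<in> E" for i j
    proof -
      have "Poly_Mapping.single (Poly_Mapping.single i 1 + Poly_Mapping.single j 1) 1 \<in> (edge_ring E :: 'k mpoly_ring set)"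
        using edge_ring.edge[OF that] by (simp add: var_def mult_single)
      then show ?thesis
        by (intro exI[of _ "Poly_Mapping.single i 1 + Poly_Mapping.single j 1"])
          (auto simp: lookup_add lookup_single when_def fun_eq_iff)
    qed
    show "Poly_Mapping.lookup a v = 0" if "v \<notin> A \<union> B" for v
      using that a by (auto simp: edge_monoid_def in_keys_iff)
    show "sum (Poly_Mapping.lookup a) A = sum (Poly_Mapping.lookup a) B"
      using a by (simp add: edge_monoid_def)
    fix S assume S: "S \<subseteq> A"
    have "(\<Sum>v\<in>S. int (Poly_Mapping.lookup a v)) \<le> (\<Sum>v\<in>N S. int (Poly_Mapping.lookup a v))"
    proof (rule facet_inequalities_imp_hall[OF _ _ _ S])
      show "(\<Sum>v\<in>A. int (Poly_Mapping.lookup a v)) = (\<Sum>v\<in>B. int (Poly_Mapping.lookup a v))"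
        using a by (simp add: edge_monoid_def flip: of_nat_sum)
      show "(\<Sum>v\<in>T. int (Poly_Mapping.lookup a v)) \<le> (\<Sum>v\<in>N T. int (Poly_Mapping.lookup a v))"
        if "T \<in> acceptable" for T
        using a that by (simp add: edge_monoid_def flip: of_nat_sum)
    qed simp
    then show "sum (Poly_Mapping.lookup a) S \<le> sum (Poly_Mapping.lookup a) (N S)"
      by (simp flip: of_nat_sum)
  qed
  then show ?thesis by (metis poly_mapping_eqI)
qed

lemma mem_edge_ring_iff:
  "p \<in> (edge_ring E :: 'k::field mpoly_ring set) \<longleftrightarrow> Poly_Mapping.keys p \<subseteq> edge_monoid"
proof
  assume "Poly_Mapping.keys p \<subseteq> edge_monoid"
  then show "p \<in> edge_ring E"
  proof (induction p rule: poly_mapping_keys_induct)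
    case zero
    then show ?case using edge_ring.const[of "0::'k"] by simp
  next
    case (single m c)
    then have "Poly_Mapping.single 0 c * Poly_Mapping.single m 1 \<in> (edge_ring E :: 'k mpoly_ring set)"
      by (intro edge_ring.mult edge_ring.const monomial_in_edge_ring)
    then show ?case by (simp add: mult_single)
  qed (rule edge_ring.add)
qed (rule keys_edge_ring)

text \<open>The basis element \<open>None\<close> measures the imbalance of the vertex coordinates
  of a, and \<open>Some T\<close> the difference between its coordinate at T and the form of T on
  the vertex coordinates. All of these vanish exactly when a lists the facet values of a lattice
  vector, whose entries are then the vertex coordinates.\<close>

theorem Cl_edge_ring:
  shows "Cl (edge_ring E :: 'k::field mpoly_ring set) \<cong> free_Abelian_group (insert None (Some ` acceptable))"
    and "group (Cl (edge_ring E :: 'k::field mpoly_ring set))"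
proof -
  interpret toric_ring "laurent_eval :: ((nat \<Rightarrow>\<^sub>0 int) \<Rightarrow>\<^sub>0 'k) \<Rightarrow> _" "balanced (A \<union> B)" facets form
    by (rule toric_ring_graph)
  \<comment> \<open>The vertex facets force nonnegative entries, so the lattice points of the cone
    are exponents of ordinary polynomials.\<close>
  have cone: "m \<in> cone (\<lambda>_. 0) \<longleftrightarrow> m \<in> int_exponent ` edge_monoid" for m
  proof
    assume m: "m \<in> cone (\<lambda>_. 0)"
    have "0 \<le> Poly_Mapping.lookup m v" for v
    proof (cases "v \<in> A \<union> B")
      case True
      then have "Inl v \<in> facets" by (simp add: facets_def)
      then have "0 \<le> form (Inl v) m" using m by (simp add: cone_def)
      then show ?thesis by (simp add: form_def)
    next
      case False
      have "m \<in> balanced (A \<union> B)" using m by (simp add: cone_def)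
      then have "Poly_Mapping.lookup m v = 0" using False by (auto simp: balanced_def in_keys_iff)
      then show ?thesis by simp
    qed
    then have e: "int_exponent (nat_part m) = m" by (rule int_exponent_nat_part)
    then have "nat_part m \<in> edge_monoid" unfolding edge_monoid_iff using m by (simp add: cone_def)
    then show "m \<in> int_exponent ` edge_monoid" using e by (metis imageI)
  next
    assume "m \<in> int_exponent ` edge_monoid"
    then show "m \<in> cone (\<lambda>_. 0)" by (auto simp: cone_def edge_monoid_iff)
  qed
  have R: "to_fract ` (edge_ring E :: 'k mpoly_ring set) = R"
  proof (intro Set.set_eqI iffI)
    fix x assume "x \<in> to_fract ` (edge_ring E :: 'k mpoly_ring set)"
    then obtain q where q: "x = to_fract q" "Poly_Mapping.keys q \<subseteq> edge_monoid"
      by (auto simp: mem_edge_ring_iff)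
    then obtain p where "laurent_eval p = x" "Poly_Mapping.keys p \<subseteq> int_exponent ` edge_monoid"
      using polynomial_laurent_eval by blast
    then show "x \<in> R" using h_mem_J[of p "\<lambda>_. 0"] cone by blast
  next
    fix x assume "x \<in> R"
    then obtain p where p: "x = laurent_eval p" "Poly_Mapping.keys p \<subseteq> cone (\<lambda>_. 0)" by (rule J_E)
    then have sub: "Poly_Mapping.keys p \<subseteq> int_exponent ` edge_monoid" using cone by blast
    then have "Poly_Mapping.keys p \<subseteq> range int_exponent" by blast
    then obtain q where q: "x = to_fract q" "\<And>a. Poly_Mapping.lookup q a = Poly_Mapping.lookup p (int_exponent a)"
      using laurent_eval_polynomial p(1) by blast
    have "a \<in> edge_monoid" if "a \<in> Poly_Mapping.keys q" for a
    proof -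
      have "int_exponent a \<in> Poly_Mapping.keys p" using that q(2) by (simp add: in_keys_iff)
      then have "int_exponent a \<in> int_exponent ` edge_monoid" by (rule subsetD[OF sub])
      then show ?thesis by (auto simp: int_exponent_inj)
    qed
    then have "q \<in> edge_ring E" unfolding mem_edge_ring_iff by (rule subsetI)
    then show "x \<in> to_fract ` (edge_ring E :: 'k mpoly_ring set)" unfolding q(1) by (rule imageI)
  qed
  \<comment> \<open>Sets that are not acceptable receive the value 0, so that the support is finite
    and contained in the basis.\<close>
  define c where "c a u = (case u of None \<Rightarrow> (\<Sum>v\<in>A. a (Inl v)) - (\<Sum>v\<in>B. a (Inl v))
      | Some T \<Rightarrow> if T \<in> acceptable then a (Inr T) - facet_form (Inr T) (\<lambda>v. a (Inl v)) else 0)"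
    for a :: "nat + nat set \<Rightarrow> int" and u
  define \<theta> where "\<theta> a = Abs_poly_mapping (c a)" for a
  have c_supp: "{u. c a u \<noteq> 0} \<subseteq> insert None (Some ` acceptable)" for a
  proof
    fix u assume u: "u \<in> {u. c a u \<noteq> 0}"
    show "u \<in> insert None (Some ` acceptable)"
    proof (cases u)
      case (Some T)
      then show ?thesis using u by (cases "T \<in> acceptable") (simp_all add: c_def)
    qed simp
  qed
  have "finite {u. c a u \<noteq> 0}" for a
    by (rule finite_subset[OF c_supp]) (simp add: finite_acceptable)
  then have lookup_\<theta>: "Poly_Mapping.lookup (\<theta> a) = c a" for a by (simp add: \<theta>_def)
  let ?G = "free_Abelian_group (insert None (Some ` acceptable))"
  have closed: "\<theta> a \<in> carrier ?G" for a
    using c_supp[of a] by (simp add: subset_iff in_keys_iff lookup_\<theta>)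
  have c_add: "c (\<lambda>i. a i + b i) u = c a u + c b u" for a b u
    by (cases u) (simp_all add: c_def sum.distrib)
  have add: "\<theta> (\<lambda>i. a i + b i) = \<theta> a \<otimes>\<^bsub>?G\<^esub> \<theta> b" for a b
    unfolding mult_free_Abelian_group
    by (rule poly_mapping_eqI) (simp only: lookup_add lookup_\<theta> c_add)
  have surj: "\<exists>a. \<theta> a = x" if x: "x \<in> carrier ?G" for x
    proof -
      obtain v0 where v0: "v0 \<in> A" using card_sides(1) by fastforce
      \<comment> \<open>A weight at one vertex of A realises any imbalance. The coordinates at the
        sets T are then shifted by the values of their forms at w.\<close>
      define w where "w v = (if v = v0 then Poly_Mapping.lookup x None else 0)" for v
      define a where "a = case_sum w (\<lambda>T. Poly_Mapping.lookup x (Some T) + facet_form (Inr T) w)"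
      have w: "sum w A = Poly_Mapping.lookup x None" "sum w B = 0"
        using v0 disjoint finite_A finite_B by (auto simp: w_def)
      have "c a u = Poly_Mapping.lookup x u" for u
        using x w by (cases u) (auto simp: c_def a_def in_keys_iff)
      then show ?thesis by (intro exI[of _ a] poly_mapping_eqI) (simp add: lookup_\<theta>)
    qed
  have ker: "\<theta> a = \<one>\<^bsub>?G\<^esub> \<longleftrightarrow> (\<exists>m\<in>balanced (A \<union> B). \<forall>i\<in>facets. a i = form i m)" for a
    proof
      assume "\<theta> a = \<one>\<^bsub>?G\<^esub>"
      then have 0: "c a u = 0" for u by (metis lookup_\<theta> lookup_zero one_free_Abelian_group)
      define w where "w v = (if v \<in> A \<union> B then a (Inl v) else 0)" for v
      define m where "m = Abs_poly_mapping w"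
      have "finite {v. w v \<noteq> 0}"
        by (rule finite_subset[of _ "A \<union> B"]) (auto simp: w_def finite_A finite_B)
      then have m: "Poly_Mapping.lookup m = w" by (simp add: m_def)
      have sum_w: "sum w S = (\<Sum>v\<in>S. a (Inl v))" if "S \<subseteq> A \<union> B" for S
        using that by (intro sum.cong) (auto simp: w_def)
      have "Poly_Mapping.keys m \<subseteq> A \<union> B"
      proof
        fix v assume "v \<in> Poly_Mapping.keys m"
        then have "w v \<noteq> 0" by (simp add: in_keys_iff m)
        then show "v \<in> A \<union> B" unfolding w_def by presburger
      qed
      moreover have "sum w A = sum w B"
        using 0[of None] by (simp add: c_def sum_w)
      ultimately have "m \<in> balanced (A \<union> B)" by (simp add: balanced_def m)
      moreover have "a i = form i m" if i: "i \<in> facets" for i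
      proof (cases i)
        case (Inl v)
        then show ?thesis using i by (auto simp: form_def m w_def facets_def)
      next
        case (Inr T)
        then have T: "T \<in> acceptable" using i by (auto simp: facets_def)
        have "T \<subseteq> A \<union> B" "N T \<subseteq> A \<union> B" using acceptable_parts(1)[OF T] N_subset by blast+
        then show ?thesis using 0[of "Some T"] T sum_w Inr by (simp add: c_def form_def m)
      qed
      ultimately show "\<exists>m\<in>balanced (A \<union> B). \<forall>i\<in>facets. a i = form i m" by blast
    next
      assume "\<exists>m\<in>balanced (A \<union> B). \<forall>i\<in>facets. a i = form i m"
      then obtain m where m: "m \<in> balanced (A \<union> B)" "\<And>i. i \<in> facets \<Longrightarrow> a i = form i m" by blast
      have "a (Inl v) = Poly_Mapping.lookup m v" if "v \<in> A \<union> B" for v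
        using m(2)[of "Inl v"] that by (simp add: facets_def form_def)
      then have sum_a: "(\<Sum>v\<in>S. a (Inl v)) = sum (Poly_Mapping.lookup m) S" if "S \<subseteq> A \<union> B" for S
        using that by (intro sum.cong) auto
      have "c a u = 0" for u
      proof (cases u)
        case None
        then show ?thesis using sum_a[of A] sum_a[of B] m(1) by (simp add: c_def balanced_def)
      next
        case (Some T)
        show ?thesis
        proof (cases "T \<in> acceptable")
          case True
          have "T \<subseteq> A \<union> B" "N T \<subseteq> A \<union> B" using acceptable_parts(1)[OF True] N_subset by blast+
          then show ?thesis
            using Some True sum_a m(2)[of "Inr T"] by (simp add: c_def form_def facets_def)
        qed (simp add: c_def Some)
      qed
      then show "\<theta> a = \<one>\<^bsub>?G\<^esub>" by (auto intro!: poly_mapping_eqI simp: lookup_\<theta>)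
    qed
  show "Cl (edge_ring E :: 'k mpoly_ring set) \<cong> ?G" "group (Cl (edge_ring E :: 'k mpoly_ring set))"
    unfolding Cl_def R
    using class_group_iso[OF group_free_Abelian_group closed add surj ker] by simp_all
qed

section \<open>Comparison of the class group with Z and Z^2\<close>

lemma integer_group_square_iso:
  assumes "x \<noteq> y"
  shows "integer_group \<times>\<times> integer_group \<cong> free_Abelian_group {x, y}"
proof -
  let ?f = "\<lambda>(m, n). frag_cmul m (frag_of x) + frag_cmul n (frag_of y)"
  have l: "Poly_Mapping.lookup (frag_cmul m (frag_of x) + frag_cmul n (frag_of y)) u =
      (if u = x then m else if u = y then n else 0)" for m n u
    using assms by (simp add: lookup_add)
  have closed: "?f p \<in> carrier (free_Abelian_group {x, y})" for p
    by (cases p) (auto simp: in_keys_iff l split: if_splits)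
  have "?f \<in> iso (integer_group \<times>\<times> integer_group) (free_Abelian_group {x, y})"
  proof (rule isoI)
    show "?f \<in> hom (integer_group \<times>\<times> integer_group) (free_Abelian_group {x, y})"
    proof (rule homI)
      show "?f p \<in> carrier (free_Abelian_group {x, y})" for p by (rule closed)
      show "?f (p \<otimes>\<^bsub>integer_group \<times>\<times> integer_group\<^esub> q) = ?f p \<otimes>\<^bsub>free_Abelian_group {x, y}\<^esub> ?f q" for p q
        by (cases p; cases q) (simp add: frag_cmul_distrib add_ac)
    qed
    show "bij_betw ?f (carrier (integer_group \<times>\<times> integer_group)) (carrier (free_Abelian_group {x, y}))"
    proof (rule bij_betw_byWitness[where f' = "\<lambda>c. (Poly_Mapping.lookup c x, Poly_Mapping.lookup c y)"])
      show "\<forall>p\<in>carrier (integer_group \<times>\<times> integer_group). (Poly_Mapping.lookup (?f p) x, Poly_Mapping.lookup (?f p) y) = p"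
        using assms by (auto simp: l)
      show "\<forall>c\<in>carrier (free_Abelian_group {x, y}). ?f (Poly_Mapping.lookup c x, Poly_Mapping.lookup c y) = c"
        by (auto intro!: poly_mapping_eqI simp: l in_keys_iff subset_iff)
      show "?f ` carrier (integer_group \<times>\<times> integer_group) \<subseteq> carrier (free_Abelian_group {x, y})"
        by (intro image_subsetI closed)
    qed simp
  qed
  then show ?thesis by (rule is_isoI)
qed

text \<open>Free abelian groups are isomorphic exactly when their bases are equinumerous; the
  summand 1 counts the basis element \<open>None\<close>.\<close>

lemma Cl_iso_free_Abelian_group_iff:
  assumes H: "H \<cong> free_Abelian_group S" "group H" and S: "finite S"
  shows "Cl (edge_ring E :: 'k::field mpoly_ring set) \<cong> H \<longleftrightarrow> card acceptable + 1 = card S"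
proof -
  let ?C = "Cl (edge_ring E :: 'k mpoly_ring set)" and ?I = "insert None (Some ` acceptable)"
  note C = Cl_edge_ring[where ?'k = 'k]
  have "?C \<cong> H \<longleftrightarrow> free_Abelian_group ?I \<cong> free_Abelian_group S"
  proof
    assume "?C \<cong> H"
    then show "free_Abelian_group ?I \<cong> free_Abelian_group S"
      using group.iso_sym[OF C(2,1)] H(1) by (blast intro: iso_trans)
  next
    assume "free_Abelian_group ?I \<cong> free_Abelian_group S"
    then show "?C \<cong> H"
      using C(1) group.iso_sym[OF H(2,1)] by (blast intro: iso_trans)
  qed
  also have "\<dots> \<longleftrightarrow> ?I \<approx> S" by (rule isomorphic_free_Abelian_groups)
  also have "\<dots> \<longleftrightarrow> card ?I = card S"
    using S finite_acceptable by (simp add: eqpoll_iff_card)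
  also have "card ?I = card acceptable + 1"
    using finite_acceptable by (subst card_insert_disjoint) (auto simp: card_image)
  finally show ?thesis .
qed

lemma Cl_iso_integer_group_iff:
  "Cl (edge_ring E :: 'k::field mpoly_ring set) \<cong> integer_group \<longleftrightarrow> acceptable = {}"
  using Cl_iso_free_Abelian_group_iff[OF isomorphic_group_integer_free_Abelian_group_singleton[of "0::nat"]]
    finite_acceptable by simp

lemma Cl_iso_integer_group_square_iff:
  "Cl (edge_ring E :: 'k::field mpoly_ring set) \<cong> integer_group \<times>\<times> integer_group \<longleftrightarrow> (\<exists>T. acceptable = {T})"
proof -
  have "Cl (edge_ring E :: 'k mpoly_ring set) \<cong> integer_group \<times>\<times> integer_group \<longleftrightarrow> card acceptable + 1 = card {0, 1::nat}"
    by (intro Cl_iso_free_Abelian_group_iff integer_group_square_iso DirProd_group) auto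
  then show ?thesis by (simp add: card_1_singleton_iff)
qed

end

text \<open>The sides are arbitrary, so that the same ring can be studied with a bipartition
  suggested by an isomorphism.\<close>

lemma edge_ring_graphI:
  assumes G: "simple_graph V E" "two_connected V E"
    and AB: "A \<union> B = V" "A \<inter> B = {}" "\<forall>e\<in>E. \<exists>a\<in>A. \<exists>b\<in>B. e = {a, b}"
  shows "edge_ring_graph A B E"
proof (intro edge_ring_graph.intro two_connected_bipartite.intro)
  have "finite V" and sub: "\<And>e. e \<in> E \<Longrightarrow> e \<subseteq> V" using G(1) by (auto simp: simple_graph_def)
  then show "finite A" "finite B" using AB(1) by auto
  show "A \<inter> B = {}" by (rule AB(2))
  show "\<exists>a\<in>A. \<exists>b\<in>B. e = {a, b}" if "e \<in> E" for e using AB(3) that by blast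
  show "cut_connected E (A \<union> B)"
    unfolding AB(1) using G(2) sub
    by (intro connected_graph_cut_connected[of V E]) (auto simp: two_connected_def)
  show "cut_connected E (A \<union> B - {v})" if "v \<in> A \<union> B" for v
    unfolding AB(1)
    by (rule connected_graph_cut_connected[of _ "{e \<in> E. v \<notin> e}"])
      (use G(2) sub that AB(1) in \<open>auto simp: two_connected_def\<close>)
  show "3 \<le> card (A \<union> B)" using G(2) AB(1) by (simp add: two_connected_def)
qed

theorem theorem4p7:
  fixes d :: nat and E :: "nat set set"
  assumes "simple_graph {1..d} E"
    and "two_connected {1..d} E"
    and "bipartite {1..d} E"
  shows "(Cl (edge_ring E :: 'k::field mpoly_ring set) \<cong> integer_group \<longleftrightarrow>
        (\<exists>s1 s2. s1 \<ge> 2 \<and> s2 \<ge> 2 \<and>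
          graph_iso {1..d} E {1..s1 + s2} (complete_bipartite_edges s1 s2))) \<and>
     (Cl (edge_ring E :: 'k mpoly_ring set) \<cong> integer_group \<times>\<times> integer_group \<longleftrightarrow>
        (\<exists>s1 s2 t1 t2. t1 \<ge> 1 \<and> t2 \<ge> 1 \<and> s1 \<ge> 2 \<and> s2 \<ge> 2 \<and>
          graph_iso {1..d} E {1..s1 + s2 + t1 + t2} (K_edges s1 s2 t1 t2)))"
proof -
  note iso_iff = graph_iso_K_edges_iff[OF assms(1)]
  obtain A B where AB: "A \<union> B = {1..d}" "A \<inter> B = {}" "\<forall>e\<in>E. \<exists>a\<in>A. \<exists>b\<in>B. e = {a, b}"
    using assms(3) unfolding bipartite_def by blast
  interpret G: edge_ring_graph A B E by (rule edge_ring_graphI[OF assms(1,2) AB])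
  show ?thesis
  proof (intro conjI iffI)
    assume "Cl (edge_ring E :: 'k mpoly_ring set) \<cong> integer_group"
    then have "\<forall>a\<in>A. \<forall>b\<in>B. {a, b} \<in> E"
      by (simp add: G.Cl_iso_integer_group_iff G.acceptable_eq_empty_iff)
    \<comment> \<open>Complete bipartite graphs are the case T = U = {}, which explains the
      zeros.\<close>
    then have "graph_iso {1..d} E {1..card A + card B + 0 + 0} (K_edges (card A) (card B) 0 0)"
      unfolding iso_iff using AB by (intro exI[of _ A] exI[of _ B] exI[of _ "{}"]) auto
    then show "\<exists>s1 s2. s1 \<ge> 2 \<and> s2 \<ge> 2 \<and> graph_iso {1..d} E {1..s1 + s2} (complete_bipartite_edges s1 s2)"
      using G.card_sides by (intro exI[of _ "card A"] exI[of _ "card B"]) (simp add: K_edges_0_0)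
  next
    assume "\<exists>s1 s2. s1 \<ge> 2 \<and> s2 \<ge> 2 \<and> graph_iso {1..d} E {1..s1 + s2} (complete_bipartite_edges s1 s2)"
    then obtain s1 s2 where "graph_iso {1..d} E {1..s1 + s2 + 0 + 0} (K_edges s1 s2 0 0)"
      by (auto simp: K_edges_0_0)
    then obtain A B T U where AB: "A \<union> B = {1..d}" "A \<inter> B = {}" "\<forall>e\<in>E. \<exists>a\<in>A. \<exists>b\<in>B. e = {a, b}"
      and T: "T \<subseteq> A" "card T = 0" and adj: "\<forall>a\<in>A. \<forall>b\<in>B. {a, b} \<in> E \<longleftrightarrow> \<not> (a \<in> T \<and> b \<in> U)"
      unfolding iso_iff by (elim exE conjE) (rule that)
    \<comment> \<open>The sides read off from the isomorphism may differ from those fixed at the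
      beginning, so the class group is computed anew from them.\<close>
    interpret H: edge_ring_graph A B E by (rule edge_ring_graphI[OF assms(1,2) AB])
    have "T = {}" using T finite_subset[OF T(1) H.finite_A] by simp
    then have "H.acceptable = {}" using adj by (simp add: H.acceptable_eq_empty_iff)
    then show "Cl (edge_ring E :: 'k mpoly_ring set) \<cong> integer_group"
      by (simp add: H.Cl_iso_integer_group_iff)
  next
    assume "Cl (edge_ring E :: 'k mpoly_ring set) \<cong> integer_group \<times>\<times> integer_group"
    then obtain T where T: "G.acceptable = {T}" using G.Cl_iso_integer_group_square_iff by blast
    then have "T \<in> G.acceptable" by simp
    note p = G.acceptable_parts[OF this]
    \<comment> \<open>The missing edges form the product of T and this set; s1 and s2 become the
      sizes of A - T and N T.\<close>
    let ?U = "B - G.N T"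
    have BU: "B - ?U = G.N T" using G.N_subset by blast
    have "graph_iso {1..d} E {1..card (A - T) + card (G.N T) + card T + card ?U}
        (K_edges (card (A - T)) (card (G.N T)) (card T) (card ?U))"
      unfolding iso_iff
    proof (rule exI[of _ A], rule exI[of _ B], rule exI[of _ T], rule exI[of _ ?U], intro conjI)
      show "card (B - ?U) = card (G.N T)" by (simp only: BU)
      show "?U \<subseteq> B" by blast
    qed (fact AB p(1) G.acceptable_singletonD(1)[OF T] refl)+
    moreover have "card T \<ge> 1"
      using p(2) finite_subset[OF p(1) G.finite_A] by (simp add: Suc_le_eq card_gt_0_iff)
    moreover have "card ?U \<ge> 1"
      using p(5) G.finite_B by (simp add: Suc_le_eq card_gt_0_iff)
    ultimately show "\<exists>s1 s2 t1 t2. t1 \<ge> 1 \<and> t2 \<ge> 1 \<and> s1 \<ge> 2 \<and> s2 \<ge> 2 \<and>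
        graph_iso {1..d} E {1..s1 + s2 + t1 + t2} (K_edges s1 s2 t1 t2)"
      using G.acceptable_singletonD(2,3)[OF T] by blast
  next
    assume "\<exists>s1 s2 t1 t2. t1 \<ge> 1 \<and> t2 \<ge> 1 \<and> s1 \<ge> 2 \<and> s2 \<ge> 2 \<and>
        graph_iso {1..d} E {1..s1 + s2 + t1 + t2} (K_edges s1 s2 t1 t2)"
    then obtain s1 s2 t1 t2 where s: "t1 \<ge> 1" "t2 \<ge> 1" "s1 \<ge> 2" "s2 \<ge> 2"
      and iso: "graph_iso {1..d} E {1..s1 + s2 + t1 + t2} (K_edges s1 s2 t1 t2)" by blast
    obtain A B T U where AB: "A \<union> B = {1..d}" "A \<inter> B = {}" "\<forall>e\<in>E. \<exists>a\<in>A. \<exists>b\<in>B. e = {a, b}"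
      and TU: "T \<subseteq> A" "U \<subseteq> B" "card (A - T) = s1" "card (B - U) = s2" "card T = t1" "card U = t2"
      and adj: "\<forall>a\<in>A. \<forall>b\<in>B. {a, b} \<in> E \<longleftrightarrow> \<not> (a \<in> T \<and> b \<in> U)"
      using iso unfolding iso_iff by (elim exE conjE) (rule that)
    interpret H: edge_ring_graph A B E by (rule edge_ring_graphI[OF assms(1,2) AB])
    \<comment> \<open>The four sizes are positive, so T and U are nonempty and proper, and all
      missing edges come from the single product of T and U.\<close>
    have "T \<noteq> {}" "U \<noteq> {}" "T \<noteq> A" "U \<noteq> B" using TU(3-6) s by auto
    then have "H.acceptable = {T}" using TU(1,2) adj by (intro H.acceptable_singletonI) auto
    then show "Cl (edge_ring E :: 'k mpoly_ring set) \<cong> integer_group \<times>\<times> integer_group"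
      by (simp add: H.Cl_iso_integer_group_square_iff)
  qed
qed

end
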